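(* Let $\mathfrak g=sl_{r+1}$, let $\boldsymbol\Lambda=(\Lambda_1,\dots,\Lambda_n)$ be a collection of integral dominant $sl_{r+1}$-weights and $\boldsymbol l=(l_1,\dots,l_r)$ a sequence of non-negative integers such that $\Lambda-\alpha(\boldsymbol l)$ is integral dominant, where $\Lambda=\Lambda_1+\dots+\Lambda_n$ and $\alpha(\boldsymbol l)=l_1\alpha_1+\dots+l_r\alpha_r$. Let $z\in\mathbb C^n$ be a point with distinct coordinates and let $t^0$ be a non-degenerate critical point of the master function $\Phi(\,\cdot\,,z,\boldsymbol\Lambda,\boldsymbol l)$. Then the corresponding Bethe vector $\omega(t^0,z)\in V_{\boldsymbol\Lambda}[\Lambda-\alpha(\boldsymbol l)]$ is a non-zero vector.
   Context: $sl_{r+1}$ (over $\mathbb C$) has Chevalley generators $E_i,H_i,F_i$, $i=1,\dots,r$, Cartan subalgebra $\mathfrak h$, simple roots $\alpha_1,\dots,\alpha_r\in\mathfrak h^*$, and invariant form normalized by $(\alpha_i,\alpha_i)=2$, $(\alpha_i,\alpha_{i\pm1})=-1$, $(\alpha_i,\alpha_j)=0$ if $|i-j|>1$. For $\mu\in\mathfrak h^*$, $V_\mu$ is the irreducible module with highest weight $\mu$ and fixed highest weight vector $v_\mu$. $V_{\boldsymbol\Lambda}=V_{\Lambda_1}\otimes\dots\otimes V_{\Lambda_n}$. For a module $V$, $V[\mu]$ is the weight subspace of weight $\mu$. Master function: put $l=l_1+\dots+l_r$ and let $c:\{1,\dots,l\}\to\{1,\dots,r\}$ be the unique non-decreasing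 function with $\#c^{-1}(i)=l_i$. For $t=(t_1,\dots,t_l)$, $z=(z_1,\dots,z_n)$, $$\Phi(t,z,\boldsymbol\Lambda,\boldsymbol l)=\prod_{i<j}(z_i-z_j)^{(\Lambda_i,\Lambda_j)}\prod_{i=1}^l\prod_{s=1}^n(t_i-z_s)^{-(\alpha_{c(i)},\Lambda_s)}\prod_{1\le i<j\le l}(t_i-t_j)^{(\alpha_{c(i)},\alpha_{c(j)})}.$$ A point $t\in\mathbb C^l$ is a critical point of $\Phi(\,\cdot\,,z,\boldsymbol\Lambda,\boldsymbol l)$ if $$-\sum_{s=1}^n\frac{(\alpha_{c(i)},\Lambda_s)}{t_i-z_s}+\sum_{j\ne i}\frac{(\alpha_{c(i)},\alpha_{c(j)})}{t_i-t_j}=0,\qquad i=1,\dots,l.$$ Terms with zero numerator (and factors with zero exponent) are omitted; the other denominators are required to be non-zero, so $t_i=z_s$ is allowed only if $(\alpha_{c(i)},\Lambda_s)=0$ and $t_i=t_j$, $i\neq j$, only if $(\alpha_{c(i)},\alpha_{c(j)})=0$. A critical point $t^0$ is non-degenerate if $\det\big(\partial^2\log\Phi/\partial t_i\partial t_j\big)_{i,j=1}^l(t^0)\neq0$. If $l=0$, $\mathbb C^0$ is a single point, regarded as a non-degenerate critical point. Universal weight function and Bethe vectors: let $P(\boldsymbol l,n)$ be the set of sequences $I=(i^1_1,\dots,i^1_{j_1};\dots;i^n_1,\dots,i^n_{j_n})$ in $\{1,\dots,r\}$ (with $j_s\ge 0$) in which each $i$ appears exactly $l_i$ times. For a permutation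 $\sigma$ of $\{1,\dots,l\}$ put $\sigma_s(i)=\sigma(j_1+\dots+j_{s-1}+i)$, $i=1,\dots,j_s$, and let $\Sigma(I)$ be the set of $\sigma$ with $c(\sigma_s(j))=i^s_j$ for all $s,j$. Put $F_Iv=F_{i^1_1}\cdots F_{i^1_{j_1}}v_{\Lambda_1}\otimes\cdots\otimes F_{i^n_1}\cdots F_{i^n_{j_n}}v_{\Lambda_n}$, $\ \omega_{a_1,\dots,a_j}(z_s)=\frac{1}{(t_{a_1}-t_{a_2})\cdots(t_{a_{j-1}}-t_{a_j})(t_{a_j}-z_s)}$ (equal to $1$ for $j=0$), $\omega_{I,\sigma}=\prod_{s=1}^n\omega_{\sigma_s(1),\dots,\sigma_s(j_s)}(z_s)$, and $$\omega(t,z)=\sum_{I\in P(\boldsymbol l,n)}\sum_{\sigma\in\Sigma(I)}\omega_{I,\sigma}\,F_Iv\in V_{\boldsymbol\Lambda}[\Lambda-\alpha(\boldsymbol l)].$$ As a $V_{\boldsymbol\Lambda}$-valued rational function, $\omega$ is regular at $(t,z)$ when $z$ has distinct coordinates and $t$ is a critical point (possible apparent poles cancel); its value there is the Bethe vector corresponding to $t$. *)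

theory Defs
  imports "HOL-Analysis.Analysis" "HOL-Library.Function_Algebras"
    "Jordan_Normal_Form.Determinant"
begin

text \<open>Indices of nodes, tensor factors and variables start at \<open>1\<close>, but the entries of a
  matrix are indexed from \<open>0\<close>.\<close>

section \<open>The Lie algebra \<open>sl\<^sub>r\<^sub>+\<^sub>1\<close> and its weights\<close>

definition sl :: "nat \<Rightarrow> complex mat set" where
  "sl r = {x \<in> carrier_mat (r + 1) (r + 1). (\<Sum>a<r + 1. x $$ (a, a)) = 0}"

definition cartan :: "nat \<Rightarrow> complex mat set" where
  "cartan r = {h \<in> sl r. diagonal_mat h}"

definition unit_mat :: "nat \<Rightarrow> nat \<Rightarrow> nat \<Rightarrow> complex mat" where
  "unit_mat r a b = mat (r + 1) (r + 1) (\<lambda>(i, j). if i + 1 = a \<and> j + 1 = b then 1 else 0)"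

definition chev_E :: "nat \<Rightarrow> nat \<Rightarrow> complex mat" where
  "chev_E r i = unit_mat r i (i + 1)"

definition chev_F :: "nat \<Rightarrow> nat \<Rightarrow> complex mat" where
  "chev_F r i = unit_mat r (i + 1) i"

definition chev_H :: "nat \<Rightarrow> nat \<Rightarrow> complex mat" where
  "chev_H r i = unit_mat r i i - unit_mat r (i + 1) (i + 1)"

text \<open>A weight is a linear functional on the Cartan subalgebra; the values of the HOL function
  outside \<open>cartan r\<close> are irrelevant.\<close>

type_synonym weight = "complex mat \<Rightarrow> complex"

definition is_weight :: "nat \<Rightarrow> weight \<Rightarrow> bool" where
  "is_weight r \<mu> \<longleftrightarrow>
     (\<forall>h\<in>cartan r. \<forall>k\<in>cartan r. \<mu> (h + k) = \<mu> h + \<mu> k) \<and>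
     (\<forall>h\<in>cartan r. \<forall>a. \<mu> (a \<cdot>\<^sub>m h) = a * \<mu> h)"

definition simple_root :: "nat \<Rightarrow> weight" where
  "simple_root i = (\<lambda>h. h $$ (i - 1, i - 1) - h $$ (i, i))"

definition integral_dominant :: "nat \<Rightarrow> weight \<Rightarrow> bool" where
  "integral_dominant r \<mu> \<longleftrightarrow> is_weight r \<mu> \<and> (\<forall>i\<in>{1..r}. \<mu> (chev_H r i) \<in> \<nat>)"

text \<open>The invariant form on \<open>\<hh>\<^sup>*\<close> is dual to the trace form on \<open>\<hh>\<close>. It is written here through
  the projections \<open>e\<^sub>a\<^sub>a - 1/(r+1)\<close> to \<open>\<hh>\<close> of the diagonal matrix units; the lemma below gives its
  normalization on the basis of simple roots.\<close>

definition proj_unit :: "nat \<Rightarrow> nat \<Rightarrow> complex mat" where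
  "proj_unit r a = unit_mat r a a - (1 / of_nat (r + 1)) \<cdot>\<^sub>m 1\<^sub>m (r + 1)"

definition weight_form :: "nat \<Rightarrow> weight \<Rightarrow> weight \<Rightarrow> complex" where
  "weight_form r \<mu> \<nu> = (\<Sum>a = 1..r + 1. \<mu> (proj_unit r a) * \<nu> (proj_unit r a))"

lemma simple_root_proj_unit:
  assumes "i \<in> {1..r}" "a \<in> {1..r + 1}"
  shows "simple_root i (proj_unit r a) = (if a = i then 1 else 0) - (if a = i + 1 then 1 else 0)"
  using assms by (auto simp: simple_root_def proj_unit_def unit_mat_def)

lemma weight_form_simple_root:
  assumes "i \<in> {1..r}" "j \<in> {1..r}"
  shows "weight_form r (simple_root i) (simple_root j) =
    (if i = j then 2 else if i = j + 1 \<or> j = i + 1 then - 1 else 0)"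
proof -
  have "weight_form r (simple_root i) (simple_root j) = 
     (\<Sum>a = 1..r + 1. (if a = i then (if a = j then 1 else 0) - (if a = j + 1 then 1 else 0) else 0)
        - (if a = i + 1 then (if a = j then 1 else 0) - (if a = j + 1 then 1 else 0) else 0))"
    unfolding weight_form_def using assms
    by (intro sum.cong) (auto simp: simple_root_proj_unit)
  then show ?thesis
    using assms unfolding sum_subtractf by (simp add: sum.delta)
qed

definition lowered_weight :: "nat \<Rightarrow> nat \<Rightarrow> (nat \<Rightarrow> weight) \<Rightarrow> (nat \<Rightarrow> nat) \<Rightarrow> weight" where
  "lowered_weight r n \<Lambda> l =
     (\<lambda>h. (\<Sum>s = 1..n. \<Lambda> s h) - (\<Sum>i = 1..r. of_nat (l i) * simple_root i h))"

section \<open>Modules\<close>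

text \<open>A module is a subspace \<open>V\<close> of an ambient complex vector space \<open>'v\<close> with scalar multiplication
  \<open>sc\<close>, together with an action \<open>\<rho>\<close>. The ambient space only allows
  modules of different dimensions to have the same HOL type.\<close>

definition sl_module ::
  "nat \<Rightarrow> (complex \<Rightarrow> 'v \<Rightarrow> 'v) \<Rightarrow> 'v::ab_group_add set \<Rightarrow> (complex mat \<Rightarrow> 'v \<Rightarrow> 'v) \<Rightarrow> bool" where
  "sl_module r sc V \<rho> \<longleftrightarrow>
     vector_space sc \<and> module.subspace sc V \<and>
     (\<forall>x\<in>sl r. \<forall>u\<in>V. \<rho> x u \<in> V) \<and>
     (\<forall>x\<in>sl r. \<forall>u\<in>V. \<forall>w\<in>V. \<rho> x (u + w) = \<rho> x u + \<rho> x w) \<and>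
     (\<forall>x\<in>sl r. \<forall>u\<in>V. \<forall>a. \<rho> x (sc a u) = sc a (\<rho> x u)) \<and>
     (\<forall>x\<in>sl r. \<forall>y\<in>sl r. \<forall>u\<in>V. \<rho> (x + y) u = \<rho> x u + \<rho> y u) \<and>
     (\<forall>x\<in>sl r. \<forall>u\<in>V. \<forall>a. \<rho> (a \<cdot>\<^sub>m x) u = sc a (\<rho> x u)) \<and>
     (\<forall>x\<in>sl r. \<forall>y\<in>sl r. \<forall>u\<in>V. \<rho> (x * y - y * x) u = \<rho> x (\<rho> y u) - \<rho> y (\<rho> x u))"

definition irreducible_module ::
  "nat \<Rightarrow> (complex \<Rightarrow> 'v \<Rightarrow> 'v) \<Rightarrow> 'v::ab_group_add set \<Rightarrow> (complex mat \<Rightarrow> 'v \<Rightarrow> 'v) \<Rightarrow> bool" where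
  "irreducible_module r sc V \<rho> \<longleftrightarrow>
     sl_module r sc V \<rho> \<and> V \<noteq> {0} \<and>
     (\<forall>U. U \<subseteq> V \<and> module.subspace sc U \<and> (\<forall>x\<in>sl r. \<forall>u\<in>U. \<rho> x u \<in> U) \<longrightarrow> U = {0} \<or> U = V)"

definition weight_space ::
  "nat \<Rightarrow> (complex \<Rightarrow> 'v \<Rightarrow> 'v) \<Rightarrow> 'v set \<Rightarrow> (complex mat \<Rightarrow> 'v \<Rightarrow> 'v) \<Rightarrow> weight \<Rightarrow> 'v set" where
  "weight_space r sc V \<rho> \<mu> = {u \<in> V. \<forall>h\<in>cartan r. \<rho> h u = sc (\<mu> h) u}"

definition highest_weight_vector ::
  "nat \<Rightarrow> (complex \<Rightarrow> 'v \<Rightarrow> 'v) \<Rightarrow> 'v::ab_group_add set \<Rightarrow> (complex mat \<Rightarrow> 'v \<Rightarrow> 'v) \<Rightarrow> weight \<Rightarrow> 'v \<Rightarrow> bool" where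
  "highest_weight_vector r sc V \<rho> \<mu> v \<longleftrightarrow>
     v \<noteq> 0 \<and> v \<in> weight_space r sc V \<rho> \<mu> \<and> (\<forall>i\<in>{1..r}. \<rho> (chev_E r i) v = 0)"

section \<open>Tensor products\<close>

text \<open>The tensor product of \<open>V\<^sub>1, \<dots>, V\<^sub>n\<close> is realized inside the dual of the space of multilinear forms
  on \<open>V\<^sub>1 \<times> \<dots> \<times> V\<^sub>n\<close>, as the span of the evaluations \<open>u\<^sub>1 \<otimes> \<dots> \<otimes> u\<^sub>n\<close> at tuples of vectors.
  Tuples are extensional functions, and elements of the dual are made \<open>0\<close> on functions that
  are not multilinear forms.\<close>

type_synonym 'v tensor = "((nat \<Rightarrow> 'v) \<Rightarrow> complex) \<Rightarrow> complex"

definition multilinear_form ::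
  "nat \<Rightarrow> (complex \<Rightarrow> 'v \<Rightarrow> 'v) \<Rightarrow> (nat \<Rightarrow> 'v::ab_group_add set) \<Rightarrow> ((nat \<Rightarrow> 'v) \<Rightarrow> complex) \<Rightarrow> bool" where
  "multilinear_form n sc V \<phi> \<longleftrightarrow>
     (\<forall>u \<in> (\<Pi>\<^sub>E s\<in>{1..n}. V s). \<forall>s\<in>{1..n}. \<forall>x\<in>V s.
        (\<forall>y\<in>V s. \<phi> (u(s := x + y)) = \<phi> (u(s := x)) + \<phi> (u(s := y))) \<and>
        (\<forall>a. \<phi> (u(s := sc a x)) = a * \<phi> (u(s := x))))"

definition tensor_scale :: "complex \<Rightarrow> 'v tensor \<Rightarrow> 'v tensor" where
  "tensor_scale a x = (\<lambda>\<phi>. a * x \<phi>)"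

definition pure_tensor ::
  "nat \<Rightarrow> (complex \<Rightarrow> 'v \<Rightarrow> 'v) \<Rightarrow> (nat \<Rightarrow> 'v::ab_group_add set) \<Rightarrow> (nat \<Rightarrow> 'v) \<Rightarrow> 'v tensor" where
  "pure_tensor n sc V u =
     (\<lambda>\<phi>. if multilinear_form n sc V \<phi> then \<phi> (restrict u {1..n}) else 0)"

definition tensor_space ::
  "nat \<Rightarrow> (complex \<Rightarrow> 'v \<Rightarrow> 'v) \<Rightarrow> (nat \<Rightarrow> 'v::ab_group_add set) \<Rightarrow> 'v tensor set" where
  "tensor_space n sc V =
     module.span tensor_scale (pure_tensor n sc V ` (\<Pi>\<^sub>E s\<in>{1..n}. V s))"

text \<open>The action on the tensor product is the transpose of the action on multilinear forms. By the
  lemma below it is given by the Leibniz rule.\<close>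

definition tensor_action ::
  "nat \<Rightarrow> (complex \<Rightarrow> 'v \<Rightarrow> 'v) \<Rightarrow> (nat \<Rightarrow> 'v::ab_group_add set) \<Rightarrow>
     (nat \<Rightarrow> complex mat \<Rightarrow> 'v \<Rightarrow> 'v) \<Rightarrow> complex mat \<Rightarrow> 'v tensor \<Rightarrow> 'v tensor" where
  "tensor_action n sc V \<rho> g x =
     (\<lambda>\<phi>. if multilinear_form n sc V \<phi>
          then x (\<lambda>u. \<Sum>s = 1..n. \<phi> (u(s := \<rho> s g (u s)))) else 0)"

lemma tensor_action_pure_tensor:
  fixes u :: "nat \<Rightarrow> 'v::ab_group_add"
  assumes V: "\<And>s. s \<in> {1..n} \<Longrightarrow> sl_module r sc (V s) (\<rho> s)"
    and g: "g \<in> sl r" and u: "u \<in> (\<Pi>\<^sub>E s\<in>{1..n}. V s)"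
  shows "tensor_action n sc V \<rho> g (pure_tensor n sc V u) =
    (\<Sum>s = 1..n. pure_tensor n sc V (u(s := \<rho> s g (u s))))"
proof
  fix \<phi> :: "(nat \<Rightarrow> 'v) \<Rightarrow> complex"
  have sum_app: "(\<Sum>s\<in>A. f s) \<phi> = (\<Sum>s\<in>A. f s \<phi>)" for f :: "nat \<Rightarrow> 'v tensor" and A
    by (induction A rule: infinite_finite_induct) auto
  have upd: "w(s := x) \<in> (\<Pi>\<^sub>E s\<in>{1..n}. V s)"
    if "w \<in> (\<Pi>\<^sub>E s\<in>{1..n}. V s)" "s \<in> {1..n}" "x \<in> V s" for w s x
    using that by (auto simp: PiE_iff extensional_def)
  have res: "restrict w {1..n} = w" if "w \<in> (\<Pi>\<^sub>E s\<in>{1..n}. V s)" for w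
    using that by (auto simp: PiE_def extensional_restrict)
  have act: "\<rho> s g x \<in> V s" if "s \<in> {1..n}" "x \<in> V s" for s x
    using V g that unfolding sl_module_def by blast
  have comp: "w s \<in> V s" if "w \<in> (\<Pi>\<^sub>E s\<in>{1..n}. V s)" "s \<in> {1..n}" for w s
    using that by auto
  define \<psi> where "\<psi> = (\<lambda>u. \<Sum>s = 1..n. \<phi> (u(s := \<rho> s g (u s))))"
  show "tensor_action n sc V \<rho> g (pure_tensor n sc V u) \<phi> =
    (\<Sum>s = 1..n. pure_tensor n sc V (u(s := \<rho> s g (u s)))) \<phi>"
  proof (cases "multilinear_form n sc V \<phi>")
    case True
    have add: "\<phi> (w(s := x + y)) = \<phi> (w(s := x)) + \<phi> (w(s := y))"
      and scl: "\<phi> (w(s := sc a x)) = a * \<phi> (w(s := x))"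
      if "w \<in> (\<Pi>\<^sub>E s\<in>{1..n}. V s)" "s \<in> {1..n}" "x \<in> V s" "y \<in> V s" for w s x y a
      using True that unfolding multilinear_form_def by blast+
    have \<rho>_add: "\<rho> s g (x + y) = \<rho> s g x + \<rho> s g y"
      and \<rho>_scl: "\<rho> s g (sc a x) = sc a (\<rho> s g x)"
      if "s \<in> {1..n}" "x \<in> V s" "y \<in> V s" for s x y a
      using V[OF that(1)] g that unfolding sl_module_def by blast+
    have "multilinear_form n sc V \<psi>"
      unfolding multilinear_form_def
    proof (intro ballI conjI allI)
      fix w s x y assume *: "w \<in> (\<Pi>\<^sub>E s\<in>{1..n}. V s)" "s \<in> {1..n}" "x \<in> V s" "y \<in> V s"
      have "\<phi> ((w(s := x + y))(k := \<rho> k g ((w(s := x + y)) k))) =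
          \<phi> ((w(s := x))(k := \<rho> k g ((w(s := x)) k))) + \<phi> ((w(s := y))(k := \<rho> k g ((w(s := y)) k)))"
        if k: "k \<in> {1..n}" for k
      proof (cases "k = s")
        case True
        then show ?thesis using * by (simp add: \<rho>_add add act)
      next
        case False
        have "w(k := \<rho> k g (w k)) \<in> (\<Pi>\<^sub>E s\<in>{1..n}. V s)"
          using * k by (intro upd act comp) auto
        from add[OF this *(2-4)] False show ?thesis
          by (simp add: fun_upd_twist)
      qed
      then show "\<psi> (w(s := x + y)) = \<psi> (w(s := x)) + \<psi> (w(s := y))"
        unfolding \<psi>_def sum.distrib[symmetric] by (intro sum.cong) auto
    next
      fix w s x a assume *: "w \<in> (\<Pi>\<^sub>E s\<in>{1..n}. V s)" "s \<in> {1..n}" "x \<in> V s"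
      have "\<phi> ((w(s := sc a x))(k := \<rho> k g ((w(s := sc a x)) k))) =
          a * \<phi> ((w(s := x))(k := \<rho> k g ((w(s := x)) k)))"
        if k: "k \<in> {1..n}" for k
      proof (cases "k = s")
        case True
        then show ?thesis
          using * scl[OF *(1,2) act[OF *(2,3)] act[OF *(2,3)]] by (simp add: \<rho>_scl)
      next
        case False
        have "w(k := \<rho> k g (w k)) \<in> (\<Pi>\<^sub>E s\<in>{1..n}. V s)"
          using * k by (intro upd act comp) auto
        from scl[OF this *(2,3,3)] False show ?thesis
          by (simp add: fun_upd_twist)
      qed
      then show "\<psi> (w(s := sc a x)) = a * \<psi> (w(s := x))"
        unfolding \<psi>_def sum_distrib_left by (intro sum.cong) auto
    qed
    moreover have "\<phi> (restrict (u(s := \<rho> s g (u s))) {1..n}) = \<phi> (u(s := \<rho> s g (u s)))"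
      if "s \<in> {1..n}" for s
      using res[OF upd[OF u that act[OF that comp[OF u that]]]] by simp
    ultimately show ?thesis
      using True res[OF u]
      by (simp add: tensor_action_def pure_tensor_def sum_app \<psi>_def[symmetric])
        (simp add: \<psi>_def)
  next
    case False
    then show ?thesis
      by (simp add: tensor_action_def pure_tensor_def sum_app)
  qed
qed

section \<open>The master function and its critical points\<close>

definition var_count :: "nat \<Rightarrow> (nat \<Rightarrow> nat) \<Rightarrow> nat" where
  "var_count r l = (\<Sum>i = 1..r. l i)"

definition color :: "nat \<Rightarrow> (nat \<Rightarrow> nat) \<Rightarrow> nat \<Rightarrow> nat" where
  "color r l = (THE c. c \<in> {1..var_count r l} \<rightarrow>\<^sub>E {1..r} \<and> mono_on {1..var_count r l} c \<and>
     (\<forall>i\<in>{1..r}. card {a \<in> {1..var_count r l}. c a = i} = l i))"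

text \<open>A factor with zero exponent is omitted, even if its base is zero. For integral dominant weights
  the exponents of the factors that depend on \<open>t\<close> are integers, so the branch chosen by \<open>powr\<close> only
  affects the constant factor that depends on \<open>z\<close>.\<close>

definition power_factor :: "complex \<Rightarrow> complex \<Rightarrow> complex" where
  "power_factor x e = (if e = 0 then 1 else x powr e)"

definition master_function ::
  "nat \<Rightarrow> nat \<Rightarrow> (nat \<Rightarrow> weight) \<Rightarrow> (nat \<Rightarrow> nat) \<Rightarrow> (nat \<Rightarrow> complex) \<Rightarrow> (nat \<Rightarrow> complex) \<Rightarrow> complex" where
  "master_function r n \<Lambda> l z t =
     (\<Prod>i\<in>{1..n}. \<Prod>j\<in>{i<..n}. power_factor (z i - z j) (weight_form r (\<Lambda> i) (\<Lambda> j))) *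
     (\<Prod>i\<in>{1..var_count r l}. \<Prod>s\<in>{1..n}.
        power_factor (t i - z s) (- weight_form r (simple_root (color r l i)) (\<Lambda> s))) *
     (\<Prod>i\<in>{1..var_count r l}. \<Prod>j\<in>{i<..var_count r l}.
        power_factor (t i - t j)
          (weight_form r (simple_root (color r l i)) (simple_root (color r l j))))"

text \<open>Since \<open>0 / x = 0\<close> also for \<open>x = 0\<close>, terms with zero numerator are indeed omitted.\<close>

definition critical_point ::
  "nat \<Rightarrow> nat \<Rightarrow> (nat \<Rightarrow> weight) \<Rightarrow> (nat \<Rightarrow> nat) \<Rightarrow> (nat \<Rightarrow> complex) \<Rightarrow> (nat \<Rightarrow> complex) \<Rightarrow> bool" where
  "critical_point r n \<Lambda> l z t \<longleftrightarrow>
     (\<forall>i\<in>{1..var_count r l}.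
        (\<forall>s\<in>{1..n}. weight_form r (simple_root (color r l i)) (\<Lambda> s) \<noteq> 0 \<longrightarrow> t i \<noteq> z s) \<and>
        (\<forall>j\<in>{1..var_count r l} - {i}.
           weight_form r (simple_root (color r l i)) (simple_root (color r l j)) \<noteq> 0 \<longrightarrow>
             t i \<noteq> t j) \<and>
        - (\<Sum>s = 1..n. weight_form r (simple_root (color r l i)) (\<Lambda> s) / (t i - z s)) +
          (\<Sum>j\<in>{1..var_count r l} - {i}.
             weight_form r (simple_root (color r l i)) (simple_root (color r l j)) / (t i - t j))
        = 0)"

definition partial_deriv :: "nat \<Rightarrow> ((nat \<Rightarrow> complex) \<Rightarrow> complex) \<Rightarrow> (nat \<Rightarrow> complex) \<Rightarrow> complex" where
  "partial_deriv i f t = deriv (\<lambda>x. f (t(i := x))) (t i)"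

text \<open>The derivatives of \<open>log f\<close> are those of the single-valued functions \<open>(\<partial>f/\<partial>t\<^sub>j) / f\<close>.\<close>

definition log_hessian :: "nat \<Rightarrow> ((nat \<Rightarrow> complex) \<Rightarrow> complex) \<Rightarrow> (nat \<Rightarrow> complex) \<Rightarrow> complex mat" where
  "log_hessian m f t =
     mat m m (\<lambda>(i, j). partial_deriv (i + 1) (\<lambda>u. partial_deriv (j + 1) f u / f u) t)"

definition nondegenerate_critical_point ::
  "nat \<Rightarrow> nat \<Rightarrow> (nat \<Rightarrow> weight) \<Rightarrow> (nat \<Rightarrow> nat) \<Rightarrow> (nat \<Rightarrow> complex) \<Rightarrow> (nat \<Rightarrow> complex) \<Rightarrow> bool" where
  "nondegenerate_critical_point r n \<Lambda> l z t \<longleftrightarrow>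
     critical_point r n \<Lambda> l z t \<and>
     Determinant.det (log_hessian (var_count r l) (master_function r n \<Lambda> l z) t) \<noteq> 0"

section \<open>The universal weight function and Bethe vectors\<close>

definition index_seqs :: "nat \<Rightarrow> nat \<Rightarrow> (nat \<Rightarrow> nat) \<Rightarrow> (nat \<Rightarrow> nat list) set" where
  "index_seqs r n l = {I \<in> (\<Pi>\<^sub>E s\<in>{1..n}. lists {1..r}).
     \<forall>i\<in>{1..r}. (\<Sum>s = 1..n. count_list (I s) i) = l i}"

definition block :: "(nat \<Rightarrow> nat list) \<Rightarrow> (nat \<Rightarrow> nat) \<Rightarrow> nat \<Rightarrow> nat list" where
  "block I \<sigma> s = map (\<lambda>i. \<sigma> ((\<Sum>k = 1..<s. length (I k)) + i)) [1..<length (I s) + 1]"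

definition color_perms ::
  "nat \<Rightarrow> nat \<Rightarrow> (nat \<Rightarrow> nat) \<Rightarrow> (nat \<Rightarrow> nat list) \<Rightarrow> (nat \<Rightarrow> nat) set" where
  "color_perms r n l I =
     {\<sigma>. \<sigma> permutes {1..var_count r l} \<and> (\<forall>s\<in>{1..n}. map (color r l) (block I \<sigma> s) = I s)}"

fun chain_fun :: "(nat \<Rightarrow> complex) \<Rightarrow> complex \<Rightarrow> nat list \<Rightarrow> complex" where
  "chain_fun t x [] = 1"
| "chain_fun t x [a] = 1 / (t a - x)"
| "chain_fun t x (a # b # as) = 1 / (t a - t b) * chain_fun t x (b # as)"

definition F_monomial :: "nat \<Rightarrow> (complex mat \<Rightarrow> 'v \<Rightarrow> 'v) \<Rightarrow> nat list \<Rightarrow> 'v \<Rightarrow> 'v" where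
  "F_monomial r \<rho> is v = foldr (\<lambda>i. \<rho> (chev_F r i)) is v"

definition weight_function ::
  "nat \<Rightarrow> nat \<Rightarrow> (complex \<Rightarrow> 'v \<Rightarrow> 'v) \<Rightarrow> (nat \<Rightarrow> 'v::ab_group_add set) \<Rightarrow>
     (nat \<Rightarrow> complex mat \<Rightarrow> 'v \<Rightarrow> 'v) \<Rightarrow> (nat \<Rightarrow> 'v) \<Rightarrow> (nat \<Rightarrow> nat) \<Rightarrow>
     (nat \<Rightarrow> complex) \<Rightarrow> (nat \<Rightarrow> complex) \<Rightarrow> 'v tensor" where
  "weight_function r n sc V \<rho> v l t z =
     (\<Sum>I\<in>index_seqs r n l. \<Sum>\<sigma>\<in>color_perms r n l I.
        tensor_scale (\<Prod>s = 1..n. chain_fun t (z s) (block I \<sigma> s))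
          (pure_tensor n sc V (\<lambda>s. F_monomial r (\<rho> s) (I s) (v s))))"

inductive_set poly_functions ::
  "nat \<Rightarrow> nat \<Rightarrow> ((nat \<Rightarrow> complex) \<Rightarrow> (nat \<Rightarrow> complex) \<Rightarrow> complex) set" for m n :: nat where
  const: "(\<lambda>t z. a) \<in> poly_functions m n"
| var_t: "i \<in> {1..m} \<Longrightarrow> (\<lambda>t z. t i) \<in> poly_functions m n"
| var_z: "s \<in> {1..n} \<Longrightarrow> (\<lambda>t z. z s) \<in> poly_functions m n"
| add: "p \<in> poly_functions m n \<Longrightarrow> q \<in> poly_functions m n \<Longrightarrow>
    (\<lambda>t z. p t z + q t z) \<in> poly_functions m n"
| mult: "p \<in> poly_functions m n \<Longrightarrow> q \<in> poly_functions m n \<Longrightarrow>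
    (\<lambda>t z. p t z * q t z) \<in> poly_functions m n"

definition off_diagonals :: "nat \<Rightarrow> nat \<Rightarrow> (nat \<Rightarrow> complex) \<Rightarrow> (nat \<Rightarrow> complex) \<Rightarrow> bool" where
  "off_diagonals m n t z \<longleftrightarrow>
     inj_on t {1..m} \<and> (\<forall>i\<in>{1..m}. \<forall>s\<in>{1..n}. t i \<noteq> z s)"

text \<open>The rational function represented by \<open>f\<close>, a function with values in the tensor space \<open>T\<close> whose
  formula makes sense off the diagonals, is regular at \<open>(t0, z0)\<close> with value \<open>w\<close>: it has a presentation
  with polynomial numerator and a polynomial denominator \<open>q\<close> that does not vanish at \<open>(t0, z0)\<close>.\<close>

definition regular_value ::
  "nat \<Rightarrow> nat \<Rightarrow> 'v tensor set \<Rightarrow> ((nat \<Rightarrow> complex) \<Rightarrow> (nat \<Rightarrow> complex) \<Rightarrow> 'v tensor) \<Rightarrow>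
     (nat \<Rightarrow> complex) \<Rightarrow> (nat \<Rightarrow> complex) \<Rightarrow> 'v tensor \<Rightarrow> bool" where
  "regular_value m n T f t0 z0 w \<longleftrightarrow>
     (\<exists>q\<in>poly_functions m n. \<exists>N p x.
        q t0 z0 \<noteq> 0 \<and>
        (\<forall>k<N. p k \<in> poly_functions m n \<and> x k \<in> T) \<and>
        (\<forall>t z. off_diagonals m n t z \<longrightarrow>
           tensor_scale (q t z) (f t z) = (\<Sum>k<N::nat. tensor_scale (p k t z) (x k))) \<and>
        w = tensor_scale (1 / q t0 z0) (\<Sum>k<N. tensor_scale (p k t0 z0) (x k)))"

definition bethe_vector ::
  "nat \<Rightarrow> nat \<Rightarrow> (complex \<Rightarrow> 'v \<Rightarrow> 'v) \<Rightarrow> (nat \<Rightarrow> 'v::ab_group_add set) \<Rightarrow>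
     (nat \<Rightarrow> complex mat \<Rightarrow> 'v \<Rightarrow> 'v) \<Rightarrow> (nat \<Rightarrow> 'v) \<Rightarrow> (nat \<Rightarrow> nat) \<Rightarrow>
     (nat \<Rightarrow> complex) \<Rightarrow> (nat \<Rightarrow> complex) \<Rightarrow> 'v tensor" where
  "bethe_vector r n sc V \<rho> v l t z =
     (THE w. regular_value (var_count r l) n (tensor_space n sc V)
        (weight_function r n sc V \<rho> v l) t z w)"

end

theory Submission
  imports Defs
begin

text \<open>
  The tensor product is tested against the dual weight function: the multilinear form \<open>\<phi>\<^sub>y\<close> that is
  built from the operators \<open>E\<^sub>i\<close> and the linear forms dual to \<open>v\<^sub>s\<close> with coefficients in new variables
  \<open>y\<close>. The value \<open>\<omega>(t, z)(\<phi>\<^sub>y)\<close> is a double sum over orderings of the variables; expanded over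
  parent maps it becomes, by a weighted matrix-tree theorem,
  \<open>\<Sum>\<^sub>\<sigma> det M(t, y \<circ> \<sigma>)\<close>, where \<open>\<sigma>\<close> runs over the permutations that preserve colours and \<open>M(t, y)\<close> is
  the matrix of difference quotients of the gradient of \<open>log \<Phi>\<close>. At a critical point \<open>t\<close> one has
  \<open>M(t, t \<circ> \<sigma>)(t - t \<circ> \<sigma>) = 0\<close>, so only \<open>\<sigma> = 1\<close> survives as \<open>y\<close> tends to \<open>t\<close>, and
  \<open>det M(t, t)\<close> is the Hessian of \<open>log \<Phi>\<close>.

  The value of \<open>\<omega>\<close> at \<open>t\<close> exists because an apparent pole at \<open>t\<^sub>a = t\<^sub>b\<close> cancels between two orderings
  that differ by exchanging \<open>a\<close> and \<open>b\<close> (their \<open>F\<close>'s commute), and one at \<open>t\<^sub>a = z\<^sub>s\<close> is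
  multiplied by \<open>F\<^sub>i v\<^sub>s = 0\<close>, where \<open>i = c(a)\<close>.
\<close>

section \<open>Determinants over finite index sets\<close>

text \<open>One linear form with a non-zero value proves a vector non-zero. The form chosen here
  makes \<open>\<omega>(t, z)(\<phi>_y)\<close> the Shapovalov pairing of
  \<open>\<omega>(t, z)\<close> with \<open>\<omega>(y, z)\<close>. It can be computed because an
  \<open>E\<close> applied to a monomial in the \<open>F\<close>s only removes an \<open>F\<close>,
  with a coefficient that depends on the \<open>F\<close>s standing to its right. The two sets of
  variables are kept apart because the determinant formula is derived off the diagonals, whereas a
  critical point may lie on them: \<open>t_a = t_b\<close> for orthogonal roots, or
  \<open>t_a = z_s\<close> for a weight orthogonal to the root of \<open>a\<close>. In the
  determinants the terms with such denominators have numerator 0, so these extend continuously,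
  while \<open>\<omega>\<close> is available there only as a limit. Hence a limit in
  \<open>t\<close> for fixed generic \<open>y\<close>, followed by a limit in \<open>y\<close>. The
  sum over \<open>\<sigma>\<close> appears because a monomial in the \<open>F\<close>s records the
  colours of the variables and not their labels. The kernel vector
  \<open>t - t \<circ> \<sigma>\<close> is non-zero since a moved variable and its image have the
  same colour, and such variables are distinct at a critical point.\<close>

definition set_det :: "'a set \<Rightarrow> ('a \<Rightarrow> 'a \<Rightarrow> 'b::comm_ring_1) \<Rightarrow> 'b" where
  "set_det A M = (\<Sum>\<pi> | \<pi> permutes A. of_int (sign \<pi>) * (\<Prod>a\<in>A. M a (\<pi> a)))"

text \<open>Conjugating permutations with the enumeration \<open>f\<close> preserves their signs.
  Rows and columns are indexed by labels so that a label can be deleted without renumbering the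
  others; facts about determinants of matrices are imported through this identity.\<close>

lemma set_det_eq_det:
  assumes f: "bij_betw f {0..<n} A"
  shows "set_det A M = Determinant.det (mat n n (\<lambda>(i, j). M (f i) (f j)))"
proof -
  define g where "g = inv_into {0..<n} f"
  have fin: "finite A" using f bij_betw_finite by blast
  have g: "bij_betw g A {0..<n}" unfolding g_def by (rule bij_betw_inv_into[OF f])
  have fg: "f (g a) = a" if "a \<in> A" for a
    using that f unfolding g_def by (meson bij_betw_inv_into_right)
  have gf: "g (f i) = i" if "i \<in> {0..<n}" for i
    using that f unfolding g_def by (meson bij_betw_inv_into_left)
  have finj: "inj_on f {0..<n}" using f by (rule bij_betw_imp_inj_on)
  have "set_det A M = (\<Sum>\<pi> | \<pi> permutes {0..<n}. of_int (sign \<pi>) * (\<Prod>i=0..<n. M (f i) (f (\<pi> i))))"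
    unfolding set_det_def
  proof (rule sum.reindex_bij_witness[where i = "map_permutation {0..<n} f" and j = "map_permutation A g"], goal_cases)
    case (1 p)
    then show ?case
      by (intro map_permutation_compose_inv[OF g]) (auto simp: fg)
  next
    case (2 p)
    then show ?case
      using map_permutation_permutes[OF g] by simp
  next
    case (3 p)
    then show ?case
      by (intro map_permutation_compose_inv[OF f]) (auto simp: gf)
  next
    case (4 p)
    then show ?case using map_permutation_permutes[OF f] by simp
  next
    case (5 p)
    then have p: "p permutes A" by simp
    have ginj: "inj_on g A" using g by (rule bij_betw_imp_inj_on)
    have "(\<Prod>i = 0..<n. M (f i) (f (map_permutation A g p i))) = (\<Prod>a\<in>A. M (f (g a)) (f (map_permutation A g p (g a))))"
      by (rule prod.reindex_bij_betw[OF g, symmetric])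
    also have "\<dots> = (\<Prod>a\<in>A. M a (p a))"
    proof (rule prod.cong[OF refl])
      fix a assume a: "a \<in> A"
      have "p a \<in> A" using p a by (simp add: permutes_in_image)
      then show "M (f (g a)) (f (map_permutation A g p (g a))) = M a (p a)"
        using a by (simp add: map_permutation_apply[OF ginj] fg)
    qed
    finally show ?case
      using sign_map_permutation[OF ginj p fin] by simp
  qed
  also have "\<dots> = Determinant.det (mat n n (\<lambda>(i, j). M (f i) (f j)))"
  proof -
    have X: "mat n n (\<lambda>(i, j). M (f i) (f j)) \<in> carrier_mat n n" by simp
    show ?thesis
      unfolding det_def'[OF X]
    proof (intro sum.cong refl arg_cong2[of _ _ _ _ "(*)"] prod.cong)
      fix p i assume "p \<in> {p. p permutes {0..<n}}" "i \<in> {0..<n}"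
      then show "M (f i) (f (p i)) = mat n n (\<lambda>(i, j). M (f i) (f j)) $$ (i, p i)"
        using permutes_in_image[of p "{0..<n}" i] by simp
    qed
  qed
  finally show ?thesis .
qed

lemma set_det_zero_kernel:
  fixes M :: "'a \<Rightarrow> 'a \<Rightarrow> 'b::idom"
  assumes fin: "finite A" and b: "b \<in> A" "u b \<noteq> 0"
    and ker: "\<And>a. a \<in> A \<Longrightarrow> (\<Sum>b\<in>A. M a b * u b) = 0"
  shows "set_det A M = 0"
proof -
  obtain f where f: "bij_betw f {0..<card A} A"
    using ex_bij_betw_nat_finite[OF fin] by blast
  let ?X = "mat (card A) (card A) (\<lambda>(i, j). M (f i) (f j))"
  let ?v = "vec (card A) (\<lambda>i. u (f i))"
  have "?X *\<^sub>v ?v = 0\<^sub>v (card A)"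
  proof (rule eq_vecI)
    fix i assume "i < dim_vec (0\<^sub>v (card A) :: 'b vec)"
    then have i: "i < card A" by simp
    then have fi: "f i \<in> A" using f by (auto simp: bij_betw_def)
    have "(?X *\<^sub>v ?v) $ i = (\<Sum>j\<in>{0..<card A}. M (f i) (f j) * u (f j))"
      using i by (simp add: scalar_prod_def)
    also have "\<dots> = (\<Sum>b\<in>A. M (f i) b * u b)"
      by (rule sum.reindex_bij_betw[OF f])
    finally show "(?X *\<^sub>v ?v) $ i = 0\<^sub>v (card A) $ i" using ker[OF fi] i by simp
  qed simp
  moreover have "?v \<noteq> 0\<^sub>v (card A)"
  proof
    assume v0: "?v = 0\<^sub>v (card A)"
    have "b \<in> f ` {0..<card A}" using f b(1) by (simp add: bij_betw_def)
    then obtain i where i: "i < card A" "f i = b" by auto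
    then have "?v $ i = u b" by simp
    with v0 i b show False by simp
  qed
  ultimately have "Determinant.det ?X = 0"
    by (subst det_0_iff_vec_prod_zero[of _ "card A"]) (auto intro!: exI[of _ ?v])
  then show ?thesis by (simp add: set_det_eq_det[OF f])
qed

text \<open>A permutation that moves \<open>a\<close> takes the entry of column \<open>a\<close>
  from another row, where it is 0. For the matrices of parent maps this is the removal of a
  leaf.\<close>

lemma set_det_expand_column:
  assumes fin: "finite A" and a: "a \<in> A" and col: "\<And>b. b \<in> A \<Longrightarrow> M b a = (if b = a then 1 else 0)"
  shows "set_det A M = set_det (A - {a}) M"
proof -
  have "set_det A M = (\<Sum>\<pi> | \<pi> permutes (A - {a}). of_int (sign \<pi>) * (\<Prod>a\<in>A. M a (\<pi> a)))"
    unfolding set_det_def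
  proof (rule sum.mono_neutral_right)
    show "finite {\<pi>. \<pi> permutes A}" using fin by (rule finite_permutations)
    show "{\<pi>. \<pi> permutes (A - {a})} \<subseteq> {\<pi>. \<pi> permutes A}"
      by (auto intro: permutes_subset)
    show "\<forall>\<pi>\<in>{\<pi>. \<pi> permutes A} - {\<pi>. \<pi> permutes (A - {a})}. of_int (sign \<pi>) * (\<Prod>a\<in>A. M a (\<pi> a)) = 0"
    proof
      fix \<pi> assume "\<pi> \<in> {\<pi>. \<pi> permutes A} - {\<pi>. \<pi> permutes (A - {a})}"
      then have p: "\<pi> permutes A" and np: "\<not> \<pi> permutes (A - {a})" by auto
      have ne: "\<pi> a \<noteq> a"
      proof
        assume "\<pi> a = a"
        then have "\<pi> permutes (A - {a})"
          using permutes_superset[OF p, of "A - {a}"] a by auto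
        with np show False by simp
      qed
      obtain b where b: "b \<in> A" "\<pi> b = a"
        using p a by (metis permutes_inverses(1) permutes_inv permutes_in_image)
      have "M b (\<pi> b) = 0" using b ne col[OF b(1)] by auto
      then show "of_int (sign \<pi>) * (\<Prod>a\<in>A. M a (\<pi> a)) = 0"
        using b fin by (subst prod_zero) auto
    qed
  qed
  also have "\<dots> = set_det (A - {a}) M"
    unfolding set_det_def
  proof (rule sum.cong[OF refl])
    fix \<pi> assume "\<pi> \<in> {\<pi>. \<pi> permutes (A - {a})}"
    then have "\<pi> a = a" by (auto simp: permutes_def)
    then show "of_int (sign \<pi>) * (\<Prod>a\<in>A. M a (\<pi> a)) = of_int (sign \<pi>) * (\<Prod>a\<in>A - {a}. M a (\<pi> a))"
      using prod.remove[OF fin a, of "\<lambda>b. M b (\<pi> b)"] col[OF a] by simp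
  qed
  finally show ?thesis .
qed

text \<open>Multilinearity in the rows: choosing one summand in every row amounts to a map
  \<open>p\<close> from the rows to \<open>Q\<close>. These maps become the parent maps of the tree
  expansion.\<close>

lemma set_det_row_sums:
  fixes w :: "'a \<Rightarrow> 'c \<Rightarrow> 'b::comm_ring_1"
  assumes fin: "finite A" "finite Q"
  shows "set_det A (\<lambda>a b. \<Sum>q\<in>Q. w a q * P a q b) =
    (\<Sum>p\<in>A \<rightarrow>\<^sub>E Q. (\<Prod>a\<in>A. w a (p a)) * set_det A (\<lambda>a b. P a (p a) b))"
proof -
  have "set_det A (\<lambda>a b. \<Sum>q\<in>Q. w a q * P a q b) =
    (\<Sum>\<pi> | \<pi> permutes A. \<Sum>p\<in>A \<rightarrow>\<^sub>E Q. of_int (sign \<pi>) * (\<Prod>a\<in>A. w a (p a) * P a (p a) (\<pi> a)))"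
    unfolding set_det_def using fin by (subst prod_sum_PiE) (auto simp: sum_distrib_left)
  also have "\<dots> = (\<Sum>p\<in>A \<rightarrow>\<^sub>E Q. \<Sum>\<pi> | \<pi> permutes A. of_int (sign \<pi>) * (\<Prod>a\<in>A. w a (p a) * P a (p a) (\<pi> a)))"
    by (rule sum.swap)
  also have "\<dots> = (\<Sum>p\<in>A \<rightarrow>\<^sub>E Q. (\<Prod>a\<in>A. w a (p a)) * set_det A (\<lambda>a b. P a (p a) b))"
    unfolding set_det_def by (simp add: prod.distrib sum_distrib_left mult_ac)
  finally show ?thesis .
qed

section \<open>Arrangements and parent maps\<close>

text \<open>An arrangement encodes a pair of an index sequence \<open>I\<close> and a permutation
  \<open>\<sigma>\<close> in the weight function: its lists hold the variables attached to the
  tensor factors, and \<open>I\<close> is recovered as their colours. Extensionality makes the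
  encoding unique.\<close>

definition arrangements :: "nat \<Rightarrow> nat set \<Rightarrow> (nat \<Rightarrow> nat list) set" where
  "arrangements n A = {B \<in> {1..n} \<rightarrow>\<^sub>E lists A. (\<forall>k\<in>{1..n}. distinct (B k)) \<and>
     (\<forall>j\<in>{1..n}. \<forall>k\<in>{1..n}. \<forall>a. a \<in> set (B j) \<and> a \<in> set (B k) \<longrightarrow> j = k) \<and> (\<Union>k\<in>{1..n}. set (B k)) = A}"

lemma arrangementsD:
  assumes "B \<in> arrangements n A"
  shows "k \<in> {1..n} \<Longrightarrow> distinct (B k)" "k \<in> {1..n} \<Longrightarrow> set (B k) \<subseteq> A"
    "a \<in> set (B j) \<Longrightarrow> a \<in> set (B k) \<Longrightarrow> j \<in> {1..n} \<Longrightarrow> k \<in> {1..n} \<Longrightarrow> j = k"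
    "a \<in> A \<Longrightarrow> \<exists>k\<in>{1..n}. a \<in> set (B k)" "B \<in> extensional {1..n}"
proof -
  have B: "B \<in> {1..n} \<rightarrow>\<^sub>E lists A" "\<forall>k\<in>{1..n}. distinct (B k)"
    "\<forall>j\<in>{1..n}. \<forall>k\<in>{1..n}. \<forall>a. a \<in> set (B j) \<and> a \<in> set (B k) \<longrightarrow> j = k"
    "(\<Union>k\<in>{1..n}. set (B k)) = A"
    using assms unfolding arrangements_def by (blast, blast, blast, blast)
  show "k \<in> {1..n} \<Longrightarrow> distinct (B k)" using B(2) by blast
  show "k \<in> {1..n} \<Longrightarrow> set (B k) \<subseteq> A" using B(4) by blast
  show "a \<in> set (B j) \<Longrightarrow> a \<in> set (B k) \<Longrightarrow> j \<in> {1..n} \<Longrightarrow> k \<in> {1..n} \<Longrightarrow> j = k" using B(3) by blast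
  show "a \<in> A \<Longrightarrow> \<exists>k\<in>{1..n}. a \<in> set (B k)" using B(4) by blast
  show "B \<in> extensional {1..n}" using B(1) by (simp add: PiE_def)
qed

lemma arrangements_Union: "B \<in> arrangements n L \<Longrightarrow> L = (\<Union>k\<in>{1..n}. set (B k))"
  unfolding arrangements_def by (elim CollectE conjE) (rule sym)

lemma arrangementsI:
  assumes "B \<in> extensional {1..n}" "\<And>k. k \<in> {1..n} \<Longrightarrow> distinct (B k)"
    "\<And>k. k \<in> {1..n} \<Longrightarrow> set (B k) \<subseteq> A"
    "\<And>a j k. a \<in> set (B j) \<Longrightarrow> a \<in> set (B k) \<Longrightarrow> j \<in> {1..n} \<Longrightarrow> k \<in> {1..n} \<Longrightarrow> j = k"
    "\<And>a. a \<in> A \<Longrightarrow> \<exists>k\<in>{1..n}. a \<in> set (B k)"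
  shows "B \<in> arrangements n A"
proof -
  have "B \<in> {1..n} \<rightarrow>\<^sub>E lists A" using assms(1,3) by (simp add: PiE_iff lists_eq_set)
  moreover have "(\<Union>k\<in>{1..n}. set (B k)) = A" using assms(3,5) by blast
  ultimately show ?thesis unfolding arrangements_def using assms(2,4) by blast
qed

lemma finite_arrangements: "finite A \<Longrightarrow> finite (arrangements n A)"
proof -
  assume fin: "finite A"
  have "arrangements n A \<subseteq> {1..n} \<rightarrow>\<^sub>E {xs. set xs \<subseteq> A \<and> length xs \<le> card A}"
  proof
    fix B assume B: "B \<in> arrangements n A"
    have "length (B k) \<le> card A" if "k \<in> {1..n}" for k
      using card_mono[OF fin arrangementsD(2)[OF B that]] distinct_card[OF arrangementsD(1)[OF B that]]
      by simp
    then show "B \<in> {1..n} \<rightarrow>\<^sub>E {xs. set xs \<subseteq> A \<and> length xs \<le> card A}"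
      using arrangementsD(2,5)[OF B] by (auto simp: PiE_iff)
  qed
  then show ?thesis
    by (rule finite_subset) (intro finite_PiE finite_atLeastAtMost finite_lists_length_le fin)
qed

section \<open>Orderings of the labels and insertion of a label in front of its parent\<close>

fun precedes :: "'a list \<Rightarrow> 'a \<Rightarrow> 'a \<Rightarrow> bool" where
  "precedes [] a b \<longleftrightarrow> False"
| "precedes (x # xs) a b \<longleftrightarrow> x = a \<and> b \<in> set xs \<or> precedes xs a b"

lemma precedes_set: "precedes xs a b \<Longrightarrow> a \<in> set xs \<and> b \<in> set xs"
  by (induction xs) auto

lemma precedes_filter: "P a \<Longrightarrow> P b \<Longrightarrow> precedes (filter P xs) a b = precedes xs a b"
  by (induction xs) auto

text \<open>The labels \<open>m + 1, \<dots>, m + n\<close> stand for the points \<open>z\<^sub>1, \<dots>, z\<^sub>n\<close>.\<close>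

definition linked :: "nat \<Rightarrow> nat \<Rightarrow> (nat \<Rightarrow> nat list) \<Rightarrow> nat \<Rightarrow> nat \<Rightarrow> bool" where
  "linked m n B a q \<longleftrightarrow> (\<exists>k\<in>{1..n}. a \<in> set (B k) \<and> (q = m + k \<or> precedes (B k) a q))"

text \<open>Merging the variables and the points \<open>z\<close> into one family \<open>x\<close>
  makes the last factor of a chain look like the others: a difference of two entries of
  \<open>x\<close>.\<close>

definition chain_prod :: "nat \<Rightarrow> nat \<Rightarrow> (nat \<Rightarrow> complex) \<Rightarrow> (nat \<Rightarrow> nat list) \<Rightarrow> complex" where
  "chain_prod m n x B = (\<Prod>k=1..n. chain_fun x (x (m + k)) (B k))"

text \<open>The insertions of \<open>a\<close> in front of \<open>q\<close>; if \<open>q\<close>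
  does not occur in the list, every position is allowed, including the end. The two cases correspond
  to a parent that is a label of the list and to a parent that is its root.\<close>

fun insertions :: "'a \<Rightarrow> 'a \<Rightarrow> 'a list \<Rightarrow> 'a list list" where
  "insertions a q [] = [[a]]"
| "insertions a q (y # ys) = (a # y # ys) # (if q = y then [] else map ((#) y) (insertions a q ys))"

lemma set_insertions:
  assumes "distinct xs" "a \<notin> set xs"
  shows "set (insertions a q xs) = {ys. distinct ys \<and> a \<in> set ys \<and> filter (\<lambda>b. b \<noteq> a) ys = xs \<and>
    (q \<in> set xs \<longrightarrow> precedes ys a q)}"
  using assms
proof (induction xs)
  case Nil
  have "ys = [a]" if "distinct ys" "a \<in> set ys" "filter (\<lambda>b. b \<noteq> a) ys = []" for ys
  proof -
    have "\<forall>b\<in>set ys. b = a" using that(3) by (auto simp: filter_empty_conv)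
    then show ?thesis using that(1,2) by (cases ys; cases "tl ys") auto
  qed
  then show ?case by auto
next
  case (Cons y xs)
  then have IH: "set (insertions a q xs) = {ys. distinct ys \<and> a \<in> set ys \<and> filter (\<lambda>b. b \<noteq> a) ys = xs \<and>
    (q \<in> set xs \<longrightarrow> precedes ys a q)}" by simp
  show ?case
  proof (intro equalityI subsetI)
    fix ys assume "ys \<in> set (insertions a q (y # xs))"
    then consider "ys = a # y # xs" | zs where "q \<noteq> y" "zs \<in> set (insertions a q xs)" "ys = y # zs"
      by (auto split: if_splits)
    then show "ys \<in> {ys. distinct ys \<and> a \<in> set ys \<and> filter (\<lambda>b. b \<noteq> a) ys = y # xs \<and>
      (q \<in> set (y # xs) \<longrightarrow> precedes ys a q)}"
    proof cases
      case 1
      have "filter (\<lambda>b. b \<noteq> a) xs = xs" using Cons.prems by (auto intro: filter_True)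
      with 1 Cons.prems show ?thesis by auto
    next
      case 2
      have zs: "distinct zs" "a \<in> set zs" "filter (\<lambda>b. b \<noteq> a) zs = xs" "q \<in> set xs \<longrightarrow> precedes zs a q"
        using 2(2) unfolding IH by auto
      have "y \<notin> set zs" using zs(3) Cons.prems by auto
      with 2 zs Cons.prems show ?thesis by auto
    qed
  next
    fix ys assume "ys \<in> {ys. distinct ys \<and> a \<in> set ys \<and> filter (\<lambda>b. b \<noteq> a) ys = y # xs \<and>
      (q \<in> set (y # xs) \<longrightarrow> precedes ys a q)}"
    then have ys: "distinct ys" "a \<in> set ys" "filter (\<lambda>b. b \<noteq> a) ys = y # xs"
      "q \<in> set (y # xs) \<Longrightarrow> precedes ys a q" by auto
    from ys(2) obtain w ws where w: "ys = w # ws" by (cases ys) auto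
    show "ys \<in> set (insertions a q (y # xs))"
    proof (cases "w = a")
      case True
      then have "filter (\<lambda>b. b \<noteq> a) ws = ws" using ys(1) w by (auto intro: filter_True)
      with True w ys(3) show ?thesis by auto
    next
      case False
      then have wy: "w = y" and f: "filter (\<lambda>b. b \<noteq> a) ws = xs" using ys(3) w by auto
      have "q \<noteq> y"
      proof
        assume "q = y"
        then have "precedes ws a y" using ys(4) w False by auto
        then show False using ys(1) w wy precedes_set by fastforce
      qed
      moreover have "ws \<in> set (insertions a q xs)"
        unfolding IH using ys w wy f False by auto
      ultimately show ?thesis using w wy by auto
    qed
  qed
qed

lemma distinct_insertions: "a \<notin> set xs \<Longrightarrow> distinct (insertions a q xs)"
  by (induction xs) (auto simp: distinct_map)

text \<open>Partial fractions in \<open>a\<close>. When \<open>a\<close> is put between two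
  neighbours \<open>y\<close> and \<open>w\<close> of a chain, the left side replaces their factor
  \<open>1 / (y - w)\<close>.\<close>

lemma split_fraction:
  fixes a w y :: "'a::field"
  assumes "y \<noteq> w" "a \<noteq> w" "a \<noteq> y"
  shows "1 / (y - a) * (1 / (a - w)) = 1 / (y - w) * (1 / (a - w) - 1 / (a - y))"
proof -
  define p q where "p = a - w" and "q = a - y"
  have "p \<noteq> 0" "q \<noteq> 0" "p - q \<noteq> 0" using assms by (auto simp: p_def q_def)
  then have "1 / (- q) * (1 / p) = 1 / (p - q) * (1 / p - 1 / q)"
    by (simp add: diff_frac_eq field_split_simps)
  then show ?thesis by (simp add: p_def q_def)
qed

text \<open>Inserting \<open>a\<close> between two neighbours multiplies the chain by a difference
  of two reciprocals, one for each neighbour, so the sum over the positions behind \<open>y\<close>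
  telescopes. There remain the boundary terms at \<open>y\<close> and at the last admissible right
  neighbour, whose coordinate is \<open>v\<close>: this is \<open>q\<close>, or the root if
  \<open>q\<close> is absent.\<close>

lemma sum_chain_insertions_Cons:
  assumes "inj_on x (set (y # xs))" "a \<notin> set (y # xs)" "distinct (y # xs)"
    and "\<And>b. b \<in> set (y # xs) \<Longrightarrow> x b \<noteq> x a \<and> x b \<noteq> r" and "x a \<noteq> r"
    and "q \<in> set xs \<and> v = x q \<or> q \<notin> set xs \<and> v = r"
  shows "(\<Sum>zs\<leftarrow>insertions a q xs. chain_fun x r (y # zs)) =
    chain_fun x r (y # xs) * (1 / (x a - v) - 1 / (x a - x y))"
  using assms
proof (induction xs arbitrary: y)
  case Nil
  then have "1 / (x y - x a) * (1 / (x a - r)) = 1 / (x y - r) * (1 / (x a - r) - 1 / (x a - x y))"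
    by (intro split_fraction) auto
  with Nil show ?case by simp
next
  case (Cons w ws)
  have split: "1 / (x y - x a) * (1 / (x a - x w)) = 1 / (x y - x w) * (1 / (x a - x w) - 1 / (x a - x y))"
    using Cons.prems(1,3) Cons.prems(4)[of y] Cons.prems(4)[of w] by (intro split_fraction) auto
  have scale: "(\<Sum>zs\<leftarrow>Z. chain_fun x r (y # w # zs)) = 1 / (x y - x w) * (\<Sum>zs\<leftarrow>Z. chain_fun x r (w # zs))" for Z
    by (induction Z) (simp_all add: add_divide_distrib)
  have "(\<Sum>zs\<leftarrow>insertions a q (w # ws). chain_fun x r (y # zs)) =
      1 / (x y - x a) * (1 / (x a - x w)) * chain_fun x r (w # ws) +
      (if q = w then 0 else 1 / (x y - x w) * (\<Sum>zs\<leftarrow>insertions a q ws. chain_fun x r (w # zs)))"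
    by (simp add: o_def scale del: chain_fun.simps(3)) simp
  also have "\<dots> = 1 / (x y - x w) * chain_fun x r (w # ws) * (1 / (x a - v) - 1 / (x a - x y))"
  proof (cases "q = w")
    case True
    then have "v = x w" using Cons.prems by auto
    then show ?thesis unfolding split using True by simp
  next
    case False
    have IH: "(\<Sum>zs\<leftarrow>insertions a q ws. chain_fun x r (w # zs)) =
        chain_fun x r (w # ws) * (1 / (x a - v) - 1 / (x a - x w))"
      using Cons.prems False by (intro Cons.IH) auto
    show ?thesis unfolding split IH using False by (simp add: algebra_simps)
  qed
  finally show ?case by simp
qed

text \<open>The sum over all positions before \<open>q\<close> telescopes.\<close>

lemma sum_chain_insertions:
  assumes "inj_on x (set xs)" "a \<notin> set xs" "distinct xs"
    and "\<And>b. b \<in> set xs \<Longrightarrow> x b \<noteq> x a \<and> x b \<noteq> r" and "x a \<noteq> r"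
    and "q \<in> set xs \<and> v = x q \<or> q \<notin> set xs \<and> v = r"
  shows "(\<Sum>zs\<leftarrow>insertions a q xs. chain_fun x r zs) = chain_fun x r xs / (x a - v)"
proof (cases xs)
  case Nil
  with assms show ?thesis by simp
next
  case (Cons w ws)
  \<comment> \<open>The insertion in front of the whole list supplies the reciprocal that cancels
    the lower boundary term of the telescoping sum.\<close>
  have "(\<Sum>zs\<leftarrow>insertions a q xs. chain_fun x r zs) = 1 / (x a - x w) * chain_fun x r (w # ws) +
      (if q = w then 0 else (\<Sum>zs\<leftarrow>insertions a q ws. chain_fun x r (w # zs)))"
    using Cons by (simp add: o_def)
  also have "\<dots> = chain_fun x r xs / (x a - v)"
  proof (cases "q = w")
    case True
    then have "v = x w" using assms Cons by auto
    then show ?thesis using True Cons by simp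
  next
    case False
    have "(\<Sum>zs\<leftarrow>insertions a q ws. chain_fun x r (w # zs)) =
        chain_fun x r (w # ws) * (1 / (x a - v) - 1 / (x a - x w))"
      using assms False Cons by (intro sum_chain_insertions_Cons) auto
    then show ?thesis using False Cons by (simp add: algebra_simps)
  qed
  finally show ?thesis .
qed

text \<open>If \<open>p\<close> has no cycle, it is a forest with roots among
  \<open>m + 1, ..., m + n\<close>, and these are its linear extensions: list \<open>k\<close>
  orders the tree at the root \<open>m + k\<close> with every label in front of its parent.\<close>

definition tree_arrangements :: "nat \<Rightarrow> nat \<Rightarrow> nat set \<Rightarrow> (nat \<Rightarrow> nat) \<Rightarrow> (nat \<Rightarrow> nat list) set" where
  "tree_arrangements m n A p = {B \<in> arrangements n A. \<forall>a\<in>A. linked m n B a (p a)}"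

definition delete_label :: "nat \<Rightarrow> nat \<Rightarrow> (nat \<Rightarrow> nat list) \<Rightarrow> nat \<Rightarrow> nat list" where
  "delete_label n a B = (\<lambda>k\<in>{1..n}. filter (\<lambda>b. b \<noteq> a) (B k))"

lemma delete_label_arrangements:
  assumes "B \<in> arrangements n A"
  shows "delete_label n a B \<in> arrangements n (A - {a})"
proof (rule arrangementsI, goal_cases)
  case 1 show ?case by (simp add: delete_label_def)
next
  case (2 k) then show ?case using arrangementsD(1)[OF assms] by (simp add: delete_label_def)
next
  case (3 k) then show ?case using arrangementsD(2)[OF assms 3] by (auto simp: delete_label_def)
next
  case (4 b j k)
  show ?case by (rule arrangementsD(3)[OF assms _ _ 4(3,4)]) (use 4 in \<open>auto simp: delete_label_def\<close>)
next
  case (5 b) then show ?case using arrangementsD(4)[OF assms, of b] by (auto simp: delete_label_def)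
qed

lemma linked_delete_label:
  assumes "b \<noteq> a" "q \<noteq> a"
  shows "linked m n (delete_label n a B) b q = linked m n B b q"
  using assms unfolding linked_def delete_label_def by (auto simp: precedes_filter)

text \<open>No label has to precede a leaf, so putting \<open>a\<close> back means inserting it in
  front of its parent, in the one list \<open>k0\<close> that contains the parent or has it as its
  root.\<close>

lemma tree_arrangements_fiber:
  assumes A: "A \<subseteq> {1..m}" and a: "a \<in> A" and leaf: "\<And>b. b \<in> A \<Longrightarrow> p b \<noteq> a"
    and B': "B' \<in> tree_arrangements m n (A - {a}) p"
    and k0: "k0 \<in> {1..n}" "p a = m + k0 \<or> p a \<in> set (B' k0)"
  shows "{B \<in> tree_arrangements m n A p. delete_label n a B = B'} =
    (\<lambda>zs. B'(k0 := zs)) ` set (insertions a (p a) (B' k0))"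
proof -
  have arr': "B' \<in> arrangements n (A - {a})" using B' by (simp add: tree_arrangements_def)
  note D' = arrangementsD[OF arr']
  have small: "b \<le> m" if "b \<in> set (B' k0)" for b
    using D'(2)[OF k0(1)] A that by auto
  have ins: "set (insertions a (p a) (B' k0)) = {ys. distinct ys \<and> a \<in> set ys \<and>
      filter (\<lambda>b. b \<noteq> a) ys = B' k0 \<and> (p a \<in> set (B' k0) \<longrightarrow> precedes ys a (p a))}"
    using D'(1,2)[OF k0(1)] by (intro set_insertions) auto
  show ?thesis
  proof (intro equalityI subsetI)
    fix B assume "B \<in> {B \<in> tree_arrangements m n A p. delete_label n a B = B'}"
    then have arr: "B \<in> arrangements n A" and del: "B' = delete_label n a B"
      and lnk: "linked m n B a (p a)"
      using a by (auto simp: tree_arrangements_def)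
    note D = arrangementsD[OF arr]
    have B'k: "B' k = filter (\<lambda>b. b \<noteq> a) (B k)" if "k \<in> {1..n}" for k
      using that by (simp add: del delete_label_def)
    obtain k where k: "k \<in> {1..n}" "a \<in> set (B k)" "p a = m + k \<or> precedes (B k) a (p a)"
      using lnk unfolding linked_def by blast
    have pk: "precedes (B k) a (p a)" if "p a \<in> set (B' k0)"
      using k(3) small[OF that] k(1) by auto
    have kk: "k = k0"
    proof (cases "p a \<in> set (B' k0)")
      case True
      then have "p a \<in> set (B k0)" using B'k[OF k0(1)] by auto
      moreover have "p a \<in> set (B k)" using precedes_set[OF pk[OF True]] by simp
      ultimately show ?thesis using D(3) k k0 by blast
    next
      case False
      then have "p a = m + k0" using k0(2) by simp
      then show ?thesis using k D(2)[OF k(1)] A precedes_set[of "B k" a "p a"] k0(1) by fastforce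
    qed
    have "B = B'(k0 := B k0)"
    proof
      fix j show "B j = (B'(k0 := B k0)) j"
      proof (cases "j = k0 \<or> j \<notin> {1..n}")
        case True
        then show ?thesis using D(5) D'(5) by (auto simp: extensional_def)
      next
        case False
        then have j: "j \<noteq> k0" "j \<in> {1..n}" by auto
        have "a \<notin> set (B j)" using D(3)[of a j k] k kk j by blast
        then have "filter (\<lambda>b. b \<noteq> a) (B j) = B j" by (auto intro: filter_True)
        then show ?thesis using B'k[OF j(2)] j by simp
      qed
    qed
    moreover have "B k0 \<in> set (insertions a (p a) (B' k0))"
      unfolding ins using D(1)[OF k0(1)] k(2) kk B'k[OF k0(1)] pk by auto
    ultimately show "B \<in> (\<lambda>zs. B'(k0 := zs)) ` set (insertions a (p a) (B' k0))" by blast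
  next
    fix B assume "B \<in> (\<lambda>zs. B'(k0 := zs)) ` set (insertions a (p a) (B' k0))"
    then obtain zs where B: "B = B'(k0 := zs)" and zs: "distinct zs" "a \<in> set zs"
      "filter (\<lambda>b. b \<noteq> a) zs = B' k0" "p a \<in> set (B' k0) \<longrightarrow> precedes zs a (p a)"
      unfolding ins by blast
    have set_zs: "set zs = insert a (set (B' k0))" using zs(2) unfolding zs(3)[symmetric] by auto
    have anot: "a \<notin> set (B' k)" if "k \<in> {1..n}" for k using D'(2)[OF that] by auto
    have set_B: "b \<in> set (B k) \<longleftrightarrow> (if b = a then k = k0 else b \<in> set (B' k))" if "k \<in> {1..n}" for b k
      using set_zs anot[OF that] by (auto simp: B)
    have arr: "B \<in> arrangements n A"
    proof (rule arrangementsI)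
      show "B \<in> extensional {1..n}" using D'(5) k0(1) by (auto simp: B extensional_def)
      show "distinct (B k)" if "k \<in> {1..n}" for k using D'(1)[OF that] zs(1) by (simp add: B)
      show "set (B k) \<subseteq> A" if "k \<in> {1..n}" for k
        using D'(2)[OF that] a set_B[OF that] by (auto split: if_splits)
      show "j = k" if "b \<in> set (B j)" "b \<in> set (B k)" "j \<in> {1..n}" "k \<in> {1..n}" for b j k
        using that D'(3)[of b j k] by (auto simp: set_B split: if_splits)
      show "\<exists>k\<in>{1..n}. b \<in> set (B k)" if "b \<in> A" for b
        using D'(4)[of b] that k0(1) set_B by (cases "b = a") auto
    qed
    have del: "delete_label n a B = B'"
    proof
      fix k show "delete_label n a B k = B' k"
      proof (cases "k \<in> {1..n}")
        case True
        have "filter (\<lambda>b. b \<noteq> a) (B' k) = B' k" using anot[OF True] by (auto intro: filter_True)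
        then show ?thesis using True zs(3) by (simp add: delete_label_def B)
      next
        case False
        then show ?thesis using D'(5) by (simp add: delete_label_def extensional_def del: atLeastAtMost_iff)
      qed
    qed
    have "linked m n B b (p b)" if "b \<in> A" for b
    proof (cases "b = a")
      case True
      then show ?thesis using k0 zs(2,4) unfolding linked_def by (intro bexI[of _ k0]) (auto simp: B)
    next
      case False
      then have "linked m n B' b (p b)" using B' that by (simp add: tree_arrangements_def)
      then show ?thesis
        using linked_delete_label[of b a "p b" m n B] False leaf[OF that] del by simp
    qed
    then show "B \<in> {B \<in> tree_arrangements m n A p. delete_label n a B = B'}"
      using arr del by (simp add: tree_arrangements_def)
  qed
qed

text \<open>The arrangements are grouped by what remains after deleting the leaf \<open>a\<close>.
  Within a group only one list varies, and its chains add up to the chain without \<open>a\<close>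
  times \<open>1 / (x a - x (p a))\<close>.\<close>

lemma tree_arrangements_leaf:
  assumes A: "A \<subseteq> {1..m}" and a: "a \<in> A" and leaf: "\<And>b. b \<in> A \<Longrightarrow> p b \<noteq> a"
    and pa: "p a \<in> A \<union> {m + 1..m + n}"
    and gen: "\<And>b q. b \<in> A \<Longrightarrow> q \<in> A \<union> {m + 1..m + n} \<Longrightarrow> b \<noteq> q \<Longrightarrow> x b \<noteq> x q"
  shows "(\<Sum>B\<in>tree_arrangements m n A p. chain_prod m n x B) =
    (\<Sum>B\<in>tree_arrangements m n (A - {a}) p. chain_prod m n x B) / (x a - x (p a))"
proof -
  have finA: "finite A" using A finite_subset by blast
  have fin: "finite (tree_arrangements m n A' p)" if "A' \<subseteq> A" for A'
    using finite_arrangements[of A' n] finA that finite_subset[of A' A] by (auto simp: tree_arrangements_def)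
  have "(\<Sum>B\<in>tree_arrangements m n A p. chain_prod m n x B) =
    (\<Sum>B'\<in>tree_arrangements m n (A - {a}) p.
      \<Sum>B\<in>{B \<in> tree_arrangements m n A p. delete_label n a B = B'}. chain_prod m n x B)"
  proof (rule sum.group[symmetric])
    show "delete_label n a ` tree_arrangements m n A p \<subseteq> tree_arrangements m n (A - {a}) p"
    proof (intro image_subsetI)
      fix B assume B: "B \<in> tree_arrangements m n A p"
      then have "linked m n (delete_label n a B) b (p b)" if "b \<in> A - {a}" for b
        using that leaf[of b] by (simp add: tree_arrangements_def linked_delete_label)
      with B show "delete_label n a B \<in> tree_arrangements m n (A - {a}) p"
        by (simp add: tree_arrangements_def delete_label_arrangements)
    qed
  qed (auto intro: fin)
  also have "\<dots> = (\<Sum>B'\<in>tree_arrangements m n (A - {a}) p. chain_prod m n x B' / (x a - x (p a)))"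
  proof (rule sum.cong[OF refl])
    fix B' assume B': "B' \<in> tree_arrangements m n (A - {a}) p"
    then have arr': "B' \<in> arrangements n (A - {a})" by (simp add: tree_arrangements_def)
    note D' = arrangementsD[OF arr']
    obtain k0 where k0: "k0 \<in> {1..n}" "p a = m + k0 \<or> p a \<in> set (B' k0)"
    proof (cases "p a \<in> A")
      case True
      then show ?thesis using D'(4)[of "p a"] leaf[OF a] that by auto
    next
      case False
      then have "p a \<in> {m + 1..m + n}" using pa by auto
      then have "p a - m \<in> {1..n}" "p a = m + (p a - m)" by auto
      then show ?thesis using that by blast
    qed
    have set0: "set (B' k0) \<subseteq> A - {a}" by (rule D'(2)[OF k0(1)])
    have inj: "inj_on (\<lambda>zs. B'(k0 := zs)) Z" for Z by (intro inj_onI) (metis fun_upd_same)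
    have rest: "chain_prod m n x (B'(k0 := zs)) =
        chain_fun x (x (m + k0)) zs * (\<Prod>k\<in>{1..n} - {k0}. chain_fun x (x (m + k)) (B' k))" for zs
      unfolding chain_prod_def using k0(1) by (subst prod.remove[of _ k0]) auto
    have "(\<Sum>B\<in>{B \<in> tree_arrangements m n A p. delete_label n a B = B'}. chain_prod m n x B) =
      (\<Sum>zs\<in>set (insertions a (p a) (B' k0)). chain_prod m n x (B'(k0 := zs)))"
      unfolding tree_arrangements_fiber[where p = p, OF A a leaf B' k0, simplified]
      by (subst sum.reindex[OF inj]) simp
    also have "\<dots> = (\<Sum>zs\<leftarrow>insertions a (p a) (B' k0). chain_fun x (x (m + k0)) zs) *
        (\<Prod>k\<in>{1..n} - {k0}. chain_fun x (x (m + k)) (B' k))"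
      unfolding rest sum_distrib_right[symmetric] using set0
      by (subst sum.distinct_set_conv_list) (auto intro!: distinct_insertions)
    also have "(\<Sum>zs\<leftarrow>insertions a (p a) (B' k0). chain_fun x (x (m + k0)) zs) =
        chain_fun x (x (m + k0)) (B' k0) / (x a - x (p a))"
    proof (rule sum_chain_insertions)
      have big: "m + k0 \<in> A \<union> {m + 1..m + n}" "\<And>b. b \<in> A \<Longrightarrow> b \<noteq> m + k0" using k0(1) A by auto
      show "inj_on x (set (B' k0))" using set0 gen by (auto intro!: inj_onI)
      show "a \<notin> set (B' k0)" using set0 by auto
      show "distinct (B' k0)" by (rule D'(1)[OF k0(1)])
      show "x b \<noteq> x a \<and> x b \<noteq> x (m + k0)" if "b \<in> set (B' k0)" for b
        using that set0 gen[of b a] gen[of b "m + k0"] big a by auto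
      show "x a \<noteq> x (m + k0)" using gen[of a "m + k0"] big a by auto
      show "p a \<in> set (B' k0) \<and> x (p a) = x (p a) \<or> p a \<notin> set (B' k0) \<and> x (p a) = x (m + k0)"
        using k0 by auto
    qed
    finally show "(\<Sum>B\<in>{B \<in> tree_arrangements m n A p. delete_label n a B = B'}. chain_prod m n x B) =
      chain_prod m n x B' / (x a - x (p a))"
      using rest[of "B' k0"] by simp
  qed
  finally show ?thesis by (simp add: sum_divide_distrib)
qed

text \<open>Both sides vanish unless every label is connected to a root by \<open>p\<close>: a cycle of \<open>p\<close>
  has no leaf, and it gives a kernel vector of the matrix with constant entries.\<close>

lemma tree_chain_sum:
  fixes p :: "nat \<Rightarrow> nat" and x :: "nat \<Rightarrow> complex"
  defines "\<delta> \<equiv> \<lambda>A. set_det A (\<lambda>a b. of_bool (a = b) - of_bool (p a = b)) :: complex"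
  assumes A: "A \<subseteq> {1..m}" and p: "\<And>a. a \<in> A \<Longrightarrow> p a \<in> A \<union> {m + 1..m + n}"
    and gen: "\<And>b q. b \<in> A \<Longrightarrow> q \<in> A \<union> {m + 1..m + n} \<Longrightarrow> b \<noteq> q \<Longrightarrow> x b \<noteq> x q"
  shows "(\<Sum>B\<in>tree_arrangements m n A p. chain_prod m n x B) = \<delta> A * (\<Prod>a\<in>A. 1 / (x a - x (p a)))"
    and "\<delta> A * \<delta> A = \<delta> A"
proof -
  have finA: "finite A" using A finite_subset by blast
  have "(\<Sum>B\<in>tree_arrangements m n A p. chain_prod m n x B) = \<delta> A * (\<Prod>a\<in>A. 1 / (x a - x (p a))) \<and>
    \<delta> A * \<delta> A = \<delta> A"
    using finA A p gen
  proof (induction A rule: finite_psubset_induct)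
    case (psubset A)
    show ?case
    proof (cases "A = {}")
      case True
      have "B = (\<lambda>k\<in>{1..n}. [])" if "B \<in> arrangements n {}" for B
      proof
        fix k show "B k = (\<lambda>k\<in>{1..n}. []) k"
          using arrangementsD(2)[OF that, of k] arrangementsD(5)[OF that]
          by (cases "k \<in> {1..n}") (simp_all add: extensional_def del: atLeastAtMost_iff)
      qed
      moreover have "(\<lambda>k\<in>{1..n}. []) \<in> arrangements n {}" by (rule arrangementsI) auto
      ultimately have "arrangements n {} = {\<lambda>k\<in>{1..n}. []}" by blast
      then show ?thesis using True
        by (simp add: tree_arrangements_def chain_prod_def \<delta>_def set_det_def)
    next
      case nonempty: False
      show ?thesis
      proof (cases "\<exists>a\<in>A. \<forall>b\<in>A. p b \<noteq> a")
        case True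
        then obtain a where a: "a \<in> A" and leaf: "\<And>b. b \<in> A \<Longrightarrow> p b \<noteq> a" by blast
        \<comment> \<open>No label has parent \<open>a\<close>, so column \<open>a\<close> is a unit
          column.\<close>
        have eq: "\<delta> A = \<delta> (A - {a})"
          unfolding \<delta>_def using psubset.hyps a leaf by (intro set_det_expand_column) auto
        have IH: "(\<Sum>B\<in>tree_arrangements m n (A - {a}) p. chain_prod m n x B) =
            \<delta> (A - {a}) * (\<Prod>a\<in>A - {a}. 1 / (x a - x (p a))) \<and> \<delta> (A - {a}) * \<delta> (A - {a}) = \<delta> (A - {a})"
        proof (rule psubset.IH)
          show "A - {a} \<subset> A" using a by auto
          show "A - {a} \<subseteq> {1..m}" using psubset.prems(1) by auto
          show "p b \<in> A - {a} \<union> {m + 1..m + n}" if "b \<in> A - {a}" for b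
            using psubset.prems(2)[of b] leaf[of b] that by auto
          show "x b \<noteq> x q" if "b \<in> A - {a}" "q \<in> A - {a} \<union> {m + 1..m + n}" "b \<noteq> q" for b q
            using psubset.prems(3)[of b q] that by auto
        qed
        have "(\<Sum>B\<in>tree_arrangements m n A p. chain_prod m n x B) =
            (\<Sum>B\<in>tree_arrangements m n (A - {a}) p. chain_prod m n x B) / (x a - x (p a))"
          using psubset.prems(1) a leaf psubset.prems(2)[OF a] psubset.prems(3)
          by (rule tree_arrangements_leaf)
        with IH eq show ?thesis
          using prod.remove[OF psubset.hyps a, of "\<lambda>a. 1 / (x a - x (p a))"] by simp
      next
        case False
        have sub: "A \<subseteq> p ` A"
        proof
          fix a assume "a \<in> A"
          with False obtain b where "b \<in> A" "p b = a" by blast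
          then show "a \<in> p ` A" by blast
        qed
        \<comment> \<open>Without a leaf every label is a parent, so by counting \<open>p\<close>
          maps \<open>A\<close> onto itself and reaches no root.\<close>
        have im: "p ` A = A"
          using sub psubset.hyps card_image_le[OF psubset.hyps, of p]
          by (intro card_seteq[symmetric] finite_imageI)
        \<comment> \<open>The head of a non-empty list is the parent of some label, which would have
          to stand in front of it.\<close>
        have none: "tree_arrangements m n A p = {}"
        proof (rule ccontr)
          assume "tree_arrangements m n A p \<noteq> {}"
          then obtain B where arr: "B \<in> arrangements n A" and lnk: "\<And>a. a \<in> A \<Longrightarrow> linked m n B a (p a)"
            by (auto simp: tree_arrangements_def)
          note D = arrangementsD[OF arr]
          obtain a where "a \<in> A" using nonempty by blast
          then obtain k where k: "k \<in> {1..n}" "a \<in> set (B k)" using D(4) by blast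
          then obtain h ys where h: "B k = h # ys" by (cases "B k") auto
          then have "h \<in> A" using D(2)[OF k(1)] by auto
          then obtain b where b: "b \<in> A" "p b = h" using sub by auto
          obtain j where j: "j \<in> {1..n}" "b \<in> set (B j)" "h = m + j \<or> precedes (B j) b h"
            using lnk[OF b(1)] b(2) unfolding linked_def by blast
          have "h \<le> m" using \<open>h \<in> A\<close> psubset.prems(1) by auto
          then have pr: "precedes (B j) b h" using j by auto
          then have "j = k" using D(3)[of h j k] j(1) k(1) h precedes_set[OF pr] by auto
          with pr h have "h \<in> set ys" using precedes_set[of ys b h] by auto
          then show False using D(1)[OF k(1)] h by simp
        qed
        obtain a where a: "a \<in> A" using nonempty by blast
        have "\<delta> A = 0"
          unfolding \<delta>_def
        proof (rule set_det_zero_kernel[where u = "\<lambda>_. 1"])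
          fix a assume "a \<in> A"
          then have "p a \<in> A" using im by auto
          then show "(\<Sum>b\<in>A. (of_bool (a = b) - of_bool (p a = b)) * (1::complex)) = 0"
            using \<open>a \<in> A\<close> psubset.hyps by (simp add: sum_subtractf of_bool_def sum.delta)
        qed (use psubset.hyps a in auto)
        with none show ?thesis by simp
      qed
    qed
  qed
  then show "(\<Sum>B\<in>tree_arrangements m n A p. chain_prod m n x B) = \<delta> A * (\<Prod>a\<in>A. 1 / (x a - x (p a)))"
    and "\<delta> A * \<delta> A = \<delta> A" by auto
qed

section \<open>Pairs of orderings with a common parent map\<close>

lemma precedes_split:
  "distinct (ys @ a # xs) \<Longrightarrow> precedes (ys @ a # xs) a q \<Longrightarrow> q \<in> set xs"
  by (induction ys) (auto dest: precedes_set)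

text \<open>The parent map alone determines the list in which a label lies. The induction runs from
  the end of the list \<open>B k\<close>: the parent of a label is the root \<open>m + k\<close> or
  a later label, and the latter is already known to lie in \<open>C k\<close>.\<close>

lemma linked_same_blocks:
  assumes A: "A \<subseteq> {1..m}" and B: "B \<in> arrangements n A" and C: "C \<in> arrangements n A"
    and lB: "\<And>a. a \<in> A \<Longrightarrow> linked m n B a (p a)" and lC: "\<And>a. a \<in> A \<Longrightarrow> linked m n C a (p a)"
    and k: "k \<in> {1..n}"
  shows "set (B k) \<subseteq> set (C k)"
proof -
  have "set xs \<subseteq> set (C k)" if "B k = ys @ xs" for xs ys
    using that
  proof (induction xs arbitrary: ys)
    case (Cons a xs)
    have IH: "set xs \<subseteq> set (C k)" using Cons.IH[of "ys @ [a]"] Cons.prems by simp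
    have aB: "a \<in> set (B k)" using Cons.prems by simp
    then have aA: "a \<in> A" using arrangementsD(2)[OF B k] by blast
    obtain j where j: "j \<in> {1..n}" "a \<in> set (B j)" "p a = m + j \<or> precedes (B j) a (p a)"
      using lB[OF aA] unfolding linked_def by blast
    have jk: "j = k" using arrangementsD(3)[OF B j(2) aB j(1) k] .
    obtain i where i: "i \<in> {1..n}" "a \<in> set (C i)" "p a = m + i \<or> precedes (C i) a (p a)"
      using lC[OF aA] unfolding linked_def by blast
    have small: "q \<le> m" if "q \<in> set (C i')" "i' \<in> {1..n}" for q i'
      using arrangementsD(2)[OF C that(2)] that(1) A by auto
    have "i = k"
    proof (cases "p a = m + k")
      case True
      then show ?thesis using i small[of "p a" i] k precedes_set[of "C i" a "p a"] by auto
    next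
      case False
      then have "precedes (ys @ a # xs) a (p a)" using j(3) jk Cons.prems by simp
      then have "p a \<in> set xs"
        using precedes_split arrangementsD(1)[OF B k] Cons.prems by metis
      then have pC: "p a \<in> set (C k)" using IH by blast
      then have "p a \<in> set (C i)" using i small[OF pC k] precedes_set[of "C i" a "p a"] by auto
      then show ?thesis using arrangementsD(3)[OF C _ pC i(1) k] by simp
    qed
    then show ?case using IH i(2) by simp
  qed simp
  from this[of "[]" "B k"] show ?thesis by simp
qed

text \<open>A weighted matrix-tree theorem: expanding the product over the labels gives a sum over parent
  maps, and for each of them the sums over \<open>B\<close> and \<open>C\<close> factorize.\<close>

lemma chain_pair_sum:
  fixes x y :: "nat \<Rightarrow> complex" and G :: "nat \<Rightarrow> nat \<Rightarrow> complex"
  assumes genx: "\<And>b q. b \<in> {1..m} \<Longrightarrow> q \<in> {1..m + n} \<Longrightarrow> b \<noteq> q \<Longrightarrow> x b \<noteq> x q"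
    and geny: "\<And>b q. b \<in> {1..m} \<Longrightarrow> q \<in> {1..m + n} \<Longrightarrow> b \<noteq> q \<Longrightarrow> y b \<noteq> y q"
  shows "(\<Sum>B\<in>arrangements n {1..m}. \<Sum>C | C \<in> arrangements n {1..m} \<and> (\<forall>k\<in>{1..n}. set (C k) = set (B k)).
      chain_prod m n x B * chain_prod m n y C *
      (\<Prod>a\<in>{1..m}. \<Sum>q | q \<in> {1..m + n} \<and> linked m n B a q \<and> linked m n C a q. G a q)) =
    set_det {1..m} (\<lambda>a b. \<Sum>q\<in>{1..m + n}. G a q / ((x a - x q) * (y a - y q)) * (of_bool (a = b) - of_bool (q = b)))"
proof -
  define L Q where "L = {1..m}" and "Q = {1..m + n}"
  define W where "W B C = (\<Prod>a\<in>L. \<Sum>q | q \<in> Q \<and> linked m n B a q \<and> linked m n C a q. G a q)" for B C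
  define T where "T p = tree_arrangements m n L p" for p
  define \<delta> where "\<delta> p = (set_det L (\<lambda>a b. of_bool (a = b) - of_bool (p a = b)) :: complex)" for p
  have finL: "finite L" and finQ: "finite Q" and LQ: "L \<union> {m + 1..m + n} = Q"
    by (auto simp: L_def Q_def)
  have finP: "finite (L \<rightarrow>\<^sub>E Q)" using finL finQ by (intro finite_PiE)
  have finA: "finite (arrangements n L)" using finL by (rule finite_arrangements)
  have W: "W B C = (\<Sum>p\<in>L \<rightarrow>\<^sub>E Q. of_bool (B \<in> T p) * of_bool (C \<in> T p) * (\<Prod>a\<in>L. G a (p a)))"
    if "B \<in> arrangements n L" "C \<in> arrangements n L" for B C
  proof -
    have "W B C = (\<Prod>a\<in>L. \<Sum>q\<in>Q. of_bool (linked m n B a q \<and> linked m n C a q) * G a q)"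
      unfolding W_def
      by (intro prod.cong refl sum.mono_neutral_cong_left finQ) auto
    also have "\<dots> = (\<Sum>p\<in>L \<rightarrow>\<^sub>E Q. \<Prod>a\<in>L. of_bool (linked m n B a (p a) \<and> linked m n C a (p a)) * G a (p a))"
      by (rule prod_sum_PiE) (use finL finQ in auto)
    also have "\<dots> = (\<Sum>p\<in>L \<rightarrow>\<^sub>E Q. of_bool (B \<in> T p) * of_bool (C \<in> T p) * (\<Prod>a\<in>L. G a (p a)))"
    proof (rule sum.cong[OF refl])
      fix p assume "p \<in> L \<rightarrow>\<^sub>E Q"
      show "(\<Prod>a\<in>L. of_bool (linked m n B a (p a) \<and> linked m n C a (p a)) * G a (p a)) =
        of_bool (B \<in> T p) * of_bool (C \<in> T p) * (\<Prod>a\<in>L. G a (p a))"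
      proof (cases "B \<in> T p \<and> C \<in> T p")
        case True
        then have "linked m n B a (p a) \<and> linked m n C a (p a)" if "a \<in> L" for a
          using that by (simp add: T_def tree_arrangements_def)
        with True show ?thesis by simp
      next
        case False
        then obtain a where "a \<in> L" "\<not> (linked m n B a (p a) \<and> linked m n C a (p a))"
          using \<open>B \<in> arrangements n L\<close> \<open>C \<in> arrangements n L\<close> by (auto simp: T_def tree_arrangements_def)
        then have "(\<Prod>a\<in>L. of_bool (linked m n B a (p a) \<and> linked m n C a (p a)) * G a (p a)) = 0"
          using finL by (intro prod_zero) auto
        with False show ?thesis by auto
      qed
    qed
    finally show ?thesis .
  qed
  \<comment> \<open>A parent map respected by both arrangements fixes the set of labels in each
    list. So the sum over \<open>C\<close> may be extended to all arrangements, and this separates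
    the sums over \<open>B\<close> and \<open>C\<close>.\<close>
  have mismatch: "W B C = 0" if B: "B \<in> arrangements n L" and C: "C \<in> arrangements n L"
    and ne: "\<not> (\<forall>k\<in>{1..n}. set (C k) = set (B k))" for B C
  proof -
    have "\<not> (B \<in> T p \<and> C \<in> T p)" for p
    proof
      assume "B \<in> T p \<and> C \<in> T p"
      then have l: "linked m n B a (p a)" "linked m n C a (p a)" if "a \<in> L" for a
        using that by (simp_all add: T_def tree_arrangements_def)
      have L: "L \<subseteq> {1..m}" by (simp add: L_def)
      have "set (C k) = set (B k)" if "k \<in> {1..n}" for k
        using linked_same_blocks[OF L B C l that] linked_same_blocks[OF L C B l(2) l(1) that] by blast
      with ne show False by blast
    qed
    then show ?thesis unfolding W[OF B C] by (intro sum.neutral) auto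
  qed
  have chain: "(\<Sum>B\<in>arrangements n L. of_bool (B \<in> T p) * chain_prod m n u B) = \<delta> p * (\<Prod>a\<in>L. 1 / (u a - u (p a)))"
    and \<delta>\<delta>: "\<delta> p * \<delta> p = \<delta> p"
    if p: "p \<in> L \<rightarrow>\<^sub>E Q" and gen: "\<And>b q. b \<in> {1..m} \<Longrightarrow> q \<in> {1..m + n} \<Longrightarrow> b \<noteq> q \<Longrightarrow> u b \<noteq> u q" for p u
  proof -
    have p': "p a \<in> L \<union> {m + 1..m + n}" if "a \<in> L" for a using p that LQ by auto
    have gen': "u b \<noteq> u q" if "b \<in> L" "q \<in> L \<union> {m + 1..m + n}" "b \<noteq> q" for b q
      using gen that unfolding LQ by (simp add: L_def Q_def)
    have "(\<Sum>B\<in>arrangements n L. of_bool (B \<in> T p) * chain_prod m n u B) = (\<Sum>B\<in>T p. chain_prod m n u B)"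
      by (intro sum.mono_neutral_cong_right finA) (auto simp: T_def tree_arrangements_def)
    also have "\<dots> = \<delta> p * (\<Prod>a\<in>L. 1 / (u a - u (p a)))"
      unfolding T_def \<delta>_def by (rule tree_chain_sum(1)[OF _ p' gen']) (simp_all add: L_def)
    finally show "(\<Sum>B\<in>arrangements n L. of_bool (B \<in> T p) * chain_prod m n u B) = \<delta> p * (\<Prod>a\<in>L. 1 / (u a - u (p a)))"
      .
    show "\<delta> p * \<delta> p = \<delta> p"
      unfolding \<delta>_def by (rule tree_chain_sum(2)[OF _ p' gen']) (simp_all add: L_def)
  qed
  have "(\<Sum>B\<in>arrangements n L. \<Sum>C | C \<in> arrangements n L \<and> (\<forall>k\<in>{1..n}. set (C k) = set (B k)).
      chain_prod m n x B * chain_prod m n y C * W B C) =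
    (\<Sum>B\<in>arrangements n L. \<Sum>C\<in>arrangements n L. chain_prod m n x B * chain_prod m n y C * W B C)"
    by (intro sum.cong refl sum.mono_neutral_left finA) (auto simp: mismatch)
  also have "\<dots> = (\<Sum>B\<in>arrangements n L. \<Sum>C\<in>arrangements n L. \<Sum>p\<in>L \<rightarrow>\<^sub>E Q. (\<Prod>a\<in>L. G a (p a)) *
      (of_bool (B \<in> T p) * chain_prod m n x B) * (of_bool (C \<in> T p) * chain_prod m n y C))"
    by (intro sum.cong refl) (simp only: W sum_distrib_left mult_ac)
  also have "\<dots> = (\<Sum>p\<in>L \<rightarrow>\<^sub>E Q. \<Sum>B\<in>arrangements n L. \<Sum>C\<in>arrangements n L. (\<Prod>a\<in>L. G a (p a)) *
      (of_bool (B \<in> T p) * chain_prod m n x B) * (of_bool (C \<in> T p) * chain_prod m n y C))"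
    by (subst sum.swap[of _ _ "arrangements n L"], subst sum.swap[of _ _ "L \<rightarrow>\<^sub>E Q"])
      (intro sum.cong refl sum.swap)
  also have "\<dots> = (\<Sum>p\<in>L \<rightarrow>\<^sub>E Q. (\<Prod>a\<in>L. G a (p a)) *
      ((\<Sum>B\<in>arrangements n L. of_bool (B \<in> T p) * chain_prod m n x B) *
       (\<Sum>C\<in>arrangements n L. of_bool (C \<in> T p) * chain_prod m n y C)))"
    unfolding sum_product by (simp only: sum_distrib_left mult.assoc)
  also have "\<dots> = (\<Sum>p\<in>L \<rightarrow>\<^sub>E Q. (\<Prod>a\<in>L. G a (p a) / ((x a - x (p a)) * (y a - y (p a)))) * \<delta> p)"
  proof (rule sum.cong[OF refl])
    fix p assume p: "p \<in> L \<rightarrow>\<^sub>E Q"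
    have "(\<Prod>a\<in>L. G a (p a) / ((x a - x (p a)) * (y a - y (p a)))) =
      (\<Prod>a\<in>L. G a (p a)) * (\<Prod>a\<in>L. 1 / (x a - x (p a))) * (\<Prod>a\<in>L. 1 / (y a - y (p a)))"
      unfolding prod.distrib[symmetric] by (intro prod.cong) auto
    \<comment> \<open>Each of the two chain sums brings a factor \<open>\<delta> p\<close>. It is
      idempotent, so a single copy survives, and this is the determinant that the expansion by rows
      asks for.\<close>
    moreover have "\<delta> p * s * (\<delta> p * t) = s * t * \<delta> p" for s t
    proof -
      have "\<delta> p * s * (\<delta> p * t) = (\<delta> p * \<delta> p) * (s * t)" by (simp only: mult_ac)
      also have "\<delta> p * \<delta> p = \<delta> p" by (rule \<delta>\<delta>[OF p, of x]) (rule genx)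
      finally show ?thesis by (simp only: mult_ac)
    qed
    moreover have cx: "(\<Sum>B\<in>arrangements n L. of_bool (B \<in> T p) * chain_prod m n x B) = \<delta> p * (\<Prod>a\<in>L. 1 / (x a - x (p a)))"
      by (rule chain[OF p]) (rule genx)
    moreover have cy: "(\<Sum>B\<in>arrangements n L. of_bool (B \<in> T p) * chain_prod m n y B) = \<delta> p * (\<Prod>a\<in>L. 1 / (y a - y (p a)))"
      by (rule chain[OF p]) (rule geny)
    ultimately show "(\<Prod>a\<in>L. G a (p a)) * ((\<Sum>B\<in>arrangements n L. of_bool (B \<in> T p) * chain_prod m n x B) *
       (\<Sum>C\<in>arrangements n L. of_bool (C \<in> T p) * chain_prod m n y C)) =
       (\<Prod>a\<in>L. G a (p a) / ((x a - x (p a)) * (y a - y (p a)))) * \<delta> p"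
      using cx cy by simp
  qed
  also have "\<dots> = set_det L (\<lambda>a b. \<Sum>q\<in>Q. G a q / ((x a - x q) * (y a - y q)) * (of_bool (a = b) - of_bool (q = b)))"
    unfolding \<delta>_def by (rule set_det_row_sums[OF finL finQ, symmetric])
  finally show ?thesis unfolding W_def L_def Q_def .
qed

section \<open>The universal weight function as a sum over arrangements\<close>

lemma arrangements_permute:
  assumes C: "C \<in> arrangements n L" and \<sigma>: "\<sigma> permutes L"
  shows "(\<lambda>s\<in>{1..n}. map \<sigma> (C s)) \<in> arrangements n L"
proof (rule arrangementsI, goal_cases)
  case (2 s)
  then show ?case
    using arrangementsD(1)[OF C 2] permutes_inj_on[OF \<sigma>] by (simp add: distinct_map)
next
  case (3 s)
  then show ?case
    using arrangementsD(2)[OF C 3] permutes_in_image[OF \<sigma>] by auto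
next
  case (4 a j k)
  then obtain b b' where b: "b \<in> set (C j)" "\<sigma> b = a" "b' \<in> set (C k)" "\<sigma> b' = a" by auto
  then have "b = b'" using permutes_inj[OF \<sigma>] by (auto dest: injD)
  then show ?case using arrangementsD(3)[OF C, of b j k] b 4 by simp
next
  case (5 a)
  then have "inv_into UNIV \<sigma> a \<in> L" using permutes_in_image[OF permutes_inv[OF \<sigma>]] by simp
  then obtain k where k: "k \<in> {1..n}" "inv_into UNIV \<sigma> a \<in> set (C k)" using arrangementsD(4)[OF C] by blast
  moreover have "a = \<sigma> (inv_into UNIV \<sigma> a)" using permutes_inverses(1)[OF \<sigma>] by simp
  ultimately show ?case by (intro bexI[of _ k]) auto
qed auto

text \<open>\<open>C\<close> names every position by a label, so an arrangement of the same shape is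
  a relabelling of \<open>C\<close> by a unique permutation.\<close>

lemma bij_betw_permute_arrangement:
  assumes fin: "finite L" and C: "C \<in> arrangements n L"
  shows "bij_betw (\<lambda>\<sigma>. \<lambda>s\<in>{1..n}. map \<sigma> (C s)) {\<sigma>. \<sigma> permutes L}
    {B \<in> arrangements n L. \<forall>s\<in>{1..n}. length (B s) = length (C s)}"
  unfolding bij_betw_def
proof (intro conjI equalityI subsetI)
  show "inj_on (\<lambda>\<sigma>. \<lambda>s\<in>{1..n}. map \<sigma> (C s)) {\<sigma>. \<sigma> permutes L}"
  proof (rule inj_onI)
    fix \<sigma> \<tau> assume *: "\<sigma> \<in> {\<sigma>. \<sigma> permutes L}" "\<tau> \<in> {\<sigma>. \<sigma> permutes L}"
      "(\<lambda>s\<in>{1..n}. map \<sigma> (C s)) = (\<lambda>s\<in>{1..n}. map \<tau> (C s))"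
    show "\<sigma> = \<tau>"
    proof
      fix a show "\<sigma> a = \<tau> a"
      proof (cases "a \<in> L")
        case True
        then obtain k where k: "k \<in> {1..n}" "a \<in> set (C k)" using arrangementsD(4)[OF C] by blast
        have "map \<sigma> (C k) = map \<tau> (C k)" using fun_cong[OF *(3), of k] k(1) by simp
        then show ?thesis using k(2) by simp
      next
        case False
        then show ?thesis using * by (auto simp: permutes_def)
      qed
    qed
  qed
next
  fix B assume "B \<in> (\<lambda>\<sigma>. \<lambda>s\<in>{1..n}. map \<sigma> (C s)) ` {\<sigma>. \<sigma> permutes L}"
  then show "B \<in> {B \<in> arrangements n L. \<forall>s\<in>{1..n}. length (B s) = length (C s)}"
    using arrangements_permute[OF C] by auto
next
  fix B assume "B \<in> {B \<in> arrangements n L. \<forall>s\<in>{1..n}. length (B s) = length (C s)}"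
  then have B: "B \<in> arrangements n L" and len: "\<And>s. s \<in> {1..n} \<Longrightarrow> length (B s) = length (C s)" by auto
  have pos: "\<exists>k i. k \<in> {1..n} \<and> i < length (C k) \<and> C k ! i = a" if "a \<in> L" for a
    using arrangementsD(4)[OF C that] by (auto simp: in_set_conv_nth)
  have same: "k = k' \<and> i = i'" if "D \<in> arrangements n L" "k \<in> {1..n}" "k' \<in> {1..n}" "i < length (D k)"
    "i' < length (D k')" "D k ! i = D k' ! i'" for D k k' i i'
    using that arrangementsD(3)[OF that(1), of "D k ! i" k k'] arrangementsD(1)[OF that(1,2)]
    by (metis nth_eq_iff_index_eq nth_mem)
  \<comment> \<open>The label at a position of \<open>C\<close> goes to the label of
    \<open>B\<close> at the same position. A label occupies only one position of \<open>C\<close>,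
    so the description is unambiguous.\<close>
  define \<sigma> where "\<sigma> a = (if a \<in> L then THE b. \<exists>k i. k \<in> {1..n} \<and> i < length (C k) \<and> C k ! i = a \<and> b = B k ! i else a)" for a
  have inL: "D k ! i \<in> L" if "D \<in> arrangements n L" "k \<in> {1..n}" "i < length (D k)" for D k i
    using arrangementsD(2)[OF that(1,2)] that(3) by auto
  have \<sigma>: "\<sigma> (C k ! i) = B k ! i" if ki: "k \<in> {1..n}" "i < length (C k)" for k i
  proof -
    have "(THE b. \<exists>k' i'. k' \<in> {1..n} \<and> i' < length (C k') \<and> C k' ! i' = C k ! i \<and> b = B k' ! i') = B k ! i"
    proof (rule the_equality)
      fix b assume "\<exists>k' i'. k' \<in> {1..n} \<and> i' < length (C k') \<and> C k' ! i' = C k ! i \<and> b = B k' ! i'"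
      then obtain k' i' where *: "k' \<in> {1..n}" "i' < length (C k')" "C k' ! i' = C k ! i" "b = B k' ! i'" by blast
      show "b = B k ! i" using same[OF C *(1) ki(1) *(2) ki(2) *(3)] *(4) by simp
    qed (use ki in blast)
    then show ?thesis using inL[OF C ki] by (simp add: \<sigma>_def)
  qed
  have "inj_on \<sigma> L"
  proof (rule inj_onI)
    fix a b assume ab: "a \<in> L" "b \<in> L" "\<sigma> a = \<sigma> b"
    obtain k i where a: "k \<in> {1..n}" "i < length (C k)" "C k ! i = a" using pos[OF ab(1)] by blast
    obtain k' i' where b: "k' \<in> {1..n}" "i' < length (C k')" "C k' ! i' = b" using pos[OF ab(2)] by blast
    have "B k ! i = B k' ! i'" using ab(3) \<sigma>[OF a(1,2)] \<sigma>[OF b(1,2)] a(3) b(3) by simp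
    then have "k = k' \<and> i = i'" using same[OF B a(1) b(1)] a b len by simp
    then show "a = b" using a b by simp
  qed
  moreover have "\<sigma> ` L \<subseteq> L"
  proof
    fix b assume "b \<in> \<sigma> ` L"
    then obtain a where a: "a \<in> L" "b = \<sigma> a" by blast
    obtain k i where ki: "k \<in> {1..n}" "i < length (C k)" "C k ! i = a" using pos[OF a(1)] by blast
    then show "b \<in> L" using \<sigma>[OF ki(1,2)] a inL[OF B ki(1)] len by simp
  qed
  ultimately have "bij_betw \<sigma> L L"
    using fin by (simp add: bij_betw_def endo_inj_surj)
  then have "\<sigma> permutes L" by (rule bij_imp_permutes) (simp add: \<sigma>_def)
  moreover have "B = (\<lambda>s\<in>{1..n}. map \<sigma> (C s))"
  proof
    fix s show "B s = (\<lambda>s\<in>{1..n}. map \<sigma> (C s)) s"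
    proof (cases "s \<in> {1..n}")
      case True
      then show ?thesis using len \<sigma> by (auto intro!: nth_equalityI)
    next
      case False
      then show ?thesis using arrangementsD(5)[OF B] by (simp add: extensional_def del: atLeastAtMost_iff)
    qed
  qed
  ultimately show "B \<in> (\<lambda>\<sigma>. \<lambda>s\<in>{1..n}. map \<sigma> (C s)) ` {\<sigma>. \<sigma> permutes L}" by blast
qed

lemma bij_betw_coloured_permutations:
  assumes fin: "finite L" and C: "C \<in> arrangements n L"
  shows "bij_betw (\<lambda>\<sigma>. \<lambda>s\<in>{1..n}. map \<sigma> (C s))
    {\<sigma>. \<sigma> permutes L \<and> (\<forall>s\<in>{1..n}. map c (map \<sigma> (C s)) = J s)}
    {B \<in> arrangements n L. \<forall>s\<in>{1..n}. length (B s) = length (C s) \<and> map c (B s) = J s}"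
proof -
  note bij = bij_betw_permute_arrangement[OF fin C]
  show ?thesis
    unfolding bij_betw_def
  proof (intro conjI equalityI subsetI)
    show "inj_on (\<lambda>\<sigma>. \<lambda>s\<in>{1..n}. map \<sigma> (C s)) {\<sigma>. \<sigma> permutes L \<and> (\<forall>s\<in>{1..n}. map c (map \<sigma> (C s)) = J s)}"
      by (rule inj_on_subset[OF bij_betw_imp_inj_on[OF bij]]) auto
  next
    fix B assume "B \<in> (\<lambda>\<sigma>. \<lambda>s\<in>{1..n}. map \<sigma> (C s)) ` {\<sigma>. \<sigma> permutes L \<and> (\<forall>s\<in>{1..n}. map c (map \<sigma> (C s)) = J s)}"
    then show "B \<in> {B \<in> arrangements n L. \<forall>s\<in>{1..n}. length (B s) = length (C s) \<and> map c (B s) = J s}"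
      using arrangements_permute[OF C] by auto
  next
    fix B assume B: "B \<in> {B \<in> arrangements n L. \<forall>s\<in>{1..n}. length (B s) = length (C s) \<and> map c (B s) = J s}"
    then have "B \<in> (\<lambda>\<sigma>. \<lambda>s\<in>{1..n}. map \<sigma> (C s)) ` {\<sigma>. \<sigma> permutes L}"
      using bij_betw_imp_surj_on[OF bij] by auto
    then show "B \<in> (\<lambda>\<sigma>. \<lambda>s\<in>{1..n}. map \<sigma> (C s)) ` {\<sigma>. \<sigma> permutes L \<and> (\<forall>s\<in>{1..n}. map c (map \<sigma> (C s)) = J s)}"
      using B by auto
  qed
qed

text \<open>Existence and uniqueness for the definite description in \<open>color\<close>. The
  explicit colour of \<open>a\<close> is the least \<open>i\<close> with
  \<open>a \<le> l_1 + ... + l_i\<close>. For a non-decreasing \<open>d\<close> the labels with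
  \<open>d \<le> i\<close> form an initial segment, whose size \<open>l_1 + ... + l_i\<close> is
  prescribed; this determines \<open>d\<close>.\<close>

lemma color_spec:
  "color r l \<in> {1..var_count r l} \<rightarrow>\<^sub>E {1..r} \<and> mono_on {1..var_count r l} (color r l) \<and>
    (\<forall>i\<in>{1..r}. card {a \<in> {1..var_count r l}. color r l a = i} = l i)"
proof -
  define m where "m = var_count r l"
  define S where "S i = (\<Sum>j=1..i. l j)" for i
  have S_Suc: "S (Suc i) = S i + l (Suc i)" for i by (simp add: S_def)
  have S_mono: "S i \<le> S j" if "i \<le> j" for i j using that unfolding S_def by (intro sum_mono2) auto
  have Sr: "S r = m" by (simp add: S_def m_def var_count_def)
  define P where "P c \<longleftrightarrow> c \<in> {1..m} \<rightarrow>\<^sub>E {1..r} \<and> mono_on {1..m} c \<and>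
     (\<forall>i\<in>{1..r}. card {a \<in> {1..m}. c a = i} = l i)" for c
  define c where "c = (\<lambda>a\<in>{1..m}. LEAST i. a \<le> S i)"
  have c_le: "c a \<le> i \<longleftrightarrow> a \<le> S i" if "a \<in> {1..m}" for a i
  proof
    have "a \<le> S (LEAST i. a \<le> S i)" by (rule LeastI[where P = "\<lambda>i. a \<le> S i" and k = r]) (use that in \<open>simp add: Sr\<close>)
    then have "a \<le> S (c a)" using that by (simp add: c_def)
    moreover assume "c a \<le> i"
    ultimately show "a \<le> S i" using S_mono[of "c a" i] by simp
  next
    assume "a \<le> S i"
    then show "c a \<le> i" using that by (simp add: c_def Least_le)
  qed
  have "P c"
    unfolding P_def
  proof (intro conjI ballI)
    have "c a \<in> {1..r}" if "a \<in> {1..m}" for a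
    proof -
      have "\<not> c a \<le> 0" using c_le[OF that, of 0] that by (simp add: S_def)
      moreover have "c a \<le> r" using c_le[OF that, of r] that by (simp add: Sr)
      ultimately show ?thesis by simp
    qed
    moreover have "c \<in> extensional {1..m}" unfolding c_def by (rule restrict_extensional)
    ultimately show "c \<in> {1..m} \<rightarrow>\<^sub>E {1..r}" by (simp add: PiE_iff)
    show "mono_on {1..m} c"
    proof (rule mono_onI)
      fix a b assume "a \<in> {1..m}" "b \<in> {1..m}" "a \<le> b"
      then show "c a \<le> c b" using c_le[of a "c b"] c_le[of b "c b"] by simp
    qed
    fix i assume i: "i \<in> {1..r}"
    then obtain i' where i': "i = Suc i'" by (cases i) auto
    have "{a \<in> {1..m}. c a = i} = {S i'<..S i}"
    proof (intro equalityI subsetI)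
      fix a assume "a \<in> {a \<in> {1..m}. c a = i}"
      then show "a \<in> {S i'<..S i}" using c_le[of a i] c_le[of a i'] i' by auto
    next
      fix a assume a: "a \<in> {S i'<..S i}"
      then have "a \<in> {1..m}" using S_mono[of i r] i Sr by auto
      then show "a \<in> {a \<in> {1..m}. c a = i}" using a c_le[of a i] c_le[of a i'] i' by auto
    qed
    then show "card {a \<in> {1..m}. c a = i} = l i" by (simp add: i' S_Suc)
  qed
  moreover have "d = c" if "P d" for d
  proof -
    have d: "d \<in> {1..m} \<rightarrow>\<^sub>E {1..r}" "mono_on {1..m} d" "\<And>i. i \<in> {1..r} \<Longrightarrow> card {a \<in> {1..m}. d a = i} = l i"
      using that by (auto simp: P_def)
    have d_range: "d a \<in> {1..r}" if "a \<in> {1..m}" for a using d(1) that by blast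
    have d_le: "d a \<le> i \<longleftrightarrow> a \<le> S i" if a: "a \<in> {1..m}" and i: "i \<le> r" for a i
    proof -
      define D where "D i = {b \<in> {1..m}. d b \<le> i}" for i
      have card_D: "card (D i) = S i" using i
      proof (induction i)
        case 0
        have "\<not> d b \<le> 0" if "b \<in> {1..m}" for b using d_range[OF that] by simp
        then have "D 0 = {}" by (auto simp only: D_def)
        then show ?case by (simp add: S_def)
      next
        case (Suc i)
        have "D (Suc i) = D i \<union> {b \<in> {1..m}. d b = Suc i}" by (auto simp: D_def)
        also have "card \<dots> = card (D i) + card {b \<in> {1..m}. d b = Suc i}"
          by (rule card_Un_disjoint) (auto simp: D_def)
        finally show ?case using Suc d(3)[of "Suc i"] by (simp add: S_Suc)
      qed
      show ?thesis
      proof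
        assume "d a \<le> i"
        then have "b \<in> D i" if "b \<in> {1..a}" for b
          using that a mono_onD[OF d(2), of b a] by (simp add: D_def)
        then have "{1..a} \<subseteq> D i" by blast
        then have "card {1..a} \<le> card (D i)" by (intro card_mono) (auto simp: D_def)
        then show "a \<le> S i" by (simp add: card_D)
      next
        assume "a \<le> S i"
        show "d a \<le> i"
        proof (rule ccontr)
          assume "\<not> d a \<le> i"
          then have "b \<in> {1..<a}" if "b \<in> D i" for b
            using that a mono_onD[OF d(2), of a b] by (cases "a \<le> b") (simp_all add: D_def)
          then have "D i \<subseteq> {1..<a}" by blast
          then have "card (D i) \<le> card {1..<a}" by (intro card_mono) auto
          then have "S i \<le> a - 1" by (simp add: card_D)
          moreover have "1 \<le> a" using a by simp
          ultimately show False using \<open>a \<le> S i\<close> by linarith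
        qed
      qed
    qed
    show ?thesis
    proof
      fix a show "d a = c a"
      proof (cases "a \<in> {1..m}")
        case True
        have "c a \<in> {1..r}" using \<open>P c\<close> True by (auto simp: P_def)
        then have "d a \<le> c a" using d_le[OF True, of "c a"] c_le[OF True, of "c a"] by simp
        moreover have "c a \<le> d a" using d_le[OF True, of "d a"] c_le[OF True, of "d a"] d_range[OF True] by simp
        ultimately show ?thesis by simp
      next
        case False
        then show ?thesis using d(1) by (simp add: c_def PiE_iff extensional_def del: atLeastAtMost_iff)
      qed
    qed
  qed
  ultimately have "P (THE c. P c)" by (rule theI)
  then have "P (color r l)" unfolding P_def m_def color_def .
  then show ?thesis unfolding P_def m_def .
qed

lemma count_list_map_distinct: "distinct xs \<Longrightarrow> count_list (map f xs) i = card {a \<in> set xs. f a = i}"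
proof (induction xs)
  case (Cons x xs)
  have "{a \<in> set (x # xs). f a = i} = (if f x = i then insert x {a \<in> set xs. f a = i} else {a \<in> set xs. f a = i})"
    by auto
  with Cons show ?case by simp
qed simp

lemma colors_index_seqs:
  assumes B: "B \<in> arrangements n {1..var_count r l}"
  shows "(\<lambda>s\<in>{1..n}. map (color r l) (B s)) \<in> index_seqs r n l"
proof -
  let ?L = "{1..var_count r l}"
  have col: "color r l \<in> ?L \<rightarrow> {1..r}" using color_spec[of r l] by (auto simp: PiE_def)
  have "map (color r l) (B s) \<in> lists {1..r}" if "s \<in> {1..n}" for s
    using arrangementsD(2)[OF B that] col by (fastforce simp: lists_eq_set)
  moreover have "(\<Sum>s=1..n. count_list (map (color r l) (B s)) i) = l i" if i: "i \<in> {1..r}" for i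
  proof -
    have "(\<Sum>s=1..n. count_list (map (color r l) (B s)) i) = (\<Sum>s=1..n. card {a \<in> set (B s). color r l a = i})"
      using arrangementsD(1)[OF B] by (intro sum.cong refl count_list_map_distinct) auto
    also have "\<dots> = card (\<Union>s\<in>{1..n}. {a \<in> set (B s). color r l a = i})"
    proof (rule card_UN_disjoint[symmetric], goal_cases)
      case 3
      then show ?case using arrangementsD(3)[OF B] by blast
    qed auto
    also have "(\<Union>s\<in>{1..n}. {a \<in> set (B s). color r l a = i}) = {a \<in> ?L. color r l a = i}"
    proof (intro equalityI subsetI)
      fix a assume "a \<in> (\<Union>s\<in>{1..n}. {a \<in> set (B s). color r l a = i})"
      then show "a \<in> {a \<in> ?L. color r l a = i}" using arrangementsD(2)[OF B] by blast
    next
      fix a assume "a \<in> {a \<in> ?L. color r l a = i}"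
      then show "a \<in> (\<Union>s\<in>{1..n}. {a \<in> set (B s). color r l a = i})"
        using arrangementsD(4)[OF B, of a] by blast
    qed
    also have "card \<dots> = l i" using color_spec[of r l] i by blast
    finally show ?thesis .
  qed
  moreover have "(\<Sum>s=1..n. count_list ((\<lambda>s\<in>{1..n}. map (color r l) (B s)) s) i) =
      (\<Sum>s=1..n. count_list (map (color r l) (B s)) i)" for i
    by (rule sum.cong) auto
  ultimately show ?thesis unfolding index_seqs_def by (simp only: mem_Collect_eq PiE_iff restrict_extensional) simp
qed

lemma length_index_seq:
  assumes I: "I \<in> index_seqs r n l" and s: "s \<in> {1..n}"
  shows "length (I s) = (\<Sum>i=1..r. count_list (I s) i)"
proof -
  have "set (I s) \<subseteq> {1..r}" using I s by (auto simp: index_seqs_def PiE_iff lists_eq_set)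
  then have "(\<Sum>i\<in>{1..r}. count_list (I s) i) = (\<Sum>i\<in>set (I s). count_list (I s) i)"
    by (intro sum.mono_neutral_right) (auto simp: count_list_0_iff)
  then show ?thesis by (simp add: sum_count_set)
qed

text \<open>The identity permutation reads the labels in their order, so block \<open>s\<close> is
  the interval of labels that follows the earlier blocks. It is an arrangement of all labels because
  the lengths of the words in \<open>I\<close> add up to the number of variables.\<close>

lemma standard_arrangement:
  assumes I: "I \<in> index_seqs r n l"
  shows "(\<lambda>s\<in>{1..n}. block I (\<lambda>i. i) s) \<in> arrangements n {1..var_count r l}"
proof -
  define off where "off s = (\<Sum>k=1..<s. length (I k))" for s
  have off_Suc: "off (Suc s) = off s + length (I s)" if "1 \<le> s" for s using that by (simp add: off_def)
  have off_mono: "off s + length (I s) \<le> off s'" if "1 \<le> s" "s < s'" for s s'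
  proof -
    have "off (Suc s) \<le> off s'" unfolding off_def using that by (intro sum_mono2) auto
    then show ?thesis using off_Suc that by simp
  qed
  have set_block: "set (block I (\<lambda>i. i) s) = {off s<..off s + length (I s)}" for s
  proof -
    have "set (block I (\<lambda>i. i) s) = (\<lambda>i. off s + i) ` {1..length (I s)}"
    proof -
      have "{1..<length (I s) + 1} = {1..length (I s)}" by auto
      then show ?thesis unfolding block_def off_def set_map set_upt by simp
    qed
    also have "\<dots> = {1 + off s..length (I s) + off s}" by (rule image_add_atLeastAtMost)
    also have "\<dots> = {off s<..off s + length (I s)}"
      by (simp add: add.commute atLeastSucAtMost_greaterThanAtMost)
    finally show ?thesis .
  qed
  have "length (I s) = (\<Sum>i=1..r. count_list (I s) i)" if "s \<in> {1..n}" for s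
    by (rule length_index_seq[OF I that])
  then have "off (Suc n) = (\<Sum>s=1..n. \<Sum>i=1..r. count_list (I s) i)"
    unfolding off_def by (intro sum.cong) auto
  also have "\<dots> = (\<Sum>i=1..r. \<Sum>s=1..n. count_list (I s) i)" by (rule sum.swap)
  also have "\<dots> = var_count r l" using I unfolding var_count_def index_seqs_def by (intro sum.cong) auto
  finally have total: "off (Suc n) = var_count r l" .
  show ?thesis
  proof (rule arrangementsI, goal_cases)
    case (2 s)
    show ?case using 2 by (simp add: block_def distinct_map inj_on_def)
  next
    case (3 s)
    then have "off s + length (I s) \<le> var_count r l" using off_mono[of s "Suc n"] total by simp
    then show ?case using 3 by (auto simp: set_block)
  next
    case (4 a j k)
    then have "a \<in> {off j<..off j + length (I j)}" "a \<in> {off k<..off k + length (I k)}"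
      by (auto simp: set_block)
    then have "\<not> j < k" "\<not> k < j"
      using off_mono[of j k] off_mono[of k j] 4(3,4) by force+
    then show ?case by simp
  next
    case (5 a)
    have "\<exists>s\<in>{1..N}. a \<in> {off s<..off s + length (I s)}" if "a \<in> {1..off (Suc N)}" for N
      using that
    proof (induction N)
      case 0
      then show ?case by (simp add: off_def)
    next
      case (Suc N)
      show ?case
      proof (cases "a \<le> off (Suc N)")
        case True
        then have "a \<in> {1..off (Suc N)}" using Suc.prems by simp
        from Suc.IH[OF this] obtain s where s: "s \<in> {1..N}" "a \<in> {off s<..off s + length (I s)}" by blast
        then have "s \<in> {1..Suc N}" by simp
        with s(2) show ?thesis by blast
      next
        case False
        moreover have "off (Suc (Suc N)) = off (Suc N) + length (I (Suc N))" by (rule off_Suc) simp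
        ultimately have "a \<in> {off (Suc N)<..off (Suc N) + length (I (Suc N))}" using Suc.prems by simp
        moreover have "Suc N \<in> {1..Suc N}" by simp
        ultimately show ?thesis by blast
      qed
    qed
    from this[of n] obtain s where "s \<in> {1..n}" "a \<in> {off s<..off s + length (I s)}"
      using 5 total by auto
    then show ?case by (intro bexI[of _ s]) (simp_all add: set_block)
  qed auto
qed

lemma finite_index_seqs: "finite (index_seqs r n l)"
proof (rule finite_subset)
  show "index_seqs r n l \<subseteq> {1..n} \<rightarrow>\<^sub>E {xs. set xs \<subseteq> {1..r} \<and> length xs \<le> (\<Sum>i=1..r. l i)}"
  proof
    fix I assume I: "I \<in> index_seqs r n l"
    have "length (I s) \<le> (\<Sum>i=1..r. l i)" if s: "s \<in> {1..n}" for s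
    proof -
      have "length (I s) = (\<Sum>i=1..r. count_list (I s) i)" by (rule length_index_seq[OF I s])
      also have "\<dots> \<le> (\<Sum>i=1..r. l i)"
      proof (rule sum_mono)
        fix i assume "i \<in> {1..r}"
        then have "l i = (\<Sum>s=1..n. count_list (I s) i)" using I by (simp add: index_seqs_def)
        moreover have "count_list (I s) i \<le> (\<Sum>s=1..n. count_list (I s) i)"
          by (rule member_le_sum[OF s]) auto
        ultimately show "count_list (I s) i \<le> l i" by simp
      qed
      finally show ?thesis .
    qed
    then show "I \<in> {1..n} \<rightarrow>\<^sub>E {xs. set xs \<subseteq> {1..r} \<and> length xs \<le> (\<Sum>i=1..r. l i)}"
      using I by (auto simp: index_seqs_def PiE_iff lists_eq_set)
  qed
qed (intro finite_PiE finite_atLeastAtMost finite_lists_length_le)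

lemma block_map: "block I \<sigma> s = map \<sigma> (block I (\<lambda>i. i) s)"
  by (simp add: block_def)

lemma pure_tensor_cong:
  assumes "\<And>s. s \<in> {1..n} \<Longrightarrow> u s = u' s"
  shows "pure_tensor n sc V u = pure_tensor n sc V u'"
proof -
  have "restrict u {1..n} = restrict u' {1..n}" using assms by (intro restrict_ext)
  then show ?thesis by (simp only: pure_tensor_def)
qed

text \<open>Relabelling the standard arrangement of \<open>I\<close> by the permutations in
  \<open>color_perms\<close> gives every arrangement with colours \<open>I\<close> exactly once.
  Grouping all arrangements by their colours therefore reproduces the double sum over
  \<open>I\<close> and \<open>\<sigma>\<close>.\<close>

lemma weight_function_arrangements:
  "weight_function r n sc V \<rho> v l t z =
    (\<Sum>B\<in>arrangements n {1..var_count r l}. tensor_scale (\<Prod>s=1..n. chain_fun t (z s) (B s))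
       (pure_tensor n sc V (\<lambda>s. F_monomial r (\<rho> s) (map (color r l) (B s)) (v s))))"
proof -
  define L c where "L = {1..var_count r l}" and "c = color r l"
  define f where "f B J = tensor_scale (\<Prod>s=1..n. chain_fun t (z s) (B s))
       (pure_tensor n sc V (\<lambda>s. F_monomial r (\<rho> s) (J s) (v s)))" for B J :: "nat \<Rightarrow> nat list"
  have f_cong: "f B J = f B' J'" if "\<And>s. s \<in> {1..n} \<Longrightarrow> B s = B' s" "\<And>s. s \<in> {1..n} \<Longrightarrow> J s = J' s" for B B' J J'
  proof -
    have "pure_tensor n sc V (\<lambda>s. F_monomial r (\<rho> s) (J s) (v s)) = pure_tensor n sc V (\<lambda>s. F_monomial r (\<rho> s) (J' s) (v s))"
      by (rule pure_tensor_cong) (simp add: that)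
    moreover have "(\<Prod>s=1..n. chain_fun t (z s) (B s)) = (\<Prod>s=1..n. chain_fun t (z s) (B' s))"
      by (intro prod.cong refl) (simp add: that)
    ultimately show ?thesis by (simp add: f_def)
  qed
  have fin: "finite (arrangements n L)" by (simp add: L_def finite_arrangements)
  have "(\<Sum>\<sigma>\<in>color_perms r n l I. f (block I \<sigma>) I) =
      (\<Sum>B\<in>{B \<in> arrangements n L. (\<lambda>s\<in>{1..n}. map c (B s)) = I}. f B (\<lambda>s. map c (B s)))"
    if I: "I \<in> index_seqs r n l" for I
  proof -
    define C where "C = (\<lambda>s\<in>{1..n}. block I (\<lambda>i. i) s)"
    have C: "C \<in> arrangements n L" unfolding C_def L_def by (rule standard_arrangement[OF I])
    have lenC: "length (C s) = length (I s)" if "s \<in> {1..n}" for s using that by (simp add: C_def block_def) (cases "I s"; simp)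
    have mapC: "map \<sigma> (C s) = block I \<sigma> s" if "s \<in> {1..n}" for s \<sigma>
      unfolding block_map[of I \<sigma>] using that by (simp add: C_def)
    have ext: "I \<in> extensional {1..n}" using I by (auto simp: index_seqs_def PiE_def)
    have dom: "{\<sigma>. \<sigma> permutes L \<and> (\<forall>s\<in>{1..n}. map c (map \<sigma> (C s)) = I s)} = color_perms r n l I"
      unfolding color_perms_def c_def[symmetric] L_def[symmetric] by (simp only: mapC cong: ball_cong)
    have ran: "{B \<in> arrangements n L. \<forall>s\<in>{1..n}. length (B s) = length (C s) \<and> map c (B s) = I s} =
        {B \<in> arrangements n L. (\<lambda>s\<in>{1..n}. map c (B s)) = I}"
    proof (intro Collect_cong conj_cong refl iffI)
      fix B assume *: "\<forall>s\<in>{1..n}. length (B s) = length (C s) \<and> map c (B s) = I s"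
      show "(\<lambda>s\<in>{1..n}. map c (B s)) = I"
        by (rule extensionalityI[OF _ ext]) (use * in auto)
    next
      fix B assume "(\<lambda>s\<in>{1..n}. map c (B s)) = I"
      then have "map c (B s) = I s" if "s \<in> {1..n}" for s using that by auto
      then show "\<forall>s\<in>{1..n}. length (B s) = length (C s) \<and> map c (B s) = I s"
        using lenC by (metis length_map)
    qed
    note bij = bij_betw_coloured_permutations[OF _ C, of c I, unfolded dom ran]
    have "(\<Sum>B\<in>{B \<in> arrangements n L. (\<lambda>s\<in>{1..n}. map c (B s)) = I}. f B (\<lambda>s. map c (B s))) =
        (\<Sum>\<sigma>\<in>color_perms r n l I. f (\<lambda>s\<in>{1..n}. map \<sigma> (C s)) (\<lambda>s'. map c ((\<lambda>s\<in>{1..n}. map \<sigma> (C s)) s')))"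
      by (rule sum.reindex_bij_betw[OF bij, symmetric]) (simp add: L_def)
    also have "\<dots> = (\<Sum>\<sigma>\<in>color_perms r n l I. f (block I \<sigma>) I)"
    proof (rule sum.cong[OF refl], rule f_cong)
      fix \<sigma> s assume \<sigma>: "\<sigma> \<in> color_perms r n l I" and s: "s \<in> {1..n}"
      show "(\<lambda>s\<in>{1..n}. map \<sigma> (C s)) s = block I \<sigma> s" using s mapC by simp
      show "map c ((\<lambda>s\<in>{1..n}. map \<sigma> (C s)) s) = I s"
        using s \<sigma> mapC[OF s, of \<sigma>] by (auto simp: color_perms_def c_def)
    qed
    finally show ?thesis by simp
  qed
  then have "weight_function r n sc V \<rho> v l t z = (\<Sum>I\<in>index_seqs r n l.
      \<Sum>B\<in>{B \<in> arrangements n L. (\<lambda>s\<in>{1..n}. map c (B s)) = I}. f B (\<lambda>s. map c (B s)))"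
    unfolding weight_function_def f_def by (intro sum.cong refl) simp
  also have "\<dots> = (\<Sum>B\<in>arrangements n L. f B (\<lambda>s. map c (B s)))"
  proof (rule sum.group[OF fin finite_index_seqs], rule image_subsetI)
    fix B assume "B \<in> arrangements n L"
    then show "(\<lambda>s\<in>{1..n}. map c (B s)) \<in> index_seqs r n l"
      unfolding L_def c_def by (rule colors_index_seqs)
  qed
  finally show ?thesis by (simp add: f_def L_def c_def)
qed

section \<open>Highest weight vectors\<close>

lemma unit_mat_carrier [simp]: "unit_mat r a b \<in> carrier_mat (r + 1) (r + 1)"
  by (simp add: unit_mat_def)

lemma unit_mat_mult:
  assumes "b \<in> {1..r + 1}"
  shows "unit_mat r a b * unit_mat r c d = (if b = c then unit_mat r a d else 0\<^sub>m (r + 1) (r + 1))"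
proof (rule eq_matI)
  fix i j assume "i < dim_row (if b = c then unit_mat r a d else 0\<^sub>m (r + 1) (r + 1))"
    "j < dim_col (if b = c then unit_mat r a d else 0\<^sub>m (r + 1) (r + 1))"
  then have ij: "i < r + 1" "j < r + 1" by (auto simp: unit_mat_def split: if_splits)
  have "(unit_mat r a b * unit_mat r c d) $$ (i, j) =
      (\<Sum>k = 0..<r + 1. (if i + 1 = a \<and> k + 1 = b then 1 else 0) * (if k + 1 = c \<and> j + 1 = d then 1 else 0))"
    using ij by (simp add: unit_mat_def scalar_prod_def del: sum.op_ivl_Suc)
  also have "\<dots> = (\<Sum>k = 0..<r + 1. (if k = b - 1 then (if i + 1 = a \<and> b = c \<and> j + 1 = d then 1 else 0) else 0))"
    using assms by (intro sum.cong refl) auto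
  also have "\<dots> = (if i + 1 = a \<and> b = c \<and> j + 1 = d then 1 else 0)"
    using assms by (subst sum.delta) auto
  finally show "(unit_mat r a b * unit_mat r c d) $$ (i, j) =
      (if b = c then unit_mat r a d else 0\<^sub>m (r + 1) (r + 1)) $$ (i, j)"
    using ij by (auto simp: unit_mat_def)
qed (auto simp: unit_mat_def)

lemma unit_mat_sl: "a \<noteq> b \<Longrightarrow> unit_mat r a b \<in> sl r"
  unfolding sl_def by (auto simp: unit_mat_def intro!: sum.neutral simp del: sum.lessThan_Suc)

lemma chev_sl:
  assumes "i \<in> {1..r}"
  shows "chev_E r i \<in> sl r" "chev_F r i \<in> sl r"
  using assms by (auto simp: chev_E_def chev_F_def intro!: unit_mat_sl)

lemma chev_H_cartan:
  assumes "i \<in> {1..r}"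
  shows "chev_H r i \<in> cartan r"
proof -
  have "(\<Sum>a<r + 1. chev_H r i $$ (a, a)) = (\<Sum>a<r + 1. (if a = i - 1 then 1 else 0) - (if a = i then 1 else 0))"
    using assms by (intro sum.cong refl) (auto simp: chev_H_def unit_mat_def)
  also have "\<dots> = 0" using assms by (auto simp: sum_subtractf)
  finally have "(\<Sum>a<r + 1. chev_H r i $$ (a, a)) = 0" .
  then show ?thesis
    by (auto simp: cartan_def sl_def diagonal_mat_def chev_H_def unit_mat_def)
qed

lemma cartan_sl: "h \<in> cartan r \<Longrightarrow> h \<in> sl r"
  by (simp add: cartan_def)

lemma chev_EF_commutator:
  assumes "i \<in> {1..r}" "j \<in> {1..r}"
  shows "chev_E r i * chev_F r j - chev_F r j * chev_E r i =
    (if i = j then chev_H r i else 0\<^sub>m (r + 1) (r + 1))"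
  unfolding chev_E_def chev_F_def chev_H_def
  using assms by (auto simp: unit_mat_mult)

lemma cartan_F_commutator:
  assumes h: "h \<in> cartan r" and i: "i \<in> {1..r}"
  shows "h * chev_F r i - chev_F r i * h = (- simple_root i h) \<cdot>\<^sub>m chev_F r i"
proof (rule eq_matI)
  have hc: "h \<in> carrier_mat (r + 1) (r + 1)" and diag: "diagonal_mat h"
    using h by (auto simp: cartan_def sl_def)
  fix a b assume "a < dim_row ((- simple_root i h) \<cdot>\<^sub>m chev_F r i)" "b < dim_col ((- simple_root i h) \<cdot>\<^sub>m chev_F r i)"
  then have ab: "a < r + 1" "b < r + 1" by (auto simp: chev_F_def unit_mat_def)
  have off: "h $$ (k, k') = 0" if "k \<noteq> k'" "k < r + 1" "k' < r + 1" for k k'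
    using diag hc that by (auto simp: diagonal_mat_def)
  have "(h * chev_F r i) $$ (a, b) = (\<Sum>k=0..<r + 1. h $$ (a, k) * (if k = i \<and> b + 1 = i then 1 else 0))"
    using ab hc i by (simp add: chev_F_def unit_mat_def scalar_prod_def)
  also have "\<dots> = (\<Sum>k=0..<r + 1. if k = i then (if b + 1 = i then h $$ (a, i) else 0) else 0)"
    by (intro sum.cong) auto
  also have "\<dots> = (if b + 1 = i then h $$ (a, i) else 0)"
    using i by (subst sum.delta) auto
  finally have 1: "(h * chev_F r i) $$ (a, b) = (if b + 1 = i then h $$ (a, i) else 0)" .
  have "(chev_F r i * h) $$ (a, b) = (\<Sum>k=0..<r + 1. (if a = i \<and> k + 1 = i then 1 else 0) * h $$ (k, b))"
    using ab hc i by (simp add: chev_F_def unit_mat_def scalar_prod_def)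
  also have "\<dots> = (\<Sum>k=0..<r + 1. if k = i - 1 then (if a = i then h $$ (i - 1, b) else 0) else 0)"
    using i by (intro sum.cong) auto
  also have "\<dots> = (if a = i then h $$ (i - 1, b) else 0)"
    using i by (subst sum.delta) auto
  finally have 2: "(chev_F r i * h) $$ (a, b) = (if a = i then h $$ (i - 1, b) else 0)" .
  have "chev_F r i * h \<in> carrier_mat (r + 1) (r + 1)"
    unfolding chev_F_def by (rule mult_carrier_mat[OF unit_mat_carrier hc])
  then have "(h * chev_F r i - chev_F r i * h) $$ (a, b) = (h * chev_F r i) $$ (a, b) - (chev_F r i * h) $$ (a, b)"
    using ab by (intro index_minus_mat(1)) auto
  also have "\<dots> = (if a = i \<and> b + 1 = i then - simple_root i h else 0)"
    unfolding 1 2 using off[of a i] off[of "i - 1" b] ab i by (auto simp: simple_root_def)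
  also have "\<dots> = ((- simple_root i h) \<cdot>\<^sub>m chev_F r i) $$ (a, b)"
    using ab by (auto simp: chev_F_def unit_mat_def)
  finally show "(h * chev_F r i - chev_F r i * h) $$ (a, b) = ((- simple_root i h) \<cdot>\<^sub>m chev_F r i) $$ (a, b)" .
qed (use h in \<open>auto simp: cartan_def sl_def chev_F_def unit_mat_def\<close>)

section \<open>Monomials in the \<open>F_i\<close> applied to a singular vector\<close>

locale sl_rep = vector_space sc
  for sc :: "complex \<Rightarrow> 'v::ab_group_add \<Rightarrow> 'v" +
  fixes r :: nat and V :: "'v set" and \<rho> :: "complex mat \<Rightarrow> 'v \<Rightarrow> 'v"
  assumes sl_module: "sl_module r sc V \<rho>"
begin

lemma subspace_V: "subspace V"
  and act_closed: "x \<in> sl r \<Longrightarrow> u \<in> V \<Longrightarrow> \<rho> x u \<in> V"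
  and act_add: "x \<in> sl r \<Longrightarrow> u \<in> V \<Longrightarrow> w \<in> V \<Longrightarrow> \<rho> x (u + w) = \<rho> x u + \<rho> x w"
  and act_scale: "x \<in> sl r \<Longrightarrow> u \<in> V \<Longrightarrow> \<rho> x (sc a u) = sc a (\<rho> x u)"
  and add_act: "x \<in> sl r \<Longrightarrow> y \<in> sl r \<Longrightarrow> u \<in> V \<Longrightarrow> \<rho> (x + y) u = \<rho> x u + \<rho> y u"
  and scale_act: "x \<in> sl r \<Longrightarrow> u \<in> V \<Longrightarrow> \<rho> (a \<cdot>\<^sub>m x) u = sc a (\<rho> x u)"
  and commutator_act: "x \<in> sl r \<Longrightarrow> y \<in> sl r \<Longrightarrow> u \<in> V \<Longrightarrow> \<rho> (x * y - y * x) u = \<rho> x (\<rho> y u) - \<rho> y (\<rho> x u)"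
  using sl_module unfolding sl_module_def by blast+

lemma act_zero: "x \<in> sl r \<Longrightarrow> \<rho> x 0 = 0"
  using act_scale[of x 0 0] subspace_0[OF subspace_V] by simp

lemma act_sum: "x \<in> sl r \<Longrightarrow> (\<And>i. i \<in> A \<Longrightarrow> f i \<in> V) \<Longrightarrow> \<rho> x (sum f A) = (\<Sum>i\<in>A. \<rho> x (f i))"
proof (induction A rule: infinite_finite_induct)
  case (insert i A)
  then have "sum f A \<in> V" by (intro subspace_sum[OF subspace_V]) auto
  with insert show ?case by (simp add: act_add)
qed (simp_all add: act_zero)

lemma zero_act: "u \<in> V \<Longrightarrow> \<rho> (0\<^sub>m (r + 1) (r + 1)) u = 0"
proof -
  assume u: "u \<in> V"
  have z: "0\<^sub>m (r + 1) (r + 1) \<in> sl r" by (simp add: sl_def)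
  have "0 \<cdot>\<^sub>m 0\<^sub>m (r + 1) (r + 1) = (0\<^sub>m (r + 1) (r + 1) :: complex mat)" by auto
  then show ?thesis using scale_act[OF z u, of 0] by simp
qed

text \<open>Unlike \<open>highest_weight_vector\<close>, this admits zero. It serves for a highest
  weight vector \<open>u\<close> and also for \<open>F_i u\<close>.\<close>

definition singular :: "weight \<Rightarrow> 'v \<Rightarrow> bool" where
  "singular \<mu> u \<longleftrightarrow> u \<in> V \<and> (\<forall>h\<in>cartan r. \<rho> h u = sc (\<mu> h) u) \<and> (\<forall>i\<in>{1..r}. \<rho> (chev_E r i) u = 0)"

lemma F_monomial_Cons: "F_monomial r \<rho> (j # J) u = \<rho> (chev_F r j) (F_monomial r \<rho> J u)"
  and F_monomial_Nil: "F_monomial r \<rho> [] u = u"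
  by (simp_all add: F_monomial_def)

lemma F_monomial_closed: "u \<in> V \<Longrightarrow> set J \<subseteq> {1..r} \<Longrightarrow> F_monomial r \<rho> J u \<in> V"
  by (induction J) (auto simp: F_monomial_Nil F_monomial_Cons intro!: act_closed chev_sl)

lemma F_monomial_weight:
  assumes u: "singular \<mu> u" and h: "h \<in> cartan r" and J: "set J \<subseteq> {1..r}"
  shows "\<rho> h (F_monomial r \<rho> J u) = sc (\<mu> h - (\<Sum>j\<leftarrow>J. simple_root j h)) (F_monomial r \<rho> J u)"
  using J
proof (induction J)
  case Nil
  then show ?case using u h by (simp add: F_monomial_Nil singular_def)
next
  case (Cons j J)
  let ?w = "F_monomial r \<rho> J u" and ?F = "chev_F r j"
  have j: "j \<in> {1..r}" and w: "?w \<in> V" using Cons.prems u by (auto simp: singular_def intro!: F_monomial_closed)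
  note F = chev_sl(2)[OF j] and hs = cartan_sl[OF h]
  have "\<rho> h (\<rho> ?F ?w) - \<rho> ?F (\<rho> h ?w) = sc (- simple_root j h) (\<rho> ?F ?w)"
    using commutator_act[OF hs F w] unfolding cartan_F_commutator[OF h j] scale_act[OF F w] by simp
  moreover have "\<rho> ?F (\<rho> h ?w) = sc (\<mu> h - (\<Sum>j\<leftarrow>J. simple_root j h)) (\<rho> ?F ?w)"
    using Cons act_scale[OF F w] by simp
  ultimately have "\<rho> h (\<rho> ?F ?w) = sc (- simple_root j h) (\<rho> ?F ?w) + sc (\<mu> h - (\<Sum>j\<leftarrow>J. simple_root j h)) (\<rho> ?F ?w)"
    by (simp add: algebra_simps)
  also have "\<dots> = sc (\<mu> h - (\<Sum>j\<leftarrow>j # J. simple_root j h)) (\<rho> ?F ?w)"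
    unfolding scale_left_distrib[symmetric] by simp
  finally show ?case by (simp add: F_monomial_Cons)
qed

text \<open>\<open>E_i\<close> is moved to the right through the monomial. Each \<open>F_i\<close>
  that it meets is replaced by \<open>H_i\<close>, which acts on the part to the right by
  \<open>\<mu>\<close> minus the roots of the labels there. The distinct labels \<open>B\<close>
  with colours \<open>c\<close> tell equal \<open>F\<close>s apart, so that the sum is indexed by
  the removed label.\<close>

lemma E_F_monomial:
  fixes c :: "'a \<Rightarrow> nat"
  assumes u: "singular \<mu> u" and i: "i \<in> {1..r}" and B: "distinct B" "c ` set B \<subseteq> {1..r}"
  shows "\<rho> (chev_E r i) (F_monomial r \<rho> (map c B) u) =
    (\<Sum>a | a \<in> set B \<and> c a = i. sc (\<mu> (chev_H r i) - (\<Sum>b | precedes B a b. simple_root (c b) (chev_H r i)))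
       (F_monomial r \<rho> (map c (filter (\<lambda>b. b \<noteq> a) B)) u))"
  using B
proof (induction B)
  case Nil
  then show ?case using u i by (simp add: F_monomial_Nil singular_def)
next
  case (Cons b B)
  let ?w = "F_monomial r \<rho> (map c B) u" and ?F = "chev_F r (c b)" and ?E = "chev_E r i"
  define k where "k B a = \<mu> (chev_H r i) - (\<Sum>b | precedes B a b. simple_root (c b) (chev_H r i))" for B and a :: 'a
  define w where "w B a = F_monomial r \<rho> (map c (filter (\<lambda>b. b \<noteq> a) B)) u" for B and a :: 'a
  have cb: "c b \<in> {1..r}" and cB: "c ` set B \<subseteq> {1..r}" and bB: "b \<notin> set B" and dB: "distinct B" using Cons.prems by auto
  have uV: "u \<in> V" using u by (simp add: singular_def)
  have "set (map c B) \<subseteq> {1..r}" "set (map c (filter (\<lambda>b. b \<noteq> a) B)) \<subseteq> {1..r}" for a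
    using cB by (simp only: set_map, unfold set_map set_filter, blast)
  then have wV: "?w \<in> V" "\<And>a. w B a \<in> V" unfolding w_def by (blast intro: F_monomial_closed[OF uV])+
  note F = chev_sl(2)[OF cb] and E = chev_sl(1)[OF i]
  have H: "\<rho> (chev_H r i) ?w = sc (\<mu> (chev_H r i) - (\<Sum>b\<in>set B. simple_root (c b) (chev_H r i))) ?w"
    using F_monomial_weight[OF u chev_H_cartan[OF i], of "map c B"] cB dB
    by (simp add: o_def sum.distinct_set_conv_list)
  have 1: "\<rho> ?E (\<rho> ?F ?w) - \<rho> ?F (\<rho> ?E ?w) = (if c b = i then \<rho> (chev_H r i) ?w else 0)"
    using commutator_act[OF E F wV(1)] zero_act[OF wV(1)] unfolding chev_EF_commutator[OF i cb]
    by (cases "c b = i") simp_all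
  have "\<rho> ?F (\<rho> ?E ?w) = \<rho> ?F (\<Sum>a | a \<in> set B \<and> c a = i. sc (k B a) (w B a))"
    using Cons.IH dB cB by (simp add: k_def w_def)
  also have "\<dots> = (\<Sum>a | a \<in> set B \<and> c a = i. \<rho> ?F (sc (k B a) (w B a)))"
    using wV(2) by (intro act_sum[OF F]) (auto intro: subspace_scale[OF subspace_V])
  also have "\<dots> = (\<Sum>a | a \<in> set B \<and> c a = i. sc (k (b # B) a) (w (b # B) a))"
  proof (rule sum.cong[OF refl])
    fix a assume "a \<in> {a. a \<in> set B \<and> c a = i}"
    then have ne: "b \<noteq> a" using bB by auto
    then have "k (b # B) a = k B a" by (simp add: k_def)
    moreover have "w (b # B) a = \<rho> ?F (w B a)" using ne by (simp add: w_def F_monomial_Cons)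
    ultimately show "\<rho> ?F (sc (k B a) (w B a)) = sc (k (b # B) a) (w (b # B) a)"
      using act_scale[OF F wV(2)] by simp
  qed
  finally have 2: "\<rho> ?F (\<rho> ?E ?w) = (\<Sum>a | a \<in> set B \<and> c a = i. sc (k (b # B) a) (w (b # B) a))" .
  have 3: "\<rho> (chev_H r i) ?w = sc (k (b # B) b) (w (b # B) b)"
  proof -
    have "filter (\<lambda>a. a \<noteq> b) B = B" using bB by (auto intro: filter_True)
    moreover have "{x. precedes (b # B) b x} = set B" using bB by (auto dest: precedes_set)
    ultimately show ?thesis unfolding H k_def w_def by (simp del: precedes.simps)
  qed
  have "{a. a \<in> set (b # B) \<and> c a = i} = (if c b = i then insert b {a. a \<in> set B \<and> c a = i} else {a. a \<in> set B \<and> c a = i})"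
    by auto
  then have "(\<Sum>a | a \<in> set (b # B) \<and> c a = i. sc (k (b # B) a) (w (b # B) a)) =
     (if c b = i then sc (k (b # B) b) (w (b # B) b) else 0) + (\<Sum>a | a \<in> set B \<and> c a = i. sc (k (b # B) a) (w (b # B) a))"
    using bB by simp
  also have "\<dots> = \<rho> ?E (\<rho> ?F ?w)" using 1 2 3 by (auto simp: algebra_simps)
  finally show ?case by (simp add: F_monomial_Cons k_def w_def)
qed

text \<open>The diagonal matrix on which every simple root takes the value \<open>1\<close>; its eigenvalues
  separate \<open>F\<^sub>J u\<close> by the length of \<open>J\<close>.\<close>

definition height_mat :: "complex mat" where
  "height_mat = mat (r + 1) (r + 1) (\<lambda>(a, b). if a = b then of_nat r / 2 - of_nat a else 0)"

lemma height_mat_cartan: "height_mat \<in> cartan r"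
proof -
  have "(\<Sum>a<r + 1. height_mat $$ (a, a)) = (\<Sum>a<r + 1. of_nat r / 2 - (of_nat a :: complex))"
    by (intro sum.cong) (auto simp: height_mat_def)
  also have "\<dots> = 0"
  proof -
    have "2 * (\<Sum>a<r + 1. (of_nat a :: complex)) = of_nat r * of_nat (r + 1)"
      by (induction r) (simp_all add: algebra_simps)
    then show ?thesis
      unfolding sum_subtractf by (simp add: field_simps del: sum.lessThan_Suc)
  qed
  finally show ?thesis by (auto simp: cartan_def sl_def height_mat_def diagonal_mat_def)
qed

lemma simple_root_height_mat: "j \<in> {1..r} \<Longrightarrow> simple_root j height_mat = 1"
  by (auto simp: simple_root_def height_mat_def)

definition lower_span :: "'v \<Rightarrow> 'v set" where
  "lower_span u = span {F_monomial r \<rho> J u | J. set J \<subseteq> {1..r} \<and> J \<noteq> []}"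

text \<open>A monomial with \<open>d\<close> letters applied to \<open>u\<close> is an eigenvector
  of \<open>height_mat\<close> with eigenvalue lower by \<open>d\<close> than that of
  \<open>u\<close>. The operator \<open>P k\<close> is the product of
  \<open>height_mat - (\<mu> height_mat - i)\<close> over \<open>i = 1, ..., k\<close>: it kills all
  monomials of lengths 1 to \<open>k\<close> but multiplies \<open>u\<close> by
  \<open>k!\<close>.\<close>

lemma singular_notin_lower_span:
  assumes u: "singular \<mu> u" "u \<noteq> 0"
  shows "u \<notin> lower_span u"
proof
  define D where "D k w = \<rho> height_mat w - sc (\<mu> height_mat - of_nat k) w" for k w
  define P where "P = rec_nat (\<lambda>w. w) (\<lambda>k f w. D (Suc k) (f w))"
  have P0: "P 0 w = w" and PS: "P (Suc k) w = D (Suc k) (P k w)" for k w by (simp_all add: P_def)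
  note h = cartan_sl[OF height_mat_cartan]
  have uV: "u \<in> V" using u by (simp add: singular_def)
  have D_closed: "D k w \<in> V" if "w \<in> V" for k w
    unfolding D_def using that by (intro subspace_diff[OF subspace_V] act_closed[OF h] subspace_scale[OF subspace_V])
  have D_add: "D k (w + w') = D k w + D k w'" if "w \<in> V" "w' \<in> V" for k w w'
    unfolding D_def using act_add[OF h that] by (simp add: scale_right_distrib)
  have D_scale: "D k (sc a w) = sc a (D k w)" if "w \<in> V" for k w a
    unfolding D_def using act_scale[OF h that] by (simp add: scale_right_diff_distrib mult.commute)
  have P_closed: "P k w \<in> V" if "w \<in> V" for k w
    using that by (induction k) (auto simp: P0 PS D_closed)
  have P_add: "P k (w + w') = P k w + P k w'" if "w \<in> V" "w' \<in> V" for k w w'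
    by (induction k) (simp_all add: P0 PS D_add P_closed that)
  have P_scale: "P k (sc a w) = sc a (P k w)" if "w \<in> V" for k w a
    by (induction k) (simp_all add: P0 PS D_scale P_closed that)
  have P_eigen: "P k w = sc (\<Prod>i=1..k. of_nat i - of_nat d) w"
    if w: "w \<in> V" "\<rho> height_mat w = sc (\<mu> height_mat - of_nat d) w" for k w d
  proof (induction k)
    case (Suc k)
    have "P (Suc k) w = D (Suc k) (sc (\<Prod>i=1..k. of_nat i - of_nat d) w)" by (simp add: PS Suc)
    also have "\<dots> = sc (\<Prod>i=1..k. of_nat i - of_nat d) (D (Suc k) w)" by (rule D_scale[OF w(1)])
    also have "D (Suc k) w = sc (of_nat (Suc k) - of_nat d) w"
      unfolding D_def w(2) scale_left_diff_distrib[symmetric] by simp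
    finally show ?case by (simp add: mult.commute)
  qed (simp add: P0)
  assume "u \<in> lower_span u"
  \<comment> \<open>The bound \<open>N\<close> depends on the vector; asking for all larger
    \<open>k\<close> makes the condition stable under sums. Membership in \<open>V\<close> is
    carried along because the action is known to be linear only there.\<close>
  then have "u \<in> V \<and> (\<exists>N. \<forall>k\<ge>N. P k u = 0)"
    unfolding lower_span_def
  proof (induction u rule: span_induct)
    case base
    show ?case
    proof (rule subspaceI)
      show "0 \<in> {x. x \<in> V \<and> (\<exists>N. \<forall>k\<ge>N. P k x = 0)}"
        using P_scale[of 0 _ 0] subspace_0[OF subspace_V] by simp
      fix x y assume "x \<in> {x. x \<in> V \<and> (\<exists>N. \<forall>k\<ge>N. P k x = 0)}" "y \<in> {x. x \<in> V \<and> (\<exists>N. \<forall>k\<ge>N. P k x = 0)}"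
      then obtain N N' where "x \<in> V" "y \<in> V" "\<And>k. k \<ge> N \<Longrightarrow> P k x = 0" "\<And>k. k \<ge> N' \<Longrightarrow> P k y = 0" by blast
      then show "x + y \<in> {x. x \<in> V \<and> (\<exists>N. \<forall>k\<ge>N. P k x = 0)}"
        using subspace_add[OF subspace_V] by (auto simp: P_add intro!: exI[of _ "max N N'"])
    next
      fix a x assume "x \<in> {x. x \<in> V \<and> (\<exists>N. \<forall>k\<ge>N. P k x = 0)}"
      then show "sc a x \<in> {x. x \<in> V \<and> (\<exists>N. \<forall>k\<ge>N. P k x = 0)}"
        using subspace_scale[OF subspace_V] by (auto simp: P_scale)
    qed
  next
    case (step x)
    then obtain J where J: "x = F_monomial r \<rho> J u" "set J \<subseteq> {1..r}" "J \<noteq> []" by blast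
    have "(\<Sum>j\<leftarrow>J. simple_root j height_mat) = (\<Sum>j\<leftarrow>J. 1)"
      using J(2) by (intro arg_cong[where f = sum_list] map_cong refl simple_root_height_mat) auto
    then have "(\<Sum>j\<leftarrow>J. simple_root j height_mat) = of_nat (length J)" by (simp add: sum_list_triv)
    then have w: "\<rho> height_mat x = sc (\<mu> height_mat - of_nat (length J)) x"
      using F_monomial_weight[OF u(1) height_mat_cartan J(2)] J(1) by simp
    have xV: "x \<in> V" using J uV by (simp add: F_monomial_closed)
    have "P k x = 0" if "k \<ge> length J" for k
    proof -
      have "(\<Prod>i=1..k. of_nat i - of_nat (length J)) = (0::complex)"
        using that J(3) by (intro prod_zero) (auto intro!: bexI[of _ "length J"] simp: Suc_le_eq)
      then show ?thesis using P_eigen[OF xV w, of k] by simp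
    qed
    with xV show ?case by blast
  qed
  then obtain N where "P N u = 0" by blast
  moreover have "P N u = sc (\<Prod>i=1..N. of_nat i - of_nat 0) u"
    using u height_mat_cartan by (intro P_eigen uV) (simp add: singular_def)
  moreover have "(\<Prod>i=1..N. of_nat i - of_nat 0) \<noteq> (0::complex)" by simp
  ultimately show False using u(2) by (simp add: scale_eq_0_iff)
qed

text \<open>\<open>u\<close> together with a basis of \<open>lower_span u\<close> is independent, so
  the values 1 on \<open>u\<close> and 0 on that basis extend to a linear form on the whole ambient
  space.\<close>

lemma dual_vector_exists:
  assumes u: "singular \<mu> u" "u \<noteq> 0"
  obtains \<xi> :: "'v \<Rightarrow> complex" where "\<And>x y. \<xi> (x + y) = \<xi> x + \<xi> y" "\<And>a x. \<xi> (sc a x) = a * \<xi> x" "\<xi> u = 1"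
    "\<And>J. set J \<subseteq> {1..r} \<Longrightarrow> J \<noteq> [] \<Longrightarrow> \<xi> (F_monomial r \<rho> J u) = 0"
proof -
  interpret pair: vector_space_pair sc "(*) :: complex \<Rightarrow> complex \<Rightarrow> complex"
    by unfold_locales (simp_all add: algebra_simps)
  let ?S = "{F_monomial r \<rho> J u | J. set J \<subseteq> {1..r} \<and> J \<noteq> []}"
  obtain C where C: "C \<subseteq> ?S" "independent C" "?S \<subseteq> span C"
    using maximal_independent_subset[of ?S] by blast
  have "u \<notin> span C" using singular_notin_lower_span[OF u] span_mono[OF C(1)] by (auto simp: lower_span_def)
  then have ind: "independent (insert u C)" and uC: "u \<notin> C"
    using C(2) by (auto simp: independent_insert intro: span_base)
  obtain \<xi> where lin: "Vector_Spaces.linear sc (*) \<xi>" and val: "\<And>x. x \<in> insert u C \<Longrightarrow> \<xi> x = (if x = u then 1 else 0)"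
    using pair.linear_independent_extend[OF ind, of "\<lambda>x. if x = u then 1 else 0"] by blast
  have zero: "\<xi> x = 0" if "x \<in> span C" for x
    by (rule pair.linear_eq_0_on_span[OF lin _ that]) (use val uC in auto)
  show thesis
  proof
    show "\<xi> (x + y) = \<xi> x + \<xi> y" for x y by (rule pair.linear_add[OF lin])
    show "\<xi> (sc a x) = a * \<xi> x" for a x by (rule pair.linear_scale[OF lin])
    show "\<xi> u = 1" using val by simp
    show "\<xi> (F_monomial r \<rho> J u) = 0" if "set J \<subseteq> {1..r}" "J \<noteq> []" for J
      using that C(3) by (intro zero) blast
  qed
qed

end

lemma unit_mat_commutator:
  assumes "b \<in> {1..r + 1}" "d \<in> {1..r + 1}" "a \<noteq> d"
  shows "unit_mat r a b * unit_mat r b d - unit_mat r b d * unit_mat r a b = unit_mat r a d"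
proof -
  have "unit_mat r a b * unit_mat r b d - unit_mat r b d * unit_mat r a b = unit_mat r a d - 0\<^sub>m (r + 1) (r + 1)"
    using unit_mat_mult[OF assms(1), where a = a and c = b and d = d] unit_mat_mult[OF assms(2), where a = b and c = a and d = b] assms(3) by simp
  also have "\<dots> = unit_mat r a d" by (rule eq_matI) (auto simp: unit_mat_def)
  finally show ?thesis .
qed

lemma sl_add:
  assumes "x \<in> sl r" "y \<in> sl r"
  shows "x + y \<in> sl r"
proof -
  have "(\<Sum>a<r + 1. (x + y) $$ (a, a)) = (\<Sum>a<r + 1. x $$ (a, a)) + (\<Sum>a<r + 1. y $$ (a, a))"
    unfolding sum.distrib[symmetric] using assms by (intro sum.cong refl) (auto simp: sl_def)
  then show ?thesis using assms by (simp add: sl_def del: sum.lessThan_Suc)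
qed

context sl_rep
begin

text \<open>The form \<open>\<xi>\<close> composed with \<open>E_(j_k) ... E_(j_1)\<close>. The head
  of the list acts on the vector before the others, so this is the transpose of
  \<open>F_monomial\<close> under the exchange of \<open>E\<close> and \<open>F\<close>.\<close>

fun dual_E :: "('v \<Rightarrow> complex) \<Rightarrow> nat list \<Rightarrow> 'v \<Rightarrow> complex" where
  "dual_E \<xi> [] u = \<xi> u"
| "dual_E \<xi> (j # J) u = dual_E \<xi> J (\<rho> (chev_E r j) u)"

lemma dual_E_linear:
  assumes \<xi>: "\<And>x y. \<xi> (x + y) = \<xi> x + \<xi> y" "\<And>a x. \<xi> (sc a x) = a * \<xi> x"
    and J: "set J \<subseteq> {1..r}"
  shows "x \<in> V \<Longrightarrow> y \<in> V \<Longrightarrow> dual_E \<xi> J (x + y) = dual_E \<xi> J x + dual_E \<xi> J y"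
    and "x \<in> V \<Longrightarrow> dual_E \<xi> J (sc a x) = a * dual_E \<xi> J x"
proof -
  have "\<forall>x\<in>V. \<forall>y\<in>V. \<forall>a. dual_E \<xi> J (x + y) = dual_E \<xi> J x + dual_E \<xi> J y \<and> dual_E \<xi> J (sc a x) = a * dual_E \<xi> J x"
    using J by (induction J) (simp_all add: \<xi> act_add act_scale act_closed chev_sl)
  then show "x \<in> V \<Longrightarrow> y \<in> V \<Longrightarrow> dual_E \<xi> J (x + y) = dual_E \<xi> J x + dual_E \<xi> J y"
    and "x \<in> V \<Longrightarrow> dual_E \<xi> J (sc a x) = a * dual_E \<xi> J x" by blast+
qed

lemma dual_E_sum:
  assumes \<xi>: "\<And>x y. \<xi> (x + y) = \<xi> x + \<xi> y" "\<And>a x. \<xi> (sc a x) = a * \<xi> x"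
    and J: "set J \<subseteq> {1..r}" and f: "\<And>i. i \<in> A \<Longrightarrow> f i \<in> V" and fin: "finite A"
  shows "dual_E \<xi> J (\<Sum>i\<in>A. sc (k i) (f i)) = (\<Sum>i\<in>A. k i * dual_E \<xi> J (f i))"
  using fin f
proof (induction A)
  case empty
  show ?case using dual_E_linear(2)[OF \<xi> J subspace_0[OF subspace_V], of 0] by simp
next
  case (insert i A)
  have "(\<Sum>i\<in>A. sc (k i) (f i)) \<in> V"
    using insert by (intro subspace_sum[OF subspace_V] subspace_scale[OF subspace_V]) auto
  moreover have "sc (k i) (f i) \<in> V" "f i \<in> V" using insert by (auto intro: subspace_scale[OF subspace_V])
  ultimately show ?case using insert by (simp add: dual_E_linear[OF \<xi> J])
qed

text \<open>A formula for the Shapovalov form on monomials. The \<open>E\<close>s remove the labels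
  of \<open>B\<close> one at a time, and \<open>C\<close> lists them in the order of removal, which
  forces the colours of \<open>C\<close> to be \<open>J\<close>. When \<open>a\<close> is removed,
  the labels still standing to its right are those behind \<open>a\<close> both in \<open>B\<close>
  and in \<open>C\<close>; their roots are subtracted from \<open>\<mu>\<close>.\<close>

lemma dual_E_F_monomial:
  fixes c :: "'a \<Rightarrow> nat"
  assumes u: "singular \<mu> u" and \<xi>: "\<And>x y. \<xi> (x + y) = \<xi> x + \<xi> y" "\<And>a x. \<xi> (sc a x) = a * \<xi> x"
    "\<xi> u = 1" "\<And>J. set J \<subseteq> {1..r} \<Longrightarrow> J \<noteq> [] \<Longrightarrow> \<xi> (F_monomial r \<rho> J u) = 0"
    and J: "set J \<subseteq> {1..r}" and B: "distinct B" "c ` set B \<subseteq> {1..r}"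
  shows "dual_E \<xi> J (F_monomial r \<rho> (map c B) u) =
    (\<Sum>C | distinct C \<and> set C = set B \<and> map c C = J.
      \<Prod>a\<in>set B. \<mu> (chev_H r (c a)) - (\<Sum>b | precedes B a b \<and> precedes C a b. simple_root (c b) (chev_H r (c a))))"
  using J B
proof (induction J arbitrary: B)
  case Nil
  \<comment> \<open>When no \<open>E\<close> is left, \<open>\<xi>\<close> kills every monomial that
    still contains an \<open>F\<close>, and it is 1 on \<open>u\<close>.\<close>
  have "{C. distinct C \<and> set C = set B \<and> map c C = []} = (if B = [] then {[]} else {})" by auto
  then show ?case using \<xi>(3) \<xi>(4)[of "map c B"] Nil.prems by (auto simp: F_monomial_Nil)
next
  case (Cons j J)
  have uV: "u \<in> V" using u by (simp add: singular_def)
  have j: "j \<in> {1..r}" and J: "set J \<subseteq> {1..r}" using Cons.prems by auto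
  define W where "W B C = (\<Prod>a\<in>set B. \<mu> (chev_H r (c a)) -
    (\<Sum>b | precedes B a b \<and> precedes C a b. simple_root (c b) (chev_H r (c a))))" for B C
  define k where "k a = \<mu> (chev_H r j) - (\<Sum>b | precedes B a b. simple_root (c b) (chev_H r j))" for a
  define B' where "B' a = filter (\<lambda>b. b \<noteq> a) B" for a
  define T where "T a = {C. distinct C \<and> set C = set (B' a) \<and> map c C = J}" for a
  have B': "distinct (B' a)" "c ` set (B' a) \<subseteq> {1..r}" "set (B' a) = set B - {a}" for a
    using Cons.prems(2,3) by (auto simp: B'_def)
  have finT: "finite (T a)" for a
  proof (rule finite_subset)
    show "T a \<subseteq> {C. set C \<subseteq> set B \<and> length C \<le> length J}" using B'(3) by (auto simp: T_def)
    show "finite {C. set C \<subseteq> set B \<and> length C \<le> length J}" by (rule finite_lists_length_le) simp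
  qed
  have wV: "F_monomial r \<rho> (map c (B' a)) u \<in> V" for a
    using B'(2)[of a] by (intro F_monomial_closed[OF uV]) simp
  have "dual_E \<xi> (j # J) (F_monomial r \<rho> (map c B) u) =
      dual_E \<xi> J (\<Sum>a | a \<in> set B \<and> c a = j. sc (k a) (F_monomial r \<rho> (map c (B' a)) u))"
    using E_F_monomial[OF u j Cons.prems(2,3)] by (simp add: k_def B'_def)
  also have "\<dots> = (\<Sum>a | a \<in> set B \<and> c a = j. k a * dual_E \<xi> J (F_monomial r \<rho> (map c (B' a)) u))"
    by (rule dual_E_sum[OF \<xi>(1,2) J]) (use wV in auto)
  also have "\<dots> = (\<Sum>a | a \<in> set B \<and> c a = j. \<Sum>C\<in>T a. k a * W (B' a) C)"
    using Cons.IH[OF J B'(1,2)] by (simp add: W_def T_def sum_distrib_left)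
  also have "\<dots> = (\<Sum>a | a \<in> set B \<and> c a = j. \<Sum>C\<in>T a. W B (a # C))"
  proof (intro sum.cong refl)
    fix a C assume a: "a \<in> {a. a \<in> set B \<and> c a = j}" and C: "C \<in> T a"
    have setC: "set C = set B - {a}" using C B'(3) by (simp add: T_def)
    have "W B (a # C) = (\<mu> (chev_H r (c a)) - (\<Sum>b | precedes B a b \<and> precedes (a # C) a b. simple_root (c b) (chev_H r (c a)))) *
      (\<Prod>x\<in>set B - {a}. \<mu> (chev_H r (c x)) - (\<Sum>b | precedes B x b \<and> precedes (a # C) x b. simple_root (c b) (chev_H r (c x))))"
      unfolding W_def using a by (subst prod.remove[of _ a]) auto
    \<comment> \<open>\<open>a\<close> is removed before all other labels, so everything behind it
      in \<open>B\<close> is still present.\<close>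
    also have "{b. precedes B a b \<and> precedes (a # C) a b} = {b. precedes B a b}"
    proof -
      have "b \<noteq> a" if "precedes B a b" for b
        using that Cons.prems(2) by (induction B) (auto dest: precedes_set)
      then show ?thesis using setC by (auto dest: precedes_set)
    qed
    also have "(\<Prod>x\<in>set B - {a}. \<mu> (chev_H r (c x)) - (\<Sum>b | precedes B x b \<and> precedes (a # C) x b. simple_root (c b) (chev_H r (c x)))) = W (B' a) C"
      unfolding W_def B'(3)
    proof (rule prod.cong[OF refl])
      fix x assume x: "x \<in> set B - {a}"
      have "{b. precedes B x b \<and> precedes (a # C) x b} = {b. precedes (B' a) x b \<and> precedes C x b}"
      proof (intro Collect_cong)
        fix b
        show "precedes B x b \<and> precedes (a # C) x b \<longleftrightarrow> precedes (B' a) x b \<and> precedes C x b"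
        proof (cases "b = a")
          case True
          then show ?thesis using setC x by (auto dest!: precedes_set)
        next
          case False
          then show ?thesis using x by (auto simp: B'_def precedes_filter)
        qed
      qed
      then show "\<mu> (chev_H r (c x)) - (\<Sum>b | precedes B x b \<and> precedes (a # C) x b. simple_root (c b) (chev_H r (c x))) =
        \<mu> (chev_H r (c x)) - (\<Sum>b | precedes (B' a) x b \<and> precedes C x b. simple_root (c b) (chev_H r (c x)))" by simp
    qed
    also have "\<mu> (chev_H r (c a)) - (\<Sum>b | precedes B a b. simple_root (c b) (chev_H r (c a))) = k a"
      using a by (simp add: k_def)
    finally show "k a * W (B' a) C = W B (a # C)" by simp
  qed
  also have "\<dots> = (\<Sum>(a, C)\<in>Sigma {a. a \<in> set B \<and> c a = j} T. W B (a # C))"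
    by (rule sum.Sigma) (use finT in auto)
  also have "\<dots> = (\<Sum>C | distinct C \<and> set C = set B \<and> map c C = j # J. W B C)"
  proof (rule sum.reindex_bij_witness[where i = "\<lambda>C. (hd C, tl C)" and j = "\<lambda>(a, C). a # C"], goal_cases)
    case (2 p)
    then show ?case by (auto simp: T_def B'(3))
  next
    case (4 C)
    then obtain a C' where C: "C = a # C'" by (cases C) auto
    then have "a \<in> set B" "c a = j" "distinct C'" "set C' = set B - {a}" "map c C' = J" using 4 by auto
    then show ?case using C by (simp add: T_def B'(3))
  next
    case (3 C)
    then show ?case by (cases C) auto
  qed auto
  finally show ?case unfolding W_def .
qed

text \<open>The off-diagonal matrix units are iterated commutators of generators:
  \<open>[e_(a,b), E_b] = e_(a,b+1)\<close> above the diagonal and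
  \<open>[F_b, e_(b,a)] = e_(b+1,a)\<close> below it.\<close>

lemma unit_mat_stable:
  assumes S: "subspace U" "U \<subseteq> V" and E: "\<And>i u. i \<in> {1..r} \<Longrightarrow> u \<in> U \<Longrightarrow> \<rho> (chev_E r i) u \<in> U"
    and F: "\<And>i u. i \<in> {1..r} \<Longrightarrow> u \<in> U \<Longrightarrow> \<rho> (chev_F r i) u \<in> U"
    and ab: "a \<noteq> b" "a \<in> {1..r + 1}" "b \<in> {1..r + 1}" and u: "u \<in> U"
  shows "\<rho> (unit_mat r a b) u \<in> U"
proof -
  have comm: "\<rho> (x * y - y * x) u \<in> U" if "x \<in> sl r" "y \<in> sl r" "\<And>u. u \<in> U \<Longrightarrow> \<rho> x u \<in> U" "\<And>u. u \<in> U \<Longrightarrow> \<rho> y u \<in> U" "u \<in> U" for x y u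
  proof -
    have "u \<in> V" using that(5) S(2) by blast
    then show ?thesis
      unfolding commutator_act[OF that(1,2) \<open>u \<in> V\<close>] using that(3-5) by (simp add: subspace_diff[OF S(1)])
  qed
  have up: "\<rho> (unit_mat r a (a + Suc d)) u \<in> U" if "1 \<le> a" "a + Suc d \<le> r + 1" "u \<in> U" for a d u
    using that
  proof (induction d arbitrary: u)
    case 0
    then show ?case using E[of a u] by (simp add: chev_E_def)
  next
    case (Suc d)
    let ?b = "a + Suc d"
    have b: "?b \<in> {1..r}" using Suc.prems by simp
    have "unit_mat r a ?b * chev_E r ?b - chev_E r ?b * unit_mat r a ?b = unit_mat r a (?b + 1)"
      unfolding chev_E_def using b Suc.prems by (intro unit_mat_commutator) auto
    moreover have "\<rho> (unit_mat r a ?b * chev_E r ?b - chev_E r ?b * unit_mat r a ?b) u \<in> U"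
    proof (rule comm)
      show "unit_mat r a ?b \<in> sl r" by (rule unit_mat_sl) simp
      show "chev_E r ?b \<in> sl r" by (rule chev_sl(1)[OF b])
      show "\<rho> (unit_mat r a ?b) u \<in> U" if "u \<in> U" for u
        by (rule Suc.IH[OF _ _ that]) (use Suc.prems in simp_all)
      show "\<rho> (chev_E r ?b) u \<in> U" if "u \<in> U" for u by (rule E[OF b that])
      show "u \<in> U" by (rule Suc.prems(3))
    qed
    ultimately show ?case by simp
  qed
  have down: "\<rho> (unit_mat r (a + Suc d) a) u \<in> U" if "1 \<le> a" "a + Suc d \<le> r + 1" "u \<in> U" for a d u
    using that
  proof (induction d arbitrary: u)
    case 0
    then show ?case using F[of a u] by (simp add: chev_F_def)
  next
    case (Suc d)
    let ?b = "a + Suc d"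
    have b: "?b \<in> {1..r}" using Suc.prems by simp
    have "chev_F r ?b * unit_mat r ?b a - unit_mat r ?b a * chev_F r ?b = unit_mat r (?b + 1) a"
      unfolding chev_F_def using b Suc.prems by (intro unit_mat_commutator) auto
    moreover have "\<rho> (chev_F r ?b * unit_mat r ?b a - unit_mat r ?b a * chev_F r ?b) u \<in> U"
    proof (rule comm)
      show "unit_mat r ?b a \<in> sl r" by (rule unit_mat_sl) simp
      show "chev_F r ?b \<in> sl r" by (rule chev_sl(2)[OF b])
      show "\<rho> (unit_mat r ?b a) u \<in> U" if "u \<in> U" for u
        by (rule Suc.IH[OF _ _ that]) (use Suc.prems in simp_all)
      show "\<rho> (chev_F r ?b) u \<in> U" if "u \<in> U" for u by (rule F[OF b that])
      show "u \<in> U" by (rule Suc.prems(3))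
    qed
    ultimately show ?case by simp
  qed
  show ?thesis
  proof (cases "a < b")
    case True
    then obtain d where "b = a + Suc d" using less_iff_Suc_add by auto
    then show ?thesis using up[of a d u] ab u by simp
  next
    case False
    then obtain d where "a = b + Suc d" using ab less_iff_Suc_add[of b a] by auto
    then show ?thesis using down[of b d u] ab u by simp
  qed
qed

text \<open>The Chevalley generators generate the Lie algebra. The off-diagonal part of
  \<open>x\<close> is accumulated entry by entry from matrix units, and the diagonal part from the
  \<open>H_i\<close>, which act as commutators of \<open>E_i\<close> and \<open>F_i\<close>.\<close>

lemma chevalley_stable:
  assumes S: "subspace U" "U \<subseteq> V" and E: "\<And>i u. i \<in> {1..r} \<Longrightarrow> u \<in> U \<Longrightarrow> \<rho> (chev_E r i) u \<in> U"
    and F: "\<And>i u. i \<in> {1..r} \<Longrightarrow> u \<in> U \<Longrightarrow> \<rho> (chev_F r i) u \<in> U"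
    and x: "x \<in> sl r" and u: "u \<in> U"
  shows "\<rho> x u \<in> U"
proof -
  have H: "\<rho> (chev_H r i) u \<in> U" if i: "i \<in> {1..r}" for i
  proof -
    have "\<rho> (chev_H r i) u = \<rho> (chev_E r i) (\<rho> (chev_F r i) u) - \<rho> (chev_F r i) (\<rho> (chev_E r i) u)"
      using commutator_act[OF chev_sl[OF i], of u] chev_EF_commutator[OF i i] u S(2) by auto
    then show ?thesis using E F i u by (auto intro: subspace_diff[OF S(1)])
  qed
  have xc: "x \<in> carrier_mat (r + 1) (r + 1)" and tr: "(\<Sum>a<r + 1. x $$ (a, a)) = 0" using x by (auto simp: sl_def)
  define part where "part T = mat (r + 1) (r + 1) (\<lambda>p. if p \<in> T then x $$ p else 0)" for T
  have off: "part T \<in> sl r \<and> \<rho> (part T) u \<in> U" if "finite T" "\<And>a b. (a, b) \<in> T \<Longrightarrow> a \<noteq> b \<and> a < r + 1 \<and> b < r + 1" for T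
    using that
  proof (induction T)
    case empty
    have "part {} = 0\<^sub>m (r + 1) (r + 1)" by (auto simp: part_def)
    then show ?case using zero_act[of u] u S subspace_0[OF S(1)] by (auto simp: sl_def)
  next
    case (insert p T)
    obtain a b where p: "p = (a, b)" by (cases p)
    have ab: "a \<noteq> b" "a < r + 1" "b < r + 1" using insert.prems[of a b] p by auto
    have IH: "part T \<in> sl r" "\<rho> (part T) u \<in> U" using insert by auto
    let ?e = "unit_mat r (a + 1) (b + 1)"
    have e: "?e \<in> sl r" using ab by (intro unit_mat_sl) simp
    have se: "x $$ p \<cdot>\<^sub>m ?e \<in> sl r" using ab by (auto simp: sl_def unit_mat_def intro!: sum.neutral)
    have eq: "part (insert p T) = part T + x $$ p \<cdot>\<^sub>m ?e"
      using insert.hyps p by (intro eq_matI) (auto simp: part_def unit_mat_def)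
    have "(a, a) \<notin> insert p T" for a using insert.prems[of a a] by blast
    then have "part (insert p T) \<in> sl r"
      unfolding sl_def part_def by (auto intro!: sum.neutral simp del: sum.lessThan_Suc insert_iff)
    moreover have "\<rho> (part (insert p T)) u = \<rho> (part T) u + sc (x $$ p) (\<rho> ?e u)"
      unfolding eq using add_act[OF IH(1) se] scale_act[OF e] u S(2) by auto
    moreover have "\<rho> ?e u \<in> U" using ab u by (intro unit_mat_stable[OF S E F]) auto
    ultimately show ?case using IH(2) by (auto intro: subspace_add[OF S(1)] subspace_scale[OF S(1)])
  qed
  \<comment> \<open>\<open>diag k\<close> carries the diagonal entries of \<open>x\<close> before
    position \<open>k\<close> and minus their sum at position \<open>k\<close>, which keeps the
    trace 0. One more step adds \<open>d (Suc k)\<close> times a coroot, and at \<open>k = r\<close>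
    the last entry is right because \<open>x\<close> itself is traceless.\<close>
  define d where "d a = (\<Sum>b<a. x $$ (b, b))" for a
  define diag where "diag k = mat (r + 1) (r + 1) (\<lambda>(a, b). if a = b then if a < k then x $$ (a, a) else if a = k then - d k else 0 else 0)" for k
  have on: "diag k \<in> sl r \<and> \<rho> (diag k) u \<in> U" if "k \<le> r" for k
    using that
  proof (induction k)
    case 0
    have "diag 0 = 0\<^sub>m (r + 1) (r + 1)" by (auto simp: diag_def d_def)
    then show ?case using zero_act[of u] u S subspace_0[OF S(1)] by (auto simp: sl_def)
  next
    case (Suc k)
    have IH: "diag k \<in> sl r" "\<rho> (diag k) u \<in> U" using Suc by auto
    have i: "Suc k \<in> {1..r}" using Suc.prems by simp
    have eq: "diag (Suc k) = diag k + d (Suc k) \<cdot>\<^sub>m chev_H r (Suc k)"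
      using Suc.prems by (intro eq_matI) (auto simp: diag_def d_def chev_H_def unit_mat_def)
    note H' = cartan_sl[OF chev_H_cartan[OF i]]
    have sH: "d (Suc k) \<cdot>\<^sub>m chev_H r (Suc k) \<in> sl r"
      using H' by (auto simp: sl_def sum_distrib_left[symmetric] simp del: sum.lessThan_Suc)
    have "diag (Suc k) \<in> sl r"
      unfolding eq by (rule sl_add[OF IH(1) sH])
    moreover have "\<rho> (diag (Suc k)) u = \<rho> (diag k) u + sc (d (Suc k)) (\<rho> (chev_H r (Suc k)) u)"
      unfolding eq using add_act[OF IH(1) sH] scale_act[OF H'] u S(2) by auto
    ultimately show ?case using IH(2) H[OF i] by (auto intro: subspace_add[OF S(1)] subspace_scale[OF S(1)])
  qed
  define T where "T = {p \<in> {..<r + 1} \<times> {..<r + 1}. fst p \<noteq> snd p}"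
  have "finite T" by (simp add: T_def)
  then have "part T \<in> sl r \<and> \<rho> (part T) u \<in> U"
    by (rule off) (simp_all add: T_def del: less_Suc_eq)
  then have T: "part T \<in> sl r" "\<rho> (part T) u \<in> U" by blast+
  have "d r + x $$ (r, r) = 0" using tr by (simp add: d_def)
  then have "x $$ (r, r) = - d r" by (simp add: eq_neg_iff_add_eq_0 add.commute)
  then have "x = part T + diag r"
    using xc by (intro eq_matI) (auto simp: part_def diag_def T_def less_Suc_eq)
  then have "\<rho> x u = \<rho> (part T) u + \<rho> (diag r) u"
    using add_act[OF T(1), of "diag r" u] on[of r] u S(2) by auto
  then show ?thesis using T(2) on[of r] by (simp add: subspace_add[OF S(1)])
qed

text \<open>\<open>E_i F_i u = \<mu>(H_i) u = 0\<close> makes \<open>w = F_i u\<close> singular. If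
  \<open>w\<close> were non-zero, the monomials applied to it would span a non-zero submodule, hence
  all of \<open>V\<close>. But this span lies in \<open>lower_span u\<close>, which does not contain
  \<open>u\<close>.\<close>

lemma F_singular_eq_0:
  assumes irr: "irreducible_module r sc V \<rho>" and u: "singular \<mu> u" "u \<noteq> 0"
    and i: "i \<in> {1..r}" and \<mu>: "\<mu> (chev_H r i) = 0"
  shows "\<rho> (chev_F r i) u = 0"
proof (rule ccontr)
  define w where "w = \<rho> (chev_F r i) u"
  assume "\<rho> (chev_F r i) u \<noteq> 0"
  then have w0: "w \<noteq> 0" by (simp add: w_def)
  have uV: "u \<in> V" using u by (simp add: singular_def)
  then have wV: "w \<in> V" unfolding w_def using i by (intro act_closed chev_sl)
  have w_F: "F_monomial r \<rho> [i] u = w" by (simp add: F_monomial_Cons F_monomial_Nil w_def)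
  have "singular (\<lambda>h. \<mu> h - simple_root i h) w"
    unfolding singular_def
  proof (intro conjI ballI wV)
    fix h assume h: "h \<in> cartan r"
    show "\<rho> h w = sc (\<mu> h - simple_root i h) w"
      using F_monomial_weight[OF u(1) h, of "[i]"] i by (simp add: w_F)
  next
    fix j assume j: "j \<in> {1..r}"
    have "\<rho> (chev_E r j) w = (\<Sum>a | a \<in> set [i] \<and> a = j. sc (\<mu> (chev_H r j) - (\<Sum>b | precedes [i] a b. simple_root b (chev_H r j)))
       (F_monomial r \<rho> (map (\<lambda>a. a) (filter (\<lambda>b. b \<noteq> a) [i])) u))"
      using E_F_monomial[OF u(1) j, of "[i]" "\<lambda>a. a"] i w_F by simp
    also have "\<dots> = 0" using \<mu> by (intro sum.neutral) auto
    finally show "\<rho> (chev_E r j) w = 0" .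
  qed
  note sing = this
  define U where "U = span {F_monomial r \<rho> J w | J. set J \<subseteq> {1..r}}"
  have S: "subspace U" unfolding U_def by (rule subspace_span)
  have UV: "U \<subseteq> V" unfolding U_def
    by (rule span_minimal[OF _ subspace_V]) (blast intro: F_monomial_closed[OF wV])
  have gen: "F_monomial r \<rho> J w \<in> U" if "set J \<subseteq> {1..r}" for J
    unfolding U_def by (rule span_base) (use that in blast)
  \<comment> \<open>It suffices to test stability on the spanning monomials. Membership in
    \<open>V\<close> accompanies the induction because the action is linear only on
    \<open>V\<close>.\<close>
  have extend: "\<rho> x y \<in> U" if x: "x \<in> sl r" and J: "\<And>J. set J \<subseteq> {1..r} \<Longrightarrow> \<rho> x (F_monomial r \<rho> J w) \<in> U" and y: "y \<in> U" for x y
  proof -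
    have "y \<in> V \<and> \<rho> x y \<in> U" using y unfolding U_def
    proof (induction y rule: span_induct)
      case base
      show ?case
      proof (rule subspaceI)
        show "0 \<in> {a. a \<in> V \<and> \<rho> x a \<in> span {F_monomial r \<rho> J w |J. set J \<subseteq> {1..r}}}"
          using act_zero[OF x] subspace_0[OF subspace_V] span_zero by simp
        fix a b assume "a \<in> {a. a \<in> V \<and> \<rho> x a \<in> span {F_monomial r \<rho> J w |J. set J \<subseteq> {1..r}}}"
          "b \<in> {a. a \<in> V \<and> \<rho> x a \<in> span {F_monomial r \<rho> J w |J. set J \<subseteq> {1..r}}}"
        then show "a + b \<in> {a. a \<in> V \<and> \<rho> x a \<in> span {F_monomial r \<rho> J w |J. set J \<subseteq> {1..r}}}"
          using act_add[OF x, of a b] subspace_add[OF subspace_V, of a b] span_add by simp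
      next
        fix k a assume "a \<in> {a. a \<in> V \<and> \<rho> x a \<in> span {F_monomial r \<rho> J w |J. set J \<subseteq> {1..r}}}"
        then show "sc k a \<in> {a. a \<in> V \<and> \<rho> x a \<in> span {F_monomial r \<rho> J w |J. set J \<subseteq> {1..r}}}"
          using act_scale[OF x, of a k] subspace_scale[OF subspace_V, of a k] span_scale by simp
      qed
    next
      case (step y)
      then obtain J where "y = F_monomial r \<rho> J w" "set J \<subseteq> {1..r}" by blast
      then show ?case using J[of J] F_monomial_closed[OF wV, of J] by (simp add: U_def)
    qed
    then show ?thesis by blast
  qed
  have FU: "\<rho> (chev_F r j) y \<in> U" if "j \<in> {1..r}" "y \<in> U" for j y
  proof (rule extend[OF _ _ that(2)])
    fix J assume "set J \<subseteq> {1..r}"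
    then have "F_monomial r \<rho> (j # J) w \<in> U" using that(1) by (intro gen) simp
    then show "\<rho> (chev_F r j) (F_monomial r \<rho> J w) \<in> U" by (simp add: F_monomial_Cons)
  qed (rule chev_sl(2)[OF that(1)])
  have EU: "\<rho> (chev_E r j) y \<in> U" if "j \<in> {1..r}" "y \<in> U" for j y
  proof (rule extend[OF _ _ that(2)])
    fix J assume J: "set J \<subseteq> {1..r}"
    \<comment> \<open>\<open>E_F_monomial\<close> wants distinct labels while \<open>J\<close> may
      repeat a letter, so the positions in \<open>J\<close> serve as labels.\<close>
    let ?B = "[0..<length J]" and ?c = "\<lambda>k. J ! k"
    have c: "map ?c ?B = J" by (rule map_nth)
    have im: "?c ` set ?B \<subseteq> {1..r}" unfolding set_map[symmetric] c by (rule J)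
    have "\<rho> (chev_E r j) (F_monomial r \<rho> (map ?c ?B) w) \<in> U"
      unfolding E_F_monomial[OF sing that(1) distinct_upt im]
    proof (intro subspace_sum[OF S] subspace_scale[OF S] gen)
      fix a
      show "set (map ?c (filter (\<lambda>b. b \<noteq> a) ?B)) \<subseteq> {1..r}" using im by (auto simp: image_subset_iff)
    qed
    then show "\<rho> (chev_E r j) (F_monomial r \<rho> J w) \<in> U" by (simp only: c)
  qed (rule chev_sl(1)[OF that(1)])
  have "\<rho> x y \<in> U" if "x \<in> sl r" "y \<in> U" for x y
    by (rule chevalley_stable[OF S UV _ _ that]) (rule EU FU; assumption)+
  then have "U \<subseteq> V \<and> subspace U \<and> (\<forall>x\<in>sl r. \<forall>u\<in>U. \<rho> x u \<in> U)" using S UV by blast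
  moreover have "U \<subseteq> V \<and> subspace U \<and> (\<forall>x\<in>sl r. \<forall>u\<in>U. \<rho> x u \<in> U) \<longrightarrow> U = {0} \<or> U = V"
    using irr unfolding irreducible_module_def by (elim conjE allE[of _ U])
  ultimately have "U = {0} \<or> U = V" by (rule rev_mp)
  moreover have "w \<in> U" using gen[of "[]"] by (simp add: F_monomial_Nil)
  ultimately have "u \<in> U" using w0 uV by auto
  moreover have "U \<subseteq> lower_span u"
    unfolding U_def lower_span_def
  proof (rule span_mono, rule subsetI)
    fix y assume "y \<in> {F_monomial r \<rho> J w | J. set J \<subseteq> {1..r}}"
    then obtain J where J: "y = F_monomial r \<rho> J w" "set J \<subseteq> {1..r}" by blast
    have "y = F_monomial r \<rho> (J @ [i]) u"
      unfolding J(1) w_F[symmetric] by (simp add: F_monomial_def)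
    moreover have "set (J @ [i]) \<subseteq> {1..r}" "J @ [i] \<noteq> []" using J(2) i by auto
    ultimately show "y \<in> {F_monomial r \<rho> J u | J. set J \<subseteq> {1..r} \<and> J \<noteq> []}" by blast
  qed
  ultimately show False using singular_notin_lower_span[OF u] by blast
qed

end

section \<open>Removing denominators\<close>

definition nodes :: "nat \<Rightarrow> (nat \<Rightarrow> complex) \<Rightarrow> (nat \<Rightarrow> complex) \<Rightarrow> nat \<Rightarrow> complex" where
  "nodes m t z = (\<lambda>i. if i \<le> m then t i else z (i - m))"

text \<open>The pairs whose difference may occur in a denominator: two variables, in either order,
  or a variable and a point \<open>z\<close>. Two points \<open>z\<close> never form such a
  pair.\<close>

definition edge_pairs :: "nat \<Rightarrow> nat \<Rightarrow> (nat \<times> nat) set" where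
  "edge_pairs m n = {(a, q). a \<in> {1..m} \<and> q \<in> {1..m + n} \<and> a \<noteq> q}"

definition generic :: "nat \<Rightarrow> nat \<Rightarrow> (nat \<Rightarrow> complex) \<Rightarrow> bool" where
  "generic m n x \<longleftrightarrow> (\<forall>(a, q)\<in>edge_pairs m n. x a \<noteq> x q)"

lemma genericD: "generic m n x \<Longrightarrow> a \<in> {1..m} \<Longrightarrow> q \<in> {1..m + n} \<Longrightarrow> a \<noteq> q \<Longrightarrow> x a \<noteq> x q"
  unfolding generic_def edge_pairs_def by blast

lemma finite_edge_pairs: "finite (edge_pairs m n)"
  by (rule finite_subset[of _ "{1..m} \<times> {1..m + n}"]) (auto simp: edge_pairs_def)

lemma generic_nodes: "generic m n (nodes m t z) \<longleftrightarrow> off_diagonals m n t z"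
proof
  assume g: "generic m n (nodes m t z)"
  have "t i \<noteq> t j" if "i \<in> {1..m}" "j \<in> {1..m}" "i \<noteq> j" for i j
    using genericD[OF g, of i j] that by (simp add: nodes_def)
  moreover have "t i \<noteq> z s" if "i \<in> {1..m}" "s \<in> {1..n}" for i s
    using genericD[OF g, of i "m + s"] that by (simp add: nodes_def)
  ultimately show "off_diagonals m n t z" unfolding off_diagonals_def inj_on_def by blast
next
  assume o: "off_diagonals m n t z"
  have "nodes m t z a \<noteq> nodes m t z q" if "a \<in> {1..m}" "q \<in> {1..m + n}" "a \<noteq> q" for a q
  proof (cases "q \<le> m")
    case True
    then show ?thesis using o that by (auto simp: off_diagonals_def nodes_def dest: inj_onD)
  next
    case False
    then have "q - m \<in> {1..n}" using that by auto
    then show ?thesis using o that False by (simp add: off_diagonals_def nodes_def)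
  qed
  then show "generic m n (nodes m t z)" by (auto simp: generic_def edge_pairs_def)
qed

text \<open>Polynomials in the merged family of variables, where the diagonals
  \<open>t_a = t_b\<close> and \<open>t_a = z_s\<close> can be treated alike.\<close>

inductive_set node_polys :: "nat \<Rightarrow> ((nat \<Rightarrow> complex) \<Rightarrow> complex) set" for N :: nat where
  const: "(\<lambda>x. a) \<in> node_polys N"
| var: "i \<in> {1..N} \<Longrightarrow> (\<lambda>x. x i) \<in> node_polys N"
| add: "p \<in> node_polys N \<Longrightarrow> q \<in> node_polys N \<Longrightarrow> (\<lambda>x. p x + q x) \<in> node_polys N"
| mult: "p \<in> node_polys N \<Longrightarrow> q \<in> node_polys N \<Longrightarrow> (\<lambda>x. p x * q x) \<in> node_polys N"

lemma node_polys_poly_functions: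
  "p \<in> node_polys (m + n) \<Longrightarrow> (\<lambda>t z. p (nodes m t z)) \<in> poly_functions m n"
proof (induction rule: node_polys.induct)
  case (var i)
  show ?case
  proof (cases "i \<le> m")
    case True
    then show ?thesis using var by (auto simp: nodes_def intro: poly_functions.var_t)
  next
    case False
    then have "i - m \<in> {1..n}" using var by auto
    then show ?thesis using False by (simp add: nodes_def poly_functions.var_z)
  qed
qed (auto intro: poly_functions.intros)

lemma node_polys_diff_var: "i \<in> {1..N} \<Longrightarrow> j \<in> {1..N} \<Longrightarrow> (\<lambda>x. x i - x j) \<in> node_polys N"
  using node_polys.add[OF node_polys.var node_polys.mult[OF node_polys.const[where a = "-1"] node_polys.var], of i N j] by simp

lemma node_polys_prod_list:
  "(\<And>i. i \<in> set xs \<Longrightarrow> f i \<in> node_polys N) \<Longrightarrow> (\<lambda>x. \<Prod>i\<leftarrow>xs. f i x) \<in> node_polys N"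
  by (induction xs) (auto intro: node_polys.const node_polys.mult)

lemma tendsto_node_poly:
  assumes "p \<in> node_polys N" "\<And>i. ((\<lambda>e. X e i) \<longlongrightarrow> x i) F"
  shows "((\<lambda>e. p (X e)) \<longlongrightarrow> p x) F"
  using assms(1) by (induction rule: node_polys.induct) (auto intro: tendsto_intros assms(2))

lemma node_poly_subst:
  assumes "p \<in> node_polys N" "b \<in> {1..N}"
  shows "(\<lambda>x. p (x(a := x b))) \<in> node_polys N"
  using assms(1)
proof (induction rule: node_polys.induct)
  case (var i)
  then show ?case using assms(2) by (cases "i = a") (simp_all add: node_polys.var)
qed (auto intro: node_polys.intros)

text \<open>The factor theorem for the linear form \<open>x a - x b\<close>. The quotient is a
  divided difference, built along the construction of \<open>p\<close> by a product rule.\<close>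

lemma node_poly_factor:
  assumes "p \<in> node_polys N" "a \<in> {1..N}" "b \<in> {1..N}"
  obtains p' where "p' \<in> node_polys N" "\<And>x. p x - p (x(a := x b)) = (x a - x b) * p' x"
proof -
  have "\<exists>p'\<in>node_polys N. \<forall>x. p x - p (x(a := x b)) = (x a - x b) * p' x"
    using assms(1)
  proof (induction rule: node_polys.induct)
    case (const c)
    show ?case by (rule bexI[of _ "\<lambda>x. 0"]) (auto intro: node_polys.const)
  next
    case (var i)
    show ?case
    proof (cases "i = a")
      case True
      then show ?thesis by (intro bexI[of _ "\<lambda>x. 1"]) (auto intro: node_polys.const)
    next
      case False
      then show ?thesis by (intro bexI[of _ "\<lambda>x. 0"]) (auto intro: node_polys.const)
    qed
  next
    case (add p q)
    then obtain p' q' where *: "p' \<in> node_polys N" "q' \<in> node_polys N"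
      "\<And>x. p x - p (x(a := x b)) = (x a - x b) * p' x" "\<And>x. q x - q (x(a := x b)) = (x a - x b) * q' x" by blast
    have eq: "p x + q x - (p (x(a := x b)) + q (x(a := x b))) = (x a - x b) * (p' x + q' x)" for x
      unfolding distrib_left *(3,4)[symmetric] by simp
    have mem: "(\<lambda>x. p' x + q' x) \<in> node_polys N" using * by (intro node_polys.add)
    show ?case by (rule bexI[OF _ mem]) (rule allI, rule eq)
  next
    case (mult p q)
    then obtain p' q' where *: "p' \<in> node_polys N" "q' \<in> node_polys N"
      "\<And>x. p x - p (x(a := x b)) = (x a - x b) * p' x" "\<And>x. q x - q (x(a := x b)) = (x a - x b) * q' x" by blast
    have eq: "p x * q x - p (x(a := x b)) * q (x(a := x b)) = (x a - x b) * (p x * q' x + p' x * q (x(a := x b)))" for x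
    proof -
      have "p x * q x - p (x(a := x b)) * q (x(a := x b)) =
        p x * (q x - q (x(a := x b))) + (p x - p (x(a := x b))) * q (x(a := x b))" by (simp add: algebra_simps)
      also have "\<dots> = (x a - x b) * (p x * q' x + p' x * q (x(a := x b)))"
        unfolding *(3,4) by (simp add: algebra_simps)
      finally show ?thesis .
    qed
    have mem: "(\<lambda>x. p x * q' x + p' x * q (x(a := x b))) \<in> node_polys N"
      using mult.hyps * node_poly_subst[OF mult.hyps(2) assms(3), of a] by (intro node_polys.add node_polys.mult)
    show ?case by (rule bexI[OF _ mem]) (rule allI, rule eq)
  qed
  then show thesis using that by blast
qed

text \<open>Two affine functions of \<open>e\<close> that do not coincide agree for at most one
  \<open>e\<close>. If that one is 0, it is excluded by the punctured neighbourhood.\<close>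

lemma eventually_line_ne:
  fixes u w d d' :: complex
  assumes "u \<noteq> w \<or> d \<noteq> d'"
  shows "eventually (\<lambda>e. u + e * d \<noteq> w + e * d') (at 0)"
proof (cases "d = d'")
  case True
  then show ?thesis using assms by simp
next
  case False
  have "eventually (\<lambda>e. e \<noteq> (w - u) / (d - d') \<or> e = 0) (nhds 0)"
  proof (cases "(w - u) / (d - d') = 0")
    case True
    then show ?thesis by simp
  next
    case False
    then have "eventually (\<lambda>e. e \<noteq> (w - u) / (d - d')) (nhds 0)" by (intro t1_space_nhds) auto
    then show ?thesis by (rule eventually_mono) simp
  qed
  then have "eventually (\<lambda>e. e \<noteq> (w - u) / (d - d')) (at 0)"
    unfolding eventually_at_filter by (rule eventually_mono) auto
  then show ?thesis
  proof (rule eventually_mono)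
    fix e assume e: "e \<noteq> (w - u) / (d - d')"
    show "u + e * d \<noteq> w + e * d'"
    proof
      assume "u + e * d = w + e * d'"
      then have "e * (d - d') = w - u" by (simp add: algebra_simps)
      then show False using e False by (simp add: field_simps)
    qed
  qed
qed

text \<open>The denominator is a product of admissible differences, possibly repeated. The identity
  is required only at generic points, since elsewhere the formula for \<open>f\<close> may divide by
  0.\<close>

definition rational_function :: "nat \<Rightarrow> nat \<Rightarrow> ((nat \<Rightarrow> complex) \<Rightarrow> complex) \<Rightarrow> bool" where
  "rational_function m n f \<longleftrightarrow> (\<exists>ls p. set ls \<subseteq> edge_pairs m n \<and> p \<in> node_polys (m + n) \<and>
     (\<forall>x. generic m n x \<longrightarrow> (\<Prod>(a, b)\<leftarrow>ls. x a - x b) * f x = p x))"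

lemma rational_function_const: "rational_function m n (\<lambda>x. c)"
  unfolding rational_function_def by (intro exI[of _ "[]"] exI[of _ "\<lambda>x. c"]) (simp add: node_polys.const)

lemma denominator_poly:
  assumes "set ls \<subseteq> edge_pairs m n"
  shows "(\<lambda>x. \<Prod>(a, b)\<leftarrow>ls. x a - x b) \<in> node_polys (m + n)"
proof -
  have "(\<lambda>x. \<Prod>p\<leftarrow>ls. (\<lambda>x. x (fst p) - x (snd p)) x) \<in> node_polys (m + n)"
    using assms by (intro node_polys_prod_list node_polys_diff_var) (auto simp: edge_pairs_def)
  then show ?thesis by (simp add: case_prod_unfold)
qed

lemma rational_function_inverse:
  assumes "(a, b) \<in> edge_pairs m n"
  shows "rational_function m n (\<lambda>x. 1 / (x a - x b))"
  unfolding rational_function_def using assms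
  by (intro exI[of _ "[(a, b)]"] exI[of _ "\<lambda>x. 1"]) (auto simp: node_polys.const generic_def)

lemma rational_function_mult:
  assumes "rational_function m n f" "rational_function m n g"
  shows "rational_function m n (\<lambda>x. f x * g x)"
proof -
  obtain ls p ls' p' where *: "set ls \<subseteq> edge_pairs m n" "p \<in> node_polys (m + n)"
     "\<And>x. generic m n x \<Longrightarrow> (\<Prod>(a, b)\<leftarrow>ls. x a - x b) * f x = p x"
     "set ls' \<subseteq> edge_pairs m n" "p' \<in> node_polys (m + n)"
     "\<And>x. generic m n x \<Longrightarrow> (\<Prod>(a, b)\<leftarrow>ls'. x a - x b) * g x = p' x"
    using assms unfolding rational_function_def by blast
  have "(\<Prod>(a, b)\<leftarrow>ls @ ls'. x a - x b) * (f x * g x) = p x * p' x" if "generic m n x" for x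
    unfolding *(3)[OF that, symmetric] *(6)[OF that, symmetric] by simp
  then show ?thesis
    unfolding rational_function_def using * 
    by (intro exI[of _ "ls @ ls'"] exI[of _ "\<lambda>x. p x * p' x"]) (simp add: node_polys.mult)
qed

lemma rational_function_add:
  assumes "rational_function m n f" "rational_function m n g"
  shows "rational_function m n (\<lambda>x. f x + g x)"
proof -
  obtain ls p ls' p' where *: "set ls \<subseteq> edge_pairs m n" "p \<in> node_polys (m + n)"
     "\<And>x. generic m n x \<Longrightarrow> (\<Prod>(a, b)\<leftarrow>ls. x a - x b) * f x = p x"
     "set ls' \<subseteq> edge_pairs m n" "p' \<in> node_polys (m + n)"
     "\<And>x. generic m n x \<Longrightarrow> (\<Prod>(a, b)\<leftarrow>ls'. x a - x b) * g x = p' x"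
    using assms unfolding rational_function_def by blast
  let ?p = "\<lambda>x. (\<Prod>(a, b)\<leftarrow>ls'. x a - x b) * p x + (\<Prod>(a, b)\<leftarrow>ls. x a - x b) * p' x"
  have "(\<Prod>(a, b)\<leftarrow>ls @ ls'. x a - x b) * (f x + g x) = ?p x" if "generic m n x" for x
    unfolding *(3)[OF that, symmetric] *(6)[OF that, symmetric] by (simp add: algebra_simps)
  moreover have "?p \<in> node_polys (m + n)"
    using * by (intro node_polys.add node_polys.mult denominator_poly)
  ultimately show ?thesis
    unfolding rational_function_def using *(1,4)
    by (intro exI[of _ "ls @ ls'"] exI[of _ ?p]) simp
qed

lemma rational_function_sum:
  "(\<And>i. i \<in> A \<Longrightarrow> rational_function m n (f i)) \<Longrightarrow> rational_function m n (\<lambda>x. \<Sum>i\<in>A. f i x)"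
  by (induction A rule: infinite_finite_induct) (auto intro: rational_function_const rational_function_add)

lemma rational_function_prod:
  "(\<And>i. i \<in> A \<Longrightarrow> rational_function m n (f i)) \<Longrightarrow> rational_function m n (\<lambda>x. \<Prod>i\<in>A. f i x)"
  by (induction A rule: infinite_finite_induct) (auto intro: rational_function_const rational_function_mult)

text \<open>The generic points of the hyperplane \<open>x a = x b\<close>. All other pairs are
  separated, so that a small move of the coordinate \<open>a\<close> off the hyperplane stays away
  from every other diagonal.\<close>

definition on_wall :: "nat \<Rightarrow> nat \<Rightarrow> nat \<Rightarrow> (nat \<Rightarrow> complex) \<Rightarrow> bool" where
  "on_wall N a b x \<longleftrightarrow> x a = x b \<and>
     (\<forall>i\<in>{1..N}. \<forall>j\<in>{1..N}. i \<noteq> j \<and> {i, j} \<noteq> {a, b} \<longrightarrow> x i \<noteq> x j)"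

text \<open>On the line used here \<open>x a - x b\<close> equals \<open>e\<close>, so
  \<open>f\<close> times this difference tends to 0. For a rational function this excludes a pole
  along the hyperplane.\<close>

definition no_pole :: "nat \<Rightarrow> nat \<Rightarrow> nat \<Rightarrow> ((nat \<Rightarrow> complex) \<Rightarrow> complex) \<Rightarrow> bool" where
  "no_pole N a b f \<longleftrightarrow>
     (\<forall>x. on_wall N a b x \<longrightarrow> ((\<lambda>e. e * f (x(a := x a + e))) \<longlongrightarrow> 0) (at 0))"

lemma eventually_generic_off_wall:
  assumes ab: "(a, b) \<in> edge_pairs m n" and x: "on_wall (m + n) a b x"
  shows "eventually (\<lambda>e. generic m n (x(a := x a + e))) (at 0)"
proof -
  have "eventually (\<lambda>e. (x(a := x a + e)) i \<noteq> (x(a := x a + e)) j) (at 0)"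
    if ij: "(i, j) \<in> edge_pairs m n" for i j
  proof -
    define \<delta> where "\<delta> k = (if k = a then 1 else 0 :: complex)" for k
    have "x i \<noteq> x j \<or> \<delta> i \<noteq> \<delta> j"
    proof (cases "{i, j} = {a, b}")
      case True
      then show ?thesis using ab ij by (auto simp: \<delta>_def edge_pairs_def doubleton_eq_iff)
    next
      case False
      then show ?thesis using x ij by (auto simp: on_wall_def edge_pairs_def)
    qed
    then have "eventually (\<lambda>e. x i + e * \<delta> i \<noteq> x j + e * \<delta> j) (at 0)" by (rule eventually_line_ne)
    then show ?thesis by (rule eventually_mono) (auto simp: \<delta>_def split: if_splits)
  qed
  then show ?thesis
    unfolding generic_def case_prod_beta
    by (intro eventually_ball_finite finite_edge_pairs ballI) (metis prod.collapse)
qed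

text \<open>The generic points are dense in the hyperplane: every point \<open>y\<close> of it is a
  limit of such points along a line inside the hyperplane.\<close>

lemma node_poly_zero_on_wall:
  assumes ab: "(a, b) \<in> edge_pairs m n" and p: "p \<in> node_polys (m + n)"
    and zero: "\<And>x. on_wall (m + n) a b x \<Longrightarrow> p x = 0" and y: "y a = y b"
  shows "p y = 0"
proof -
  \<comment> \<open>The entries at \<open>a\<close> and \<open>b\<close> agree, which keeps the line
    in the hyperplane; any other two entries differ, which takes it off all other diagonals.\<close>
  define d where "d i = (if i = a then of_nat b else of_nat i :: complex)" for i
  define X where "X e i = y i + e * d i" for e i
  have "eventually (\<lambda>e. \<forall>i\<in>{1..m + n}. \<forall>j\<in>{1..m + n}. i \<noteq> j \<and> {i, j} \<noteq> {a, b} \<longrightarrow> X e i \<noteq> X e j) (at 0)"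
  proof (intro eventually_ball_finite finite_atLeastAtMost ballI)
    fix i j
    show "eventually (\<lambda>e. i \<noteq> j \<and> {i, j} \<noteq> {a, b} \<longrightarrow> X e i \<noteq> X e j) (at 0)"
    proof (cases "i \<noteq> j \<and> {i, j} \<noteq> {a, b}")
      case True
      then have "d i \<noteq> d j" by (auto simp: d_def doubleton_eq_iff)
      then have "eventually (\<lambda>e. X e i \<noteq> X e j) (at 0)" unfolding X_def by (intro eventually_line_ne) simp
      then show ?thesis by (rule eventually_mono) simp
    next
      case False
      then show ?thesis by (intro always_eventually) blast
    qed
  qed
  then have "eventually (\<lambda>e. on_wall (m + n) a b (X e)) (at 0)"
  proof (rule eventually_mono)
    fix e
    assume *: "\<forall>i\<in>{1..m + n}. \<forall>j\<in>{1..m + n}. i \<noteq> j \<and> {i, j} \<noteq> {a, b} \<longrightarrow> X e i \<noteq> X e j"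
    have "X e a = X e b" using y by (simp add: X_def d_def)
    with * show "on_wall (m + n) a b (X e)" unfolding on_wall_def by blast
  qed
  then have "eventually (\<lambda>e. p (X e) = 0) (at 0)" by (rule eventually_mono) (rule zero)
  then have "((\<lambda>e. p (X e)) \<longlongrightarrow> 0) (at 0)" by (rule tendsto_eventually)
  moreover have "((\<lambda>e. p (X e)) \<longlongrightarrow> p y) (at 0)"
  proof (rule tendsto_node_poly[OF p])
    fix i
    have "((\<lambda>e. y i + e * d i) \<longlongrightarrow> y i + 0 * d i) (at 0)" by (intro tendsto_intros)
    then show "((\<lambda>e. X e i) \<longlongrightarrow> y i) (at 0)" by (simp add: X_def)
  qed
  ultimately show ?thesis using tendsto_unique[of "at (0::complex)"] by force
qed

text \<open>The differences are cancelled one at a time. At a generic point of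
  \<open>x a = x b\<close> the numerator \<open>p\<close> is a limit of a polynomial times
  \<open>(x a - x b) f\<close>, hence 0. So \<open>p\<close> vanishes on the hyperplane and is
  divisible by the difference. The factor \<open>g\<close> is the part of the denominator that is
  kept.\<close>

lemma remove_denominators:
  assumes "set ls \<subseteq> edge_pairs m n" and "\<And>a b. (a, b) \<in> set ls \<Longrightarrow> no_pole (m + n) a b f"
    and "p \<in> node_polys (m + n)" and g: "g \<in> node_polys (m + n)"
    and "\<And>x. generic m n x \<Longrightarrow> (\<Prod>(a, b)\<leftarrow>ls. x a - x b) * (g x * f x) = p x"
  shows "\<exists>p'\<in>node_polys (m + n). \<forall>x. generic m n x \<longrightarrow> g x * f x = p' x"
  using assms(1-3,5)
proof (induction ls arbitrary: p)
  case Nil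
  then show ?case by (intro bexI[of _ p]) auto
next
  case (Cons c ls)
  obtain a b where c: "c = (a, b)" by (cases c)
  have ab: "(a, b) \<in> edge_pairs m n" using Cons.prems(1) c by simp
  have ne: "a \<noteq> b" using ab by (simp add: edge_pairs_def)
  have np: "no_pole (m + n) a b f" using Cons.prems(2) c by simp
  let ?h = "\<lambda>x. (\<Prod>(a, b)\<leftarrow>ls. x a - x b) * g x"
  have h: "?h \<in> node_polys (m + n)"
    using Cons.prems(1) g by (intro node_polys.mult denominator_poly) auto
  have wall: "p x = 0" if x: "on_wall (m + n) a b x" for x
  proof -
    define X where "X e = x(a := x a + e)" for e
    have X: "((\<lambda>e. X e i) \<longlongrightarrow> x i) (at 0)" for i
    proof -
      have "((\<lambda>e. x a + e) \<longlongrightarrow> x a + 0) (at 0)" by (intro tendsto_intros)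
      then show ?thesis by (cases "i = a") (simp_all add: X_def)
    qed
    have xab: "x a = x b" using x by (simp add: on_wall_def)
    have "((\<lambda>e. ?h (X e) * (e * f (X e))) \<longlongrightarrow> ?h x * 0) (at 0)"
      using np x by (intro tendsto_mult tendsto_node_poly[OF h X]) (simp add: no_pole_def X_def)
    moreover have "eventually (\<lambda>e. ?h (X e) * (e * f (X e)) = p (X e)) (at 0)"
      using eventually_generic_off_wall[OF ab x]
    proof (rule eventually_mono)
      fix e assume "generic m n (x(a := x a + e))"
      then have gen: "generic m n (X e)" by (simp add: X_def)
      have "X e a - X e b = e" using ne xab by (simp add: X_def)
      then show "?h (X e) * (e * f (X e)) = p (X e)"
        using Cons.prems(4)[OF gen] c by (simp add: mult_ac)
    qed
    ultimately have "((\<lambda>e. p (X e)) \<longlongrightarrow> ?h x * 0) (at 0)" by (rule Lim_transform_eventually)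
    moreover have "((\<lambda>e. p (X e)) \<longlongrightarrow> p x) (at 0)"
      by (rule tendsto_node_poly[OF Cons.prems(3) X])
    ultimately show ?thesis using tendsto_unique[of "at (0::complex)"] by force
  qed
  have AB: "a \<in> {1..m + n}" "b \<in> {1..m + n}" using ab by (auto simp: edge_pairs_def)
  obtain p' where p': "p' \<in> node_polys (m + n)" "\<And>x. p x - p (x(a := x b)) = (x a - x b) * p' x"
    using node_poly_factor[OF Cons.prems(3) AB] by blast
  have "p (x(a := x b)) = 0" for x
    by (rule node_poly_zero_on_wall[OF ab Cons.prems(3) wall]) (use ne in auto)
  then have fac: "p x = (x a - x b) * p' x" for x using p'(2)[of x] by simp
  show ?case
  proof (rule Cons.IH)
    show "set ls \<subseteq> edge_pairs m n" using Cons.prems(1) by simp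
    show "no_pole (m + n) a b f" if "(a, b) \<in> set ls" for a b using Cons.prems(2) that by simp
    show "p' \<in> node_polys (m + n)" by (rule p')
    fix x assume gen: "generic m n x"
    have "x a - x b \<noteq> 0" using gen ab by (auto simp: generic_def)
    moreover have "(x a - x b) * ((\<Prod>(a, b)\<leftarrow>ls. x a - x b) * (g x * f x)) = (x a - x b) * p' x"
      using Cons.prems(4)[OF gen] c fac[of x] by (simp add: mult_ac)
    ultimately show "(\<Prod>(a, b)\<leftarrow>ls. x a - x b) * (g x * f x) = p' x" by simp
  qed
qed

text \<open>Only the differences that vanish at \<open>x0\<close> have to be cancelled; the product
  of the others is the denominator \<open>q\<close>.\<close>

lemma regular_at:
  assumes f: "rational_function m n f"
    and np: "\<And>a b. (a, b) \<in> edge_pairs m n \<Longrightarrow> x0 a = x0 b \<Longrightarrow> no_pole (m + n) a b f"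
  obtains q p where "q \<in> node_polys (m + n)" "p \<in> node_polys (m + n)" "q x0 \<noteq> 0"
    "\<And>x. generic m n x \<Longrightarrow> q x * f x = p x"
proof -
  obtain ls p where *: "set ls \<subseteq> edge_pairs m n" "p \<in> node_polys (m + n)"
     "\<And>x. generic m n x \<Longrightarrow> (\<Prod>(a, b)\<leftarrow>ls. x a - x b) * f x = p x"
    using f unfolding rational_function_def by blast
  define bad where "bad = filter (\<lambda>(a, b). x0 a = x0 b) ls"
  define good where "good = filter (\<lambda>(a, b). x0 a \<noteq> x0 b) ls"
  define q where "q x = (\<Prod>(a, b)\<leftarrow>good. x a - x b)" for x :: "nat \<Rightarrow> complex"
  have split: "(\<Prod>(a, b)\<leftarrow>ls. x a - x b) = (\<Prod>(a, b)\<leftarrow>bad. x a - x b) * q x" for x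
    unfolding bad_def good_def q_def by (induction ls) (auto simp: mult_ac)
  have q: "q \<in> node_polys (m + n)"
    unfolding q_def using *(1) by (intro denominator_poly) (auto simp: good_def)
  have "q x0 \<noteq> 0" unfolding q_def good_def by (induction ls) auto
  moreover have "\<exists>p'\<in>node_polys (m + n). \<forall>x. generic m n x \<longrightarrow> q x * f x = p' x"
  proof (rule remove_denominators[OF _ _ *(2) q])
    show "set bad \<subseteq> edge_pairs m n" using *(1) by (auto simp: bad_def)
    show "no_pole (m + n) a b f" if "(a, b) \<in> set bad" for a b
      using that *(1) by (intro np) (auto simp: bad_def)
    show "(\<Prod>(a, b)\<leftarrow>bad. x a - x b) * (q x * f x) = p x" if "generic m n x" for x
      using *(3)[OF that] unfolding split by (simp add: mult_ac)
  qed
  ultimately show thesis using that q by blast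
qed

section \<open>Poles of the universal weight function\<close>

fun next_label :: "'a \<Rightarrow> 'a list \<Rightarrow> 'a \<Rightarrow> 'a" where
  "next_label q [] i = q"
| "next_label q [x] i = q"
| "next_label q (x # y # xs) i = (if x = i then y else next_label q (y # xs) i)"

lemma chain_fun_next_label:
  "distinct xs \<Longrightarrow> chain_fun x (x q) xs = (\<Prod>i\<in>set xs. 1 / (x i - x (next_label q xs i)))"
proof (induction xs rule: induct_list012)
  case (3 a b xs)
  have "(\<Prod>i\<in>set (a # b # xs). 1 / (x i - x (next_label q (a # b # xs) i))) =
      1 / (x a - x b) * (\<Prod>i\<in>set (b # xs). 1 / (x i - x (next_label q (a # b # xs) i)))"
    using 3 by simp
  also have "(\<Prod>i\<in>set (b # xs). 1 / (x i - x (next_label q (a # b # xs) i))) =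
      (\<Prod>i\<in>set (b # xs). 1 / (x i - x (next_label q (b # xs) i)))"
    using "3.prems" by (intro prod.cong refl) auto
  finally show ?case using 3 by simp
qed simp_all

lemma next_label_split:
  "a \<in> set xs \<Longrightarrow> \<exists>ys zs. xs = ys @ a # zs \<and> next_label q xs a = hd (zs @ [q])"
proof (induction xs rule: induct_list012)
  case (2 x)
  then show ?case by (intro exI[of _ "[]"] exI[of _ "[]"]) simp
next
  case (3 x y xs)
  show ?case
  proof (cases "x = a")
    case True
    then show ?thesis by (intro exI[of _ "[]"] exI[of _ "y # xs"]) simp
  next
    case False
    then obtain ys zs where *: "y # xs = ys @ a # zs" "next_label q (y # xs) a = hd (zs @ [q])" using 3 by auto
    have "next_label q (x # y # xs) a = hd (zs @ [q])"
      unfolding next_label.simps(3) using False *(2) by simp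
    moreover have "x # y # xs = (x # ys) @ a # zs" using *(1) by simp
    ultimately show ?thesis by blast
  qed
qed simp

lemma next_label_map:
  "inj f \<Longrightarrow> f q = q \<Longrightarrow> next_label q (map f xs) (f i) = f (next_label q xs i)"
  by (induction xs rule: induct_list012) (auto dest: injD)

definition successor :: "nat \<Rightarrow> nat \<Rightarrow> (nat \<Rightarrow> nat list) \<Rightarrow> nat \<Rightarrow> nat" where
  "successor m n B i = (let k = THE k. k \<in> {1..n} \<and> i \<in> set (B k) in next_label (m + k) (B k) i)"

lemma successor_eq:
  assumes "B \<in> arrangements n L" "k \<in> {1..n}" "i \<in> set (B k)"
  shows "successor m n B i = next_label (m + k) (B k) i"
proof -
  have "(THE k. k \<in> {1..n} \<and> i \<in> set (B k)) = k"
    using assms arrangementsD(3)[OF assms(1)] by (intro the_equality) blast+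
  then show ?thesis by (simp add: successor_def)
qed

lemma chain_prod_successor:
  assumes B: "B \<in> arrangements n L"
  shows "chain_prod m n x B = (\<Prod>i\<in>L. 1 / (x i - x (successor m n B i)))"
proof -
  have L: "L = (\<Union>k\<in>{1..n}. set (B k))" by (rule arrangements_Union[OF B])
  have "(\<Prod>i\<in>L. 1 / (x i - x (successor m n B i))) = (\<Prod>k\<in>{1..n}. \<Prod>i\<in>set (B k). 1 / (x i - x (successor m n B i)))"
    unfolding L
  proof (rule prod.UNION_disjoint)
    show "\<forall>j\<in>{1..n}. \<forall>k\<in>{1..n}. j \<noteq> k \<longrightarrow> set (B j) \<inter> set (B k) = {}"
      using arrangementsD(3)[OF B] by blast
  qed auto
  also have "\<dots> = chain_prod m n x B"
    unfolding chain_prod_def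
  proof (rule prod.cong[OF refl])
    fix k assume k: "k \<in> {1..n}"
    show "(\<Prod>i\<in>set (B k). 1 / (x i - x (successor m n B i))) = chain_fun x (x (m + k)) (B k)"
      unfolding chain_fun_next_label[OF arrangementsD(1)[OF B k]]
      using successor_eq[OF B k] by (intro prod.cong) auto
  qed
  finally show ?thesis by simp
qed

lemma successor_cases:
  assumes B: "B \<in> arrangements n L" and i: "i \<in> L"
  obtains k ys where "k \<in> {1..n}" "B k = ys @ [i]" "successor m n B i = m + k"
  | k ys zs where "k \<in> {1..n}" "B k = ys @ i # successor m n B i # zs"
proof -
  obtain k where k: "k \<in> {1..n}" "i \<in> set (B k)" using arrangementsD(4)[OF B i] by blast
  obtain ys zs where *: "B k = ys @ i # zs" "successor m n B i = hd (zs @ [m + k])"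
    using next_label_split[OF k(2), of "m + k"] successor_eq[OF B k] by auto
  show thesis
  proof (cases zs)
    case Nil
    then show ?thesis using * k by (intro that(1)) auto
  next
    case (Cons z zs')
    then show ?thesis using * k by (intro that(2)) auto
  qed
qed

lemma successor_edge:
  assumes B: "B \<in> arrangements n {1..m}" and i: "i \<in> {1..m}"
  shows "(i, successor m n B i) \<in> edge_pairs m n"
proof (rule successor_cases[OF B i, where m = m])
  fix k ys assume "k \<in> {1..n}" "successor m n B i = m + k"
  then show ?thesis using i by (auto simp: edge_pairs_def)
next
  fix k ys zs assume k: "k \<in> {1..n}" "B k = ys @ i # successor m n B i # zs"
  then have "successor m n B i \<in> {1..m}" "successor m n B i \<noteq> i"
    using arrangementsD(1,2)[OF B k(1)] by auto
  then show ?thesis using i by (auto simp: edge_pairs_def)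
qed

text \<open>If \<open>b\<close> directly follows \<open>a\<close>, whatever follows \<open>b\<close>
  stands behind it and cannot be \<open>a\<close>. Hence a chain product contains the difference of
  \<open>x a\<close> and \<open>x b\<close> at most once, and its pole there is at most
  simple.\<close>

lemma successor_asym:
  assumes B: "B \<in> arrangements n {1..m}" and ab: "a \<in> {1..m}" "b \<in> {1..m}"
    and s: "successor m n B a = b" "successor m n B b = a"
  shows False
proof (rule successor_cases[OF B ab(1), where m = m])
  fix k assume "k \<in> {1..n}" "successor m n B a = m + k"
  then show False using ab s by simp
next
  fix k ys zs assume k: "k \<in> {1..n}" "B k = ys @ a # successor m n B a # zs"
  have b: "b \<in> set (B k)" using k s by simp
  have d: "distinct (ys @ a # b # zs)" using arrangementsD(1)[OF B k(1)] k s by simp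
  have "next_label q (ys @ a # b # zs) b = hd (zs @ [q])" if "distinct (ys @ a # b # zs)" for q
    using that
  proof (induction ys)
    case Nil
    then show ?case by (cases zs) auto
  next
    case (Cons y ys)
    then show ?case by (cases ys) auto
  qed
  from this[OF d, of "m + k"] have "hd (zs @ [m + k]) = a"
    using successor_eq[OF B k(1) b, of m] k s by simp
  then show False using d ab k(1) by (cases zs) auto
qed

lemma successor_permute:
  assumes B: "B \<in> arrangements n {1..m}" and \<sigma>: "\<sigma> permutes {1..m}" and i: "i \<in> {1..m}"
  shows "successor m n (\<lambda>k\<in>{1..n}. map \<sigma> (B k)) (\<sigma> i) = \<sigma> (successor m n B i)"
proof -
  obtain k where k: "k \<in> {1..n}" "i \<in> set (B k)" using arrangementsD(4)[OF B i] by blast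
  have fix_root: "\<sigma> (m + k) = m + k" using \<sigma> k(1) by (intro permutes_not_in[OF \<sigma>]) simp
  have "successor m n (\<lambda>k\<in>{1..n}. map \<sigma> (B k)) (\<sigma> i) = next_label (m + k) (map \<sigma> (B k)) (\<sigma> i)"
    using successor_eq[OF arrangements_permute[OF B \<sigma>] k(1), of "\<sigma> i" m] k by simp
  also have "\<dots> = \<sigma> (next_label (m + k) (B k) i)"
    using permutes_inj[OF \<sigma>] fix_root by (rule next_label_map)
  finally show ?thesis using successor_eq[OF B k, of m] by simp
qed

text \<open>The arrangements whose chain product has the difference of \<open>x a\<close> and
  \<open>x b\<close> in its denominator. Here \<open>b\<close> may be a root; the second alternative
  asks for a label because only labels have a successor.\<close>

definition adjacent :: "nat \<Rightarrow> nat \<Rightarrow> nat \<Rightarrow> nat \<Rightarrow> (nat \<Rightarrow> nat list) \<Rightarrow> bool" where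
  "adjacent m n a b B \<longleftrightarrow> successor m n B a = b \<or> b \<in> {1..m} \<and> successor m n B b = a"

text \<open>The residues at \<open>x\<^sub>a = x\<^sub>b\<close> of the chains of \<open>B\<close> and of the arrangement with \<open>a\<close> and \<open>b\<close>
  exchanged are opposite.\<close>

lemma no_pole_chain_sum:
  assumes ab: "(a, b) \<in> edge_pairs m n" and S: "S \<subseteq> arrangements n {1..m}"
    and swap: "\<And>B. B \<in> S \<Longrightarrow> adjacent m n a b B \<Longrightarrow>
      b \<in> {1..m} \<and> (\<lambda>k\<in>{1..n}. map (Transposition.transpose a b) (B k)) \<in> S"
  shows "no_pole (m + n) a b (\<lambda>x. \<Sum>B\<in>S. chain_prod m n x B)"
  unfolding no_pole_def
proof (intro allI impI)
  fix x assume x: "on_wall (m + n) a b x"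
  let ?L = "{1..m}" and ?\<tau> = "Transposition.transpose a b"
  have a: "a \<in> ?L" and aN: "a \<in> {1..m + n}" and bN: "b \<in> {1..m + n}" and ne: "a \<noteq> b"
    using ab by (auto simp: edge_pairs_def)
  have xab: "x a = x b" using x by (simp add: on_wall_def)
  define X where "X e = x(a := x a + e)" for e
  define nx where "nx B i = successor m n B i" for B i
  \<comment> \<open>The limit of factor \<open>i\<close> on the wall, after multiplication by
    \<open>e\<close> if that factor is singular there. The singular factor is \<open>1 / e\<close>
    or \<open>- 1 / e\<close>, depending on which of \<open>a\<close> and \<open>b\<close> stands in
    front.\<close>
  define ee where "ee B i = (if i = a \<and> nx B a = b then 1 else if i = b \<and> nx B b = a then - 1 else 1 / (x i - x (nx B i)))" for B i
  define T where "T = {B \<in> S. adjacent m n a b B}"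
  have finS: "finite S" using S by (rule finite_subset) (simp add: finite_arrangements)
  have X: "((\<lambda>e. X e i) \<longlongrightarrow> x i) (at 0)" for i
  proof -
    have "((\<lambda>e. x a + e) \<longlongrightarrow> x a + 0) (at 0)" by (intro tendsto_intros)
    then show ?thesis by (cases "i = a") (simp_all add: X_def)
  qed
  have edge: "(i, nx B i) \<in> edge_pairs m n" if "B \<in> S" "i \<in> ?L" for B i
    unfolding nx_def using S that by (intro successor_edge) auto
  have regular: "((\<lambda>e. 1 / (X e i - X e (nx B i))) \<longlongrightarrow> 1 / (x i - x (nx B i))) (at 0)"
    if "B \<in> S" "i \<in> ?L" "{i, nx B i} \<noteq> {a, b}" for B i
  proof (intro tendsto_intros X)
    show "x i - x (nx B i) \<noteq> 0"
      using edge[OF that(1,2)] that(3) x by (simp add: edge_pairs_def on_wall_def)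
  qed
  have lim: "((\<lambda>e. e * chain_prod m n (X e) B) \<longlongrightarrow> (if B \<in> T then \<Prod>i\<in>?L. ee B i else 0)) (at 0)"
    if B: "B \<in> S" for B
  proof -
    have arr: "B \<in> arrangements n ?L" using S B by auto
    have cp: "chain_prod m n y B = (\<Prod>i\<in>?L. 1 / (y i - y (nx B i)))" for y
      unfolding nx_def by (rule chain_prod_successor[OF arr])
    show ?thesis
    proof (cases "adjacent m n a b B")
      case False
      then have "{i, nx B i} \<noteq> {a, b}" if "i \<in> ?L" for i
        using that by (auto simp: adjacent_def nx_def doubleton_eq_iff)
      then have "((\<lambda>e. e * chain_prod m n (X e) B) \<longlongrightarrow> 0 * (\<Prod>i\<in>?L. 1 / (x i - x (nx B i)))) (at 0)"
        unfolding cp by (intro tendsto_mult tendsto_ident_at tendsto_prod regular B)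
      then show ?thesis using False by (simp add: T_def)
    next
      case True
      then have bL: "b \<in> ?L" using swap[OF B] by blast
      \<comment> \<open>\<open>i0\<close> is the label whose factor is singular on the wall, and
        \<open>s\<close> is the sign of that factor.\<close>
      obtain i0 s where i0: "i0 \<in> ?L" "ee B i0 = s" "s * s = 1" "\<And>e. X e i0 - X e (nx B i0) = s * e" "{i0, nx B i0} = {a, b}"
      proof (cases "nx B a = b")
        case True
        show ?thesis by (rule that[of a 1]) (use True a ne xab in \<open>auto simp: ee_def X_def\<close>)
      next
        case False
        then have "nx B b = a" using \<open>adjacent m n a b B\<close> by (simp add: adjacent_def nx_def)
        then show ?thesis
          by (intro that[of b "- 1"]) (use False bL ne xab in \<open>auto simp: ee_def X_def\<close>)
      qed
      have other: "{i, nx B i} \<noteq> {a, b}" if i: "i \<in> ?L" "i \<noteq> i0" for i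
      proof
        assume "{i, nx B i} = {a, b}"
        with i0(5) i have "nx B i = i0" "nx B i0 = i" by (auto simp: doubleton_eq_iff)
        then show False using successor_asym[OF arr i(1) i0(1)] by (simp add: nx_def)
      qed
      have ee_other: "ee B i = 1 / (x i - x (nx B i))" if "i \<in> ?L - {i0}" for i
        using other[of i] that by (auto simp: ee_def doubleton_eq_iff)
      have "((\<lambda>e. s * (\<Prod>i\<in>?L - {i0}. 1 / (X e i - X e (nx B i)))) \<longlongrightarrow> s * (\<Prod>i\<in>?L - {i0}. 1 / (x i - x (nx B i)))) (at 0)"
        using other by (intro tendsto_mult tendsto_const tendsto_prod regular B) auto
      moreover have "eventually (\<lambda>e. s * (\<Prod>i\<in>?L - {i0}. 1 / (X e i - X e (nx B i))) = e * chain_prod m n (X e) B) (at 0)"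
        unfolding eventually_at_filter
      proof (intro always_eventually allI impI)
        fix e :: complex assume e: "e \<noteq> 0"
        have "chain_prod m n (X e) B = 1 / (s * e) * (\<Prod>i\<in>?L - {i0}. 1 / (X e i - X e (nx B i)))"
          unfolding cp i0(4)[symmetric] using i0(1) by (subst prod.remove[of _ i0]) auto
        moreover have "e * (1 / (s * e)) = s"
        proof -
          have "s \<noteq> 0" using i0(3) by auto
          then show ?thesis using e i0(3) by (simp add: field_simps)
        qed
        ultimately show "s * (\<Prod>i\<in>?L - {i0}. 1 / (X e i - X e (nx B i))) = e * chain_prod m n (X e) B"
          by (metis mult.assoc)
      qed
      ultimately have "((\<lambda>e. e * chain_prod m n (X e) B) \<longlongrightarrow> s * (\<Prod>i\<in>?L - {i0}. 1 / (x i - x (nx B i)))) (at 0)"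
        by (rule Lim_transform_eventually)
      moreover have "(\<Prod>i\<in>?L. ee B i) = s * (\<Prod>i\<in>?L - {i0}. 1 / (x i - x (nx B i)))"
        using prod.remove[of ?L i0 "ee B"] i0(1,2) ee_other by simp
      ultimately show ?thesis using True B by (simp add: T_def)
    qed
  qed
  have "((\<lambda>e. \<Sum>B\<in>S. e * chain_prod m n (X e) B) \<longlongrightarrow> (\<Sum>B\<in>S. if B \<in> T then \<Prod>i\<in>?L. ee B i else 0)) (at 0)"
    by (intro tendsto_sum lim)
  moreover have "(\<Sum>B\<in>S. if B \<in> T then \<Prod>i\<in>?L. ee B i else 0) = 0"
  proof -
    define sw where "sw B = (\<lambda>k\<in>{1..n}. map ?\<tau> (B k))" for B :: "nat \<Rightarrow> nat list"
    \<comment> \<open>The exchange keeps the limits of the regular factors, because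
      \<open>x a = x b\<close> on the wall. It reverses the order of the two labels, which changes
      the sign of the singular factor.\<close>
    have ex: "sw B \<in> T \<and> sw (sw B) = B \<and> (\<Prod>i\<in>?L. ee (sw B) i) = - (\<Prod>i\<in>?L. ee B i)" if B: "B \<in> T" for B
    proof -
      have BS: "B \<in> S" and adj: "adjacent m n a b B" using B by (auto simp: T_def)
      then have bL: "b \<in> ?L" and sS: "sw B \<in> S" using swap[OF BS adj] by (auto simp: sw_def)
      have arr: "B \<in> arrangements n ?L" using S BS by auto
      have \<tau>: "?\<tau> permutes ?L" using a bL by (rule permutes_swap_id)
      have nx_sw: "nx (sw B) (?\<tau> i) = ?\<tau> (nx B i)" if "i \<in> ?L" for i
        unfolding nx_def sw_def by (rule successor_permute[OF arr \<tau> that])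
      have "adjacent m n a b (sw B)"
        using adj nx_sw[OF a] nx_sw[OF bL] bL by (auto simp: adjacent_def nx_def)
      then have 1: "sw B \<in> T" using sS by (simp add: T_def)
      have 2: "sw (sw B) = B"
      proof
        fix k show "sw (sw B) k = B k"
        proof (cases "k \<in> {1..n}")
          case True
          then show ?thesis by (simp add: sw_def o_def)
        next
          case False
          then show ?thesis using arrangementsD(5)[OF arr] by (simp add: sw_def extensional_def del: atLeastAtMost_iff)
        qed
      qed
      obtain i0 where i0: "i0 \<in> ?L" "{i0, nx B i0} = {a, b}"
        using adj a bL by (auto simp: adjacent_def nx_def doubleton_eq_iff)
      have x\<tau>: "x (?\<tau> i) = x i" for i using xab by (simp add: Transposition.transpose_def)
      have "ee (sw B) (?\<tau> i) = (if i = i0 then - 1 else 1) * ee B i" if i: "i \<in> ?L" for i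
      proof (cases "{i, nx B i} = {a, b}")
        case True
        have "i = i0"
        proof (rule ccontr)
          assume "i \<noteq> i0"
          with True i0(2) have "nx B i = i0" "nx B i0 = i" by (auto simp: doubleton_eq_iff)
          then show False using successor_asym[OF arr i i0(1)] by (simp add: nx_def)
        qed
        moreover have "i = a \<and> nx B a = b \<or> i = b \<and> nx B b = a" using True by (auto simp: doubleton_eq_iff)
        ultimately show ?thesis using nx_sw[OF i] ne by (auto simp: ee_def)
      next
        case False
        then have "i \<noteq> i0" using i0(2) by auto
        moreover have "\<not> (i = a \<and> nx B a = b)" "\<not> (i = b \<and> nx B b = a)" using False by auto
        moreover have "\<not> (?\<tau> i = c \<and> nx (sw B) c = d)" if "{c, d} = {a, b}" for c d
        proof
          assume *: "?\<tau> i = c \<and> nx (sw B) c = d"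
          have flip: "j = ?\<tau> k" if "?\<tau> j = k" for j k using that by auto
          have "i = ?\<tau> c" "nx B i = ?\<tau> d" using * nx_sw[OF i] flip by metis+
          then have "{i, nx B i} = {a, b}" using that by (auto simp: doubleton_eq_iff)
          then show False using False by simp
        qed
        then have n2: "\<not> (?\<tau> i = a \<and> nx (sw B) a = b)" "\<not> (?\<tau> i = b \<and> nx (sw B) b = a)" by blast+
        then have "ee (sw B) (?\<tau> i) = 1 / (x i - x (nx B i))"
          by (simp only: ee_def n2 if_False nx_sw[OF i] x\<tau>)
        ultimately show ?thesis by (simp only: ee_def if_False mult_1_left)
      qed
      then have "(\<Prod>i\<in>?L. ee (sw B) (?\<tau> i)) = (\<Prod>i\<in>?L. (if i = i0 then - 1 else 1) * ee B i)"
        by (intro prod.cong) auto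
      also have "\<dots> = (\<Prod>i\<in>?L. if i = i0 then - 1 else 1) * (\<Prod>i\<in>?L. ee B i)" by (rule prod.distrib)
      also have "(\<Prod>i\<in>?L. if i = i0 then - 1 else 1) = (- 1 :: complex)" using i0(1) by (simp add: prod.delta)
      also have "(\<Prod>i\<in>?L. ee (sw B) (?\<tau> i)) = (\<Prod>i\<in>?L. ee (sw B) i)"
        using prod.permute[OF \<tau>, of "ee (sw B)"] by (simp add: o_def)
      finally show ?thesis using 1 2 by simp
    qed
    have finT: "finite T" using finS by (simp add: T_def)
    have "(\<Sum>B\<in>T. \<Prod>i\<in>?L. ee B i) = (\<Sum>B\<in>T. \<Prod>i\<in>?L. ee (sw B) i)"
      by (rule sum.reindex_bij_witness[of _ sw sw]) (use ex in auto)
    also have "\<dots> = - (\<Sum>B\<in>T. \<Prod>i\<in>?L. ee B i)" using ex by (simp add: sum_negf)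
    finally have "(\<Sum>B\<in>T. \<Prod>i\<in>?L. ee B i) = 0" by simp
    moreover have "(\<Sum>B\<in>S. if B \<in> T then \<Prod>i\<in>?L. ee B i else 0) = (\<Sum>B\<in>T. \<Prod>i\<in>?L. ee B i)"
      by (rule sum.mono_neutral_cong_right[OF finS]) (auto simp: T_def)
    ultimately show ?thesis by simp
  qed
  ultimately show "((\<lambda>e. e * (\<Sum>B\<in>S. chain_prod m n (x(a := x a + e)) B)) \<longlongrightarrow> 0) (at 0)"
    by (simp add: sum_distrib_left X_def)
qed

lemma rational_function_chain_prod:
  assumes "B \<in> arrangements n {1..m}"
  shows "rational_function m n (\<lambda>x. chain_prod m n x B)"
  unfolding chain_prod_successor[OF assms]
  by (intro rational_function_prod rational_function_inverse successor_edge[OF assms])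

section \<open>Regular values\<close>

lemma vector_space_tensor: "vector_space (tensor_scale :: complex \<Rightarrow> 'v tensor \<Rightarrow> 'v tensor)"
  by unfold_locales (auto simp: tensor_scale_def fun_eq_iff algebra_simps)

interpretation tensor: vector_space "tensor_scale :: complex \<Rightarrow> 'v tensor \<Rightarrow> 'v tensor"
  by (rule vector_space_tensor)

lemma tensor_sum_apply: "(\<Sum>i\<in>A. f i) \<phi> = (\<Sum>i\<in>A. (f i :: 'v tensor) \<phi>)"
  by (induction A rule: infinite_finite_induct) auto

lemma tendsto_poly_function:
  assumes "p \<in> poly_functions m n" "\<And>i. ((\<lambda>e. T e i) \<longlongrightarrow> t i) F"
  shows "((\<lambda>e. p (T e) z) \<longlongrightarrow> p t z) F"
  using assms(1) by (induction rule: poly_functions.induct) (auto intro: tendsto_intros assms(2))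

lemma poly_functions_prod:
  "(\<And>i. i \<in> A \<Longrightarrow> f i \<in> poly_functions m n) \<Longrightarrow> (\<lambda>t z. \<Prod>i\<in>A. f i t z) \<in> poly_functions m n"
  by (induction A rule: infinite_finite_induct) (auto intro: poly_functions.const poly_functions.mult)

text \<open>A line through \<open>t\<close> whose coordinates have pairwise distinct speeds. The
  variables are numbered from 1, so all of them move relative to the points \<open>z\<close>, which
  stay fixed.\<close>

definition move :: "(nat \<Rightarrow> complex) \<Rightarrow> complex \<Rightarrow> nat \<Rightarrow> complex" where
  "move t e = (\<lambda>i. t i + e * of_nat i)"

lemma tendsto_move: "((\<lambda>e. move t e i) \<longlongrightarrow> t i) (at 0)"
proof -
  have "((\<lambda>e. t i + e * of_nat i) \<longlongrightarrow> t i + 0 * of_nat i) (at 0)" by (intro tendsto_intros)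
  then show ?thesis by (simp add: move_def)
qed

lemma eventually_off_diagonals_move: "eventually (\<lambda>e. off_diagonals m n (move t e) z) (at 0)"
proof -
  have "eventually (\<lambda>e. \<forall>i\<in>{1..m}. \<forall>j\<in>{1..m}. i \<noteq> j \<longrightarrow> move t e i \<noteq> move t e j) (at 0)"
  proof (intro eventually_ball_finite finite_atLeastAtMost ballI)
    fix i j
    show "eventually (\<lambda>e. i \<noteq> j \<longrightarrow> move t e i \<noteq> move t e j) (at 0)"
      unfolding move_def by (cases "i = j") (simp_all add: eventually_line_ne)
  qed
  moreover have "eventually (\<lambda>e. \<forall>i\<in>{1..m}. \<forall>s\<in>{1..n}. move t e i \<noteq> z s) (at 0)"
  proof (intro eventually_ball_finite finite_atLeastAtMost ballI)
    fix i s assume "i \<in> {1..m}"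
    then show "eventually (\<lambda>e. move t e i \<noteq> z s) (at 0)"
      using eventually_line_ne[of "t i" "z s" "of_nat i" 0] by (simp add: move_def)
  qed
  ultimately show ?thesis
    by eventually_elim (auto simp: off_diagonals_def inj_on_def)
qed

text \<open>The denominator is continuous and non-zero at the point, so the regular value is a limit
  of honest values of \<open>f\<close>, taken separately at every \<open>\<phi>\<close>. This gives
  uniqueness and carries identities off the diagonals over to the Bethe vector.\<close>

lemma regular_value_limit:
  assumes "regular_value m n T f t0 z w"
  shows "((\<lambda>e. f (move t0 e) z \<phi>) \<longlongrightarrow> w \<phi>) (at 0)"
proof -
  obtain q N p x where q: "q \<in> poly_functions m n" "q t0 z \<noteq> 0"
    and p: "\<And>k. k < N \<Longrightarrow> p k \<in> poly_functions m n"
    and eq: "\<And>t z. off_diagonals m n t z \<Longrightarrow> tensor_scale (q t z) (f t z) = (\<Sum>k<N::nat. tensor_scale (p k t z) (x k))"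
    and w: "w = tensor_scale (1 / q t0 z) (\<Sum>k<N. tensor_scale (p k t0 z) (x k))"
    using assms unfolding regular_value_def by blast
  have lim_q: "((\<lambda>e. q (move t0 e) z) \<longlongrightarrow> q t0 z) (at 0)"
    by (rule tendsto_poly_function[OF q(1) tendsto_move])
  have "((\<lambda>e. (\<Sum>k<N. p k (move t0 e) z * x k \<phi>) / q (move t0 e) z) \<longlongrightarrow> (\<Sum>k<N. p k t0 z * x k \<phi>) / q t0 z) (at 0)"
    using q(2) by (intro tendsto_intros lim_q tendsto_poly_function[OF p tendsto_move]) auto
  moreover have "eventually (\<lambda>e. (\<Sum>k<N. p k (move t0 e) z * x k \<phi>) / q (move t0 e) z = f (move t0 e) z \<phi>) (at 0)"
    using eventually_off_diagonals_move[of m n t0 z] tendsto_imp_eventually_ne[OF lim_q q(2)]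
  proof eventually_elim
    case (elim e)
    have "q (move t0 e) z * f (move t0 e) z \<phi> = (\<Sum>k<N. p k (move t0 e) z * x k \<phi>)"
      using fun_cong[OF eq[OF elim(1)], of \<phi>] by (simp add: tensor_sum_apply tensor_scale_def)
    then show ?case using elim(2) by (simp add: field_simps)
  qed
  ultimately have "((\<lambda>e. f (move t0 e) z \<phi>) \<longlongrightarrow> (\<Sum>k<N. p k t0 z * x k \<phi>) / q t0 z) (at 0)"
    by (rule Lim_transform_eventually)
  then show ?thesis by (simp add: w tensor_sum_apply tensor_scale_def)
qed

lemma regular_value_unique:
  assumes "regular_value m n T f t0 z w" "regular_value m n T f t0 z w'"
  shows "w = w'"
proof
  fix \<phi>
  show "w \<phi> = w' \<phi>"
    by (rule tendsto_unique[OF _ regular_value_limit[OF assms(1)] regular_value_limit[OF assms(2)]]) simp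
qed

lemma regular_value_mem:
  assumes "regular_value m n (tensor_space n sc V) f t0 z w"
  shows "w \<in> tensor_space n sc V"
proof -
  obtain N p x q where *: "\<forall>k<N::nat. p k \<in> poly_functions m n \<and> x k \<in> tensor_space n sc V"
    "w = tensor_scale (1 / q t0 z) (\<Sum>k<N. tensor_scale (p k t0 z) (x k))"
    using assms unfolding regular_value_def by blast
  then show ?thesis unfolding tensor_space_def
    by (auto intro!: tensor.span_scale tensor.span_sum)
qed

lemma pure_tensor_mem:
  assumes "\<And>s. s \<in> {1..n} \<Longrightarrow> u s \<in> V s"
  shows "pure_tensor n sc V u \<in> tensor_space n sc V"
proof -
  have "pure_tensor n sc V u = pure_tensor n sc V (restrict u {1..n})" by (rule pure_tensor_cong) simp
  moreover have "restrict u {1..n} \<in> (\<Pi>\<^sub>E s\<in>{1..n}. V s)" using assms by (simp add: restrict_PiE_iff)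
  ultimately show ?thesis unfolding tensor_space_def by (auto intro: tensor.span_base)
qed

lemma chain_fun_cong:
  "(\<And>a. a \<in> set xs \<Longrightarrow> t a = t' a) \<Longrightarrow> chain_fun t q xs = chain_fun t' q xs"
  by (induction xs rule: induct_list012) auto

section \<open>Cancellation of the apparent poles of the weight function\<close>

locale highest_weight_factors =
  fixes r n :: nat and \<Lambda> :: "nat \<Rightarrow> weight" and sc :: "complex \<Rightarrow> 'v::ab_group_add \<Rightarrow> 'v"
    and V :: "nat \<Rightarrow> 'v set" and \<rho> :: "nat \<Rightarrow> complex mat \<Rightarrow> 'v \<Rightarrow> 'v" and v :: "nat \<Rightarrow> 'v" and l :: "nat \<Rightarrow> nat"
  assumes irreducible: "s \<in> {1..n} \<Longrightarrow> irreducible_module r sc (V s) (\<rho> s)"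
    and highest_weight: "s \<in> {1..n} \<Longrightarrow> highest_weight_vector r sc (V s) (\<rho> s) (\<Lambda> s) (v s)"
begin

abbreviation m :: nat where "m \<equiv> var_count r l"
abbreviation c :: "nat \<Rightarrow> nat" where "c \<equiv> color r l"

text \<open>It depends only on the colours of \<open>B\<close>, and commuting \<open>F\<close>s
  identify further arrangements. Poles cancel among arrangements with the same vector.\<close>

definition F_tensor :: "(nat \<Rightarrow> nat list) \<Rightarrow> 'v tensor" where
  "F_tensor B = pure_tensor n sc V (\<lambda>s. F_monomial r (\<rho> s) (map c (B s)) (v s))"

lemma sl_rep_factor: "s \<in> {1..n} \<Longrightarrow> sl_rep sc r (V s) (\<rho> s)"
proof -
  assume "s \<in> {1..n}"
  then have M: "sl_module r sc (V s) (\<rho> s)" using irreducible unfolding irreducible_module_def by blast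
  then have "vector_space sc" unfolding sl_module_def by (rule conjunct1)
  then show ?thesis using M by (intro sl_rep.intro sl_rep_axioms.intro)
qed

lemma singular_factor: "s \<in> {1..n} \<Longrightarrow> sl_rep.singular sc r (V s) (\<rho> s) (\<Lambda> s) (v s)"
  and factor_nonzero: "s \<in> {1..n} \<Longrightarrow> v s \<noteq> 0"
  and factor_mem: "s \<in> {1..n} \<Longrightarrow> v s \<in> V s"
  using highest_weight[of s] sl_rep.singular_def[OF sl_rep_factor, of s]
  by (auto simp: highest_weight_vector_def weight_space_def)

lemma color_range: "a \<in> {1..m} \<Longrightarrow> c a \<in> {1..r}"
  using color_spec[of r l] by blast

lemma color_block: "B \<in> arrangements n {1..m} \<Longrightarrow> s \<in> {1..n} \<Longrightarrow> set (map c (B s)) \<subseteq> {1..r}"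
  using arrangementsD(2)[of B n "{1..m}" s] color_range by fastforce

lemma F_tensor_factor_mem:
  assumes "B \<in> arrangements n {1..m}" "s \<in> {1..n}"
  shows "F_monomial r (\<rho> s) (map c (B s)) (v s) \<in> V s"
  by (rule sl_rep.F_monomial_closed[OF sl_rep_factor[OF assms(2)] factor_mem[OF assms(2)] color_block[OF assms]])

lemma F_tensor_mem: "B \<in> arrangements n {1..m} \<Longrightarrow> F_tensor B \<in> tensor_space n sc V"
  unfolding F_tensor_def by (rule pure_tensor_mem) (rule F_tensor_factor_mem)

lemma weight_function_nodes:
  "weight_function r n sc V \<rho> v l t z =
    (\<Sum>B\<in>arrangements n {1..m}. tensor_scale (chain_prod m n (nodes m t z) B) (F_tensor B))"
  unfolding weight_function_arrangements F_tensor_def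
proof (rule sum.cong[OF refl])
  fix B assume B: "B \<in> arrangements n {1..m}"
  have "(\<Prod>s=1..n. chain_fun t (z s) (B s)) = chain_prod m n (nodes m t z) B"
    unfolding chain_prod_def
  proof (rule prod.cong[OF refl])
    fix s assume s: "s \<in> {1..n}"
    have "nodes m t z (m + s) = z s" using s by (simp add: nodes_def)
    moreover have "t a = nodes m t z a" if "a \<in> set (B s)" for a
      using arrangementsD(2)[OF B s] that by (auto simp: nodes_def)
    ultimately show "chain_fun t (z s) (B s) = chain_fun (nodes m t z) (nodes m t z (m + s)) (B s)"
      using chain_fun_cong[of "B s" t "nodes m t z" "z s"] by simp
  qed
  then show "tensor_scale (\<Prod>s=1..n. chain_fun t (z s) (B s))
      (pure_tensor n sc V (\<lambda>s. F_monomial r (\<rho> s) (map c (B s)) (v s))) =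
    tensor_scale (chain_prod m n (nodes m t z) B) (pure_tensor n sc V (\<lambda>s. F_monomial r (\<rho> s) (map c (B s)) (v s)))"
    by simp
qed

lemma F_F_commute:
  assumes s: "s \<in> {1..n}" and ij: "i \<in> {1..r}" "j \<in> {1..r}" "i \<noteq> j + 1" "j \<noteq> i + 1" and w: "w \<in> V s"
  shows "\<rho> s (chev_F r i) (\<rho> s (chev_F r j) w) = \<rho> s (chev_F r j) (\<rho> s (chev_F r i) w)"
proof -
  interpret S: sl_rep sc r "V s" "\<rho> s" by (rule sl_rep_factor[OF s])
  have "chev_F r i * chev_F r j - chev_F r j * chev_F r i = 0\<^sub>m (r + 1) (r + 1)"
    unfolding chev_F_def using ij by (simp add: unit_mat_mult)
  then show ?thesis
    using S.commutator_act[OF chev_sl(2)[OF ij(1)] chev_sl(2)[OF ij(2)] w] S.zero_act[OF w] by simp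
qed

text \<open>Adjacent labels are neighbours in one list, so the exchange swaps two neighbouring
  \<open>F\<close>s in one factor of the tensor product. They commute because their nodes are not
  joined in the Dynkin diagram.\<close>

lemma F_tensor_swap:
  assumes B: "B \<in> arrangements n {1..m}" and ab: "a \<in> {1..m}" "b \<in> {1..m}" "adjacent m n a b B"
    and col: "c a \<noteq> c b + 1" "c b \<noteq> c a + 1"
  shows "F_tensor (\<lambda>k\<in>{1..n}. map (Transposition.transpose a b) (B k)) = F_tensor B"
proof -
  let ?\<tau> = "Transposition.transpose a b"
  have main: ?thesis if k: "k \<in> {1..n}" and Bk: "B k = ys @ p # q # zs" and pq: "{p, q} = {a, b}" for k ys zs p q
    unfolding F_tensor_def
  proof (rule pure_tensor_cong)
    fix s assume s: "s \<in> {1..n}"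
    interpret S: sl_rep sc r "V s" "\<rho> s" by (rule sl_rep_factor[OF s])
    have fixed: "map ?\<tau> xs = xs" if "a \<notin> set xs" "b \<notin> set xs" for xs
      using that by (intro map_idI) (metis transpose_apply_other)
    have abk: "a \<in> set (B k)" "b \<in> set (B k)" using Bk pq by (auto simp: doubleton_eq_iff)
    show "F_monomial r (\<rho> s) (map c ((\<lambda>k\<in>{1..n}. map ?\<tau> (B k)) s)) (v s) = F_monomial r (\<rho> s) (map c (B s)) (v s)"
    proof (cases "s = k")
      case False
      then have "a \<notin> set (B s)" "b \<notin> set (B s)" using arrangementsD(3)[OF B _ _ s k] abk by blast+
      then have "map ?\<tau> (B s) = B s" by (rule fixed)
      then show ?thesis using s by simp
    next
      case True
      have d: "distinct (ys @ p # q # zs)" using arrangementsD(1)[OF B k] Bk by simp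
      have yz: "map ?\<tau> ys = ys" "map ?\<tau> zs = zs" using d pq by (auto intro!: fixed simp: doubleton_eq_iff)
      have tpq: "?\<tau> p = q" "?\<tau> q = p" using pq by (auto simp: doubleton_eq_iff)
      have cpq: "c p \<in> {1..r}" "c q \<in> {1..r}" "c p \<noteq> c q + 1" "c q \<noteq> c p + 1"
        using pq col ab color_range by (auto simp: doubleton_eq_iff)
      have zs: "F_monomial r (\<rho> s) (map c zs) (v s) \<in> V s"
        using color_block[OF B s] Bk True by (intro S.F_monomial_closed factor_mem s) auto
      have app: "F_monomial r (\<rho> k) (xs @ i # j # xs') w =
          F_monomial r (\<rho> k) xs (\<rho> k (chev_F r i) (\<rho> k (chev_F r j) (F_monomial r (\<rho> k) xs' w)))" for xs i j xs' w
        by (simp add: F_monomial_def)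
      show ?thesis
        using s True Bk yz tpq F_F_commute[OF s cpq zs] by (simp add: app)
    qed
  qed
  consider "successor m n B a = b" | "successor m n B b = a" using ab(3) by (auto simp: adjacent_def)
  then show ?thesis
  proof cases
    case 1
    show ?thesis
    proof (rule successor_cases[OF B ab(1), where m = m])
      fix k assume "k \<in> {1..n}" "successor m n B a = m + k"
      then show ?thesis using 1 ab(2) by simp
    next
      fix k ys zs assume "k \<in> {1..n}" "B k = ys @ a # successor m n B a # zs"
      then show ?thesis using 1 by (intro main[of k ys a b zs]) auto
    qed
  next
    case 2
    show ?thesis
    proof (rule successor_cases[OF B ab(2), where m = m])
      fix k assume "k \<in> {1..n}" "successor m n B b = m + k"
      then show ?thesis using 2 ab(1) by simp
    next
      fix k ys zs assume "k \<in> {1..n}" "B k = ys @ b # successor m n B b # zs"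
      then show ?thesis using 2 by (intro main[of k ys b a zs]) auto
    qed
  qed
qed

lemma pure_tensor_zero:
  assumes u: "\<And>s. s \<in> {1..n} \<Longrightarrow> u s \<in> V s" and k: "k \<in> {1..n}" "u k = 0"
  shows "pure_tensor n sc V u = 0"
proof
  fix \<phi> :: "(nat \<Rightarrow> 'v) \<Rightarrow> complex"
  interpret S: sl_rep sc r "V k" "\<rho> k" by (rule sl_rep_factor[OF k(1)])
  let ?u = "restrict u {1..n}"
  show "pure_tensor n sc V u \<phi> = 0 \<phi>"
  proof (cases "multilinear_form n sc V \<phi>")
    case True
    have mem: "?u \<in> (\<Pi>\<^sub>E s\<in>{1..n}. V s)" using u by (simp add: restrict_PiE_iff)
    have "\<phi> (?u(k := sc 0 0)) = 0 * \<phi> (?u(k := 0))"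
      using True mem k(1) S.subspace_0[OF S.subspace_V] unfolding multilinear_form_def by blast
    moreover have "?u(k := sc 0 0) = ?u" using k by (auto simp: fun_eq_iff)
    ultimately show ?thesis by (simp add: pure_tensor_def)
  qed (simp add: pure_tensor_def)
qed

text \<open>\<open>a\<close> is the last label of list \<open>k\<close>, so its \<open>F\<close>
  acts directly on \<open>v k\<close> and kills it.\<close>

lemma F_tensor_last_zero:
  assumes B: "B \<in> arrangements n {1..m}" and a: "a \<in> {1..m}" and k: "k \<in> {1..n}" "successor m n B a = m + k"
    and \<Lambda>: "\<Lambda> k (chev_H r (c a)) = 0"
  shows "F_tensor B = 0"
proof -
  obtain ys where ys: "B k = ys @ [a]"
  proof (rule successor_cases[OF B a, where m = m])
    fix j ys assume "j \<in> {1..n}" "B j = ys @ [a]" "successor m n B a = m + j"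
    then show thesis using that k by auto
  next
    fix j ys zs assume j: "j \<in> {1..n}" "B j = ys @ a # successor m n B a # zs"
    then have "successor m n B a \<in> {1..m}" using arrangementsD(2)[OF B j(1)] by auto
    then show thesis using k by auto
  qed
  interpret S: sl_rep sc r "V k" "\<rho> k" by (rule sl_rep_factor[OF k(1)])
  have 0: "\<rho> k (chev_F r (c a)) (v k) = 0"
    by (rule S.F_singular_eq_0[OF irreducible[OF k(1)] singular_factor[OF k(1)] factor_nonzero[OF k(1)] color_range[OF a] \<Lambda>])
  have zero: "F_monomial r (\<rho> k) J 0 = 0" if "set J \<subseteq> {1..r}" for J
    using that by (induction J) (simp_all add: S.F_monomial_Nil S.F_monomial_Cons S.act_zero chev_sl)
  have "F_monomial r (\<rho> k) (map c (B k)) (v k) = F_monomial r (\<rho> k) (map c ys) (\<rho> k (chev_F r (c a)) (v k))"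
    unfolding ys by (simp add: F_monomial_def)
  also have "\<dots> = 0" unfolding 0 using color_block[OF B k(1)] ys by (intro zero) auto
  finally have "F_monomial r (\<rho> k) (map c (B k)) (v k) = 0" .
  then show ?thesis unfolding F_tensor_def using F_tensor_factor_mem[OF B] k(1)
    by (intro pure_tensor_zero[where k = k]) auto
qed

text \<open>The arrangements are grouped by the vector \<open>F_tensor B\<close>, and those with
  vector 0 are dropped. Exchanging two adjacent labels with equal coordinates stays within a group,
  so the coefficient of every remaining vector is regular at the point. The product of the
  denominators of these coefficients is a common denominator.\<close>

lemma regular_value_exists:
  assumes L: "\<And>a b. a \<in> {1..m} \<Longrightarrow> b \<in> {1..m} \<Longrightarrow> a \<noteq> b \<Longrightarrow> t0 a = t0 b \<Longrightarrow> c a \<noteq> c b + 1 \<and> c b \<noteq> c a + 1"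
    and R: "\<And>a k. a \<in> {1..m} \<Longrightarrow> k \<in> {1..n} \<Longrightarrow> t0 a = z k \<Longrightarrow> \<Lambda> k (chev_H r (c a)) = 0"
  shows "\<exists>w. regular_value m n (tensor_space n sc V) (weight_function r n sc V \<rho> v l) t0 z w"
proof -
  let ?A = "arrangements n {1..m}"
  define X where "X = F_tensor ` ?A - {0}"
  define S where "S y = {B \<in> ?A. F_tensor B = y}" for y
  have finA: "finite ?A" by (simp add: finite_arrangements)
  then have finX: "finite X" by (simp add: X_def)
  have "\<exists>q p. q \<in> node_polys (m + n) \<and> p \<in> node_polys (m + n) \<and> q (nodes m t0 z) \<noteq> 0 \<and>
      (\<forall>x. generic m n x \<longrightarrow> q x * (\<Sum>B\<in>S y. chain_prod m n x B) = p x)" if y: "y \<in> X" for y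
  proof -
    have rat: "rational_function m n (\<lambda>x. \<Sum>B\<in>S y. chain_prod m n x B)"
      by (intro rational_function_sum rational_function_chain_prod) (simp add: S_def)
    have np: "no_pole (m + n) a b (\<lambda>x. \<Sum>B\<in>S y. chain_prod m n x B)"
      if ab: "(a, b) \<in> edge_pairs m n" and eq: "nodes m t0 z a = nodes m t0 z b" for a b
    proof (rule no_pole_chain_sum[OF ab])
      show "S y \<subseteq> ?A" by (auto simp: S_def)
      fix B assume B: "B \<in> S y" and adj: "adjacent m n a b B"
      have a: "a \<in> {1..m}" and ne: "a \<noteq> b" using ab by (auto simp: edge_pairs_def)
      have arr: "B \<in> ?A" and By: "F_tensor B = y" using B by (auto simp: S_def)
      \<comment> \<open>If \<open>b\<close> were a root, the vector of the arrangement would be 0,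
        and such arrangements are not in the group.\<close>
      have b: "b \<in> {1..m}"
      proof (rule ccontr)
        assume nb: "b \<notin> {1..m}"
        then have "b - m \<in> {1..n}" "b = m + (b - m)" using ab by (auto simp: edge_pairs_def)
        then obtain k where k: "k \<in> {1..n}" "b = m + k" by blast
        have "successor m n B a = m + k" using adj nb k by (simp add: adjacent_def)
        moreover have "t0 a = z k" using eq a k by (simp add: nodes_def)
        ultimately have "F_tensor B = 0" using F_tensor_last_zero[OF arr a k(1)] R[OF a k(1)] by blast
        then show False using By y by (simp add: X_def)
      qed
      have "t0 a = t0 b" using eq a b by (simp add: nodes_def)
      then have "F_tensor (\<lambda>k\<in>{1..n}. map (Transposition.transpose a b) (B k)) = F_tensor B"
        using L[OF a b ne] by (intro F_tensor_swap[OF arr a b adj]) auto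
      then show "b \<in> {1..m} \<and> (\<lambda>k\<in>{1..n}. map (Transposition.transpose a b) (B k)) \<in> S y"
        using b By arrangements_permute[OF arr permutes_swap_id[OF a b]] by (simp add: S_def)
    qed
    show ?thesis
    proof (rule regular_at[OF rat, where ?x0.0 = "nodes m t0 z"])
      fix a b assume "(a, b) \<in> edge_pairs m n" "nodes m t0 z a = nodes m t0 z b"
      then show "no_pole (m + n) a b (\<lambda>x. \<Sum>B\<in>S y. chain_prod m n x B)" by (rule np)
    next
      fix q p assume "q \<in> node_polys (m + n)" "p \<in> node_polys (m + n)" "q (nodes m t0 z) \<noteq> 0"
        "\<And>x. generic m n x \<Longrightarrow> q x * (\<Sum>B\<in>S y. chain_prod m n x B) = p x"
      then show ?thesis by blast
    qed
  qed
  then obtain q p where qp: "\<And>y. y \<in> X \<Longrightarrow> q y \<in> node_polys (m + n)" "\<And>y. y \<in> X \<Longrightarrow> p y \<in> node_polys (m + n)"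
    "\<And>y. y \<in> X \<Longrightarrow> q y (nodes m t0 z) \<noteq> 0"
    "\<And>y x. y \<in> X \<Longrightarrow> generic m n x \<Longrightarrow> q y x * (\<Sum>B\<in>S y. chain_prod m n x B) = p y x" by metis
  obtain g where g: "bij_betw g {..<card X} X"
    using ex_bij_betw_nat_finite[OF finX] by (auto simp: atLeast0LessThan)
  have gX: "g k \<in> X" if "k < card X" for k using g that by (auto simp: bij_betw_def)
  define Q where "Q t z' = (\<Prod>y\<in>X. q y (nodes m t z'))" for t z'
  define P where "P k t z' = p (g k) (nodes m t z') * (\<Prod>y\<in>X - {g k}. q y (nodes m t z'))" for k t z'
  have "Q \<in> poly_functions m n"
    unfolding Q_def using qp(1) by (intro poly_functions_prod node_polys_poly_functions)
  moreover have "Q t0 z \<noteq> 0" using qp(3) finX by (simp add: Q_def)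
  moreover have "P k \<in> poly_functions m n \<and> g k \<in> tensor_space n sc V" if "k < card X" for k
  proof
    show "P k \<in> poly_functions m n"
      unfolding P_def using qp(1,2) gX[OF that]
      by (intro poly_functions.mult poly_functions_prod node_polys_poly_functions) auto
    show "g k \<in> tensor_space n sc V" using gX[OF that] F_tensor_mem by (auto simp: X_def)
  qed
  moreover have "tensor_scale (Q t z') (weight_function r n sc V \<rho> v l t z') = (\<Sum>k<card X. tensor_scale (P k t z') (g k))"
    if od: "off_diagonals m n t z'" for t z'
  proof -
    let ?x = "nodes m t z'"
    have gen: "generic m n ?x" using od by (simp add: generic_nodes)
    have "weight_function r n sc V \<rho> v l t z' =
        (\<Sum>y\<in>F_tensor ` ?A. \<Sum>B\<in>{B \<in> ?A. F_tensor B = y}. tensor_scale (chain_prod m n ?x B) (F_tensor B))"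
      unfolding weight_function_nodes by (rule sum.group[symmetric]) (use finA in auto)
    also have "\<dots> = (\<Sum>y\<in>F_tensor ` ?A. tensor_scale (\<Sum>B\<in>S y. chain_prod m n ?x B) y)"
      unfolding S_def tensor.scale_sum_left by (intro sum.cong refl) auto
    also have "\<dots> = (\<Sum>y\<in>X. tensor_scale (\<Sum>B\<in>S y. chain_prod m n ?x B) y)"
      unfolding X_def using finA by (intro sum.mono_neutral_right) auto
    also have "\<dots> = (\<Sum>k<card X. tensor_scale (\<Sum>B\<in>S (g k). chain_prod m n ?x B) (g k))"
      by (rule sum.reindex_bij_betw[OF g, symmetric])
    finally have "tensor_scale (Q t z') (weight_function r n sc V \<rho> v l t z') =
        (\<Sum>k<card X. tensor_scale (Q t z' * (\<Sum>B\<in>S (g k). chain_prod m n ?x B)) (g k))"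
      by (simp add: tensor.scale_sum_right)
    also have "\<dots> = (\<Sum>k<card X. tensor_scale (P k t z') (g k))"
    proof (rule sum.cong[OF refl])
      fix k assume "k \<in> {..<card X}"
      then have k: "g k \<in> X" using gX by simp
      have "Q t z' = q (g k) ?x * (\<Prod>y\<in>X - {g k}. q y ?x)"
        unfolding Q_def by (rule prod.remove[OF finX k])
      then have "Q t z' * (\<Sum>B\<in>S (g k). chain_prod m n ?x B) = P k t z'"
        using qp(4)[OF k gen] by (simp add: P_def mult_ac)
      then show "tensor_scale (Q t z' * (\<Sum>B\<in>S (g k). chain_prod m n ?x B)) (g k) = tensor_scale (P k t z') (g k)"
        by simp
    qed
    finally show ?thesis .
  qed
  ultimately have "regular_value m n (tensor_space n sc V) (weight_function r n sc V \<rho> v l) t0 z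
      (tensor_scale (1 / Q t0 z) (\<Sum>k<card X. tensor_scale (P k t0 z) (g k)))"
    unfolding regular_value_def
    by (intro bexI[of _ Q] exI[of _ "card X"] exI[of _ P] exI[of _ g]) auto
  then show ?thesis by blast
qed

end

section \<open>The Hessian of the master function\<close>

lemma proj_unit_cartan:
  assumes "a \<in> {1..r + 1}"
  shows "proj_unit r a \<in> cartan r"
proof -
  have "(\<Sum>b<r + 1. proj_unit r a $$ (b, b)) = (\<Sum>b<r + 1. (if b = a - 1 then 1 else 0) - 1 / of_nat (r + 1))"
    using assms by (intro sum.cong refl) (auto simp: proj_unit_def unit_mat_def)
  also have "\<dots> = 1 - of_nat (r + 1) * (1 / of_nat (r + 1))"
    unfolding sum_subtractf sum_constant using assms by (subst sum.delta) auto
  also have "\<dots> = (0::complex)" by (simp del: of_nat_Suc of_nat_add)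
  finally have "(\<Sum>b<r + 1. proj_unit r a $$ (b, b)) = 0" .
  then show ?thesis
    unfolding cartan_def sl_def by (auto simp: proj_unit_def diagonal_mat_def unit_mat_def)
qed

text \<open>The scalar parts of two consecutive \<open>proj_unit\<close> cancel in their difference,
  which is \<open>H_i\<close>. So the exponents of the master function are the numbers produced by
  commutators of \<open>E_i\<close> and \<open>F_i\<close>.\<close>

lemma weight_form_coroot:
  assumes \<mu>: "is_weight r \<mu>" and i: "i \<in> {1..r}"
  shows "weight_form r (simple_root i) \<mu> = \<mu> (chev_H r i)"
proof -
  have "weight_form r (simple_root i) \<mu> = (\<Sum>a = 1..r + 1. ((if a = i then 1 else 0) - (if a = i + 1 then 1 else 0)) * \<mu> (proj_unit r a))"
    unfolding weight_form_def using i by (intro sum.cong refl) (simp add: simple_root_proj_unit)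
  also have "\<dots> = (\<Sum>a = 1..r + 1. (if a = i then \<mu> (proj_unit r a) else 0) - (if a = i + 1 then \<mu> (proj_unit r a) else 0))"
    by (intro sum.cong) auto
  also have "\<dots> = \<mu> (proj_unit r i) - \<mu> (proj_unit r (i + 1))"
    unfolding sum_subtractf using i by (subst (1 2) sum.delta) auto
  finally have 1: "weight_form r (simple_root i) \<mu> = \<mu> (proj_unit r i) - \<mu> (proj_unit r (i + 1))" .
  have H: "chev_H r i \<in> cartan r" and P: "proj_unit r (i + 1) \<in> cartan r"
    using i by (auto intro!: chev_H_cartan proj_unit_cartan)
  have "proj_unit r i = chev_H r i + proj_unit r (i + 1)"
    by (rule eq_matI) (auto simp: proj_unit_def chev_H_def unit_mat_def)
  then have "\<mu> (proj_unit r i) = \<mu> (chev_H r i) + \<mu> (proj_unit r (i + 1))"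
    using \<mu> H P by (simp add: is_weight_def)
  with 1 show ?thesis by simp
qed

lemma is_weight_simple_root:
  assumes "i \<in> {1..r}"
  shows "is_weight r (simple_root i)"
  using assms unfolding is_weight_def
  by (auto simp: simple_root_def cartan_def sl_def algebra_simps)

text \<open>A logarithmic derivative without a choice of logarithm: \<open>d\<close> is the quotient
  of the derivative by \<open>f\<close>. Non-vanishing is part of the notion, which makes it
  additive over products.\<close>

definition log_derivative :: "(complex \<Rightarrow> complex) \<Rightarrow> complex \<Rightarrow> complex \<Rightarrow> bool" where
  "log_derivative f d y \<longleftrightarrow> f y \<noteq> 0 \<and> (f has_field_derivative d * f y) (at y)"

lemma log_derivative_const: "k \<noteq> 0 \<Longrightarrow> log_derivative (\<lambda>y. k) 0 y"
  by (simp add: log_derivative_def)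

lemma log_derivative_mult:
  assumes "log_derivative f d y" "log_derivative g d' y"
  shows "log_derivative (\<lambda>y. f y * g y) (d + d') y"
proof -
  have "((\<lambda>y. f y * g y) has_field_derivative (d * f y * g y + d' * g y * f y)) (at y)"
    using assms by (intro DERIV_mult) (auto simp: log_derivative_def)
  moreover have "d * f y * g y + d' * g y * f y = (d + d') * (f y * g y)" by (simp add: algebra_simps)
  ultimately show ?thesis using assms by (simp add: log_derivative_def)
qed

lemma log_derivative_prod:
  assumes "finite A" "\<And>i. i \<in> A \<Longrightarrow> log_derivative (f i) (d i) y"
  shows "log_derivative (\<lambda>y. \<Prod>i\<in>A. f i y) (\<Sum>i\<in>A. d i) y"
  using assms
proof (induction A)
  case empty
  show ?case using log_derivative_const[of 1 y] by simp
next
  case (insert i A)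
  then have "log_derivative (\<lambda>y. f i y * (\<Prod>i\<in>A. f i y)) (d i + (\<Sum>i\<in>A. d i)) y"
    by (intro log_derivative_mult) auto
  with insert show ?case by simp
qed

lemma power_factor_powi: "e = of_int k \<Longrightarrow> power_factor x e = x powi k"
  by (cases "k = 0") (simp_all add: power_factor_def complex_powr_of_int)

text \<open>An integral exponent turns \<open>powr\<close> into an integer power. For exponent 0 the
  factor is constantly 1 whatever its base, and the stated derivative is 0 even where
  \<open>g y = 0\<close>.\<close>

lemma log_derivative_power_factor:
  assumes e: "e \<in> \<int>" and g: "(g has_field_derivative d) (at y)" and ne: "e \<noteq> 0 \<Longrightarrow> g y \<noteq> 0"
  shows "log_derivative (\<lambda>y. power_factor (g y) e) (e * d / g y) y"
proof -
  obtain k where k: "e = of_int k" using e by (elim Ints_cases)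
  show ?thesis
  proof (cases "k = 0")
    case True
    then show ?thesis using log_derivative_const[of 1 y] k by (simp add: power_factor_def)
  next
    case False
    then have gy: "g y \<noteq> 0" using ne k by simp
    have "((\<lambda>y. g y powi k) has_field_derivative (of_int k * g y powi (k - 1) * d)) (at y)"
      using g gy by (intro DERIV_power_int) auto
    moreover have "of_int k * g y powi (k - 1) * d = e * d / g y * g y powi k"
      using gy k power_int_diff[of "g y" k 1] by simp
    ultimately show ?thesis
      using gy unfolding log_derivative_def power_factor_powi[OF k] by simp
  qed
qed

context highest_weight_factors
begin

text \<open>The negated exponents of the master function. With these signs they are also the
  contributions in the pairing of monomials: plus the value of a highest weight, minus that of a
  simple root.\<close>

definition coupling :: "nat \<Rightarrow> nat \<Rightarrow> complex" where
  "coupling a q = (if q \<le> m then - weight_form r (simple_root (c a)) (simple_root (c q))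
     else weight_form r (simple_root (c a)) (\<Lambda> (q - m)))"

definition admissible :: "(nat \<Rightarrow> complex) \<Rightarrow> bool" where
  "admissible x \<longleftrightarrow> (\<forall>(a, q)\<in>edge_pairs m n. coupling a q \<noteq> 0 \<longrightarrow> x a \<noteq> x q)"

text \<open>The \<open>a\<close>-th partial derivative of the logarithm of the master function. The
  term \<open>q = a\<close> has denominator 0 and so counts as 0, as do all terms with zero
  coupling.\<close>

definition gradient :: "nat \<Rightarrow> (nat \<Rightarrow> complex) \<Rightarrow> complex" where
  "gradient a x = - (\<Sum>q\<in>{1..m + n}. coupling a q / (x a - x q))"

lemma sum_node_split: "(\<Sum>q\<in>{1..m + n}. f q) = (\<Sum>q\<in>{1..m}. f q) + (\<Sum>s\<in>{1..n}. f (m + s))"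
proof -
  have "(\<Sum>q\<in>{1..m + n}. f q) = (\<Sum>q\<in>{1..m}. f q) + (\<Sum>q\<in>{m + 1..m + n}. f q)"
    by (rule sum.ub_add_nat) simp
  also have "(\<Sum>q\<in>{m + 1..m + n}. f q) = (\<Sum>s\<in>{1..n}. f (m + s))"
    using sum.shift_bounds_cl_nat_ivl[of f 1 m n] by (simp add: add.commute)
  finally show ?thesis .
qed

lemma coupling_int:
  assumes dom: "\<And>s. s \<in> {1..n} \<Longrightarrow> integral_dominant r (\<Lambda> s)" and a: "a \<in> {1..m}" and q: "q \<in> {1..m + n}"
  shows "coupling a q \<in> \<int>"
proof (cases "q \<le> m")
  case True
  then show ?thesis
    using weight_form_simple_root[OF color_range[OF a] color_range[of q]] q by (simp add: coupling_def)
next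
  case False
  then have s: "q - m \<in> {1..n}" using q by auto
  have "weight_form r (simple_root (c a)) (\<Lambda> (q - m)) \<in> \<nat>"
    using dom[OF s] weight_form_coroot[OF _ color_range[OF a]] color_range[OF a]
    unfolding integral_dominant_def by simp
  then show ?thesis using False Nats_subset_Ints by (auto simp: coupling_def)
qed

lemma critical_point_iff:
  "critical_point r n \<Lambda> l z t \<longleftrightarrow> admissible (nodes m t z) \<and> (\<forall>a\<in>{1..m}. gradient a (nodes m t z) = 0)"
proof -
  let ?x = "nodes m t z"
  have xL: "?x a = t a" if "a \<in> {1..m}" for a using that by (simp add: nodes_def)
  have xR: "?x (m + s) = z s" if "s \<in> {1..n}" for s using that by (simp add: nodes_def)
  have cR: "coupling a (m + s) = weight_form r (simple_root (c a)) (\<Lambda> s)" if "s \<in> {1..n}" for a s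
    using that by (simp add: coupling_def)
  have cL: "coupling a b = - weight_form r (simple_root (c a)) (simple_root (c b))" if "b \<in> {1..m}" for a b
    using that by (simp add: coupling_def)
  have grad: "gradient a ?x = - (\<Sum>s = 1..n. weight_form r (simple_root (c a)) (\<Lambda> s) / (t a - z s)) +
          (\<Sum>j\<in>{1..m} - {a}. weight_form r (simple_root (c a)) (simple_root (c j)) / (t a - t j))"
    if a: "a \<in> {1..m}" for a
  proof -
    have "(\<Sum>q\<in>{1..m}. coupling a q / (?x a - ?x q)) = (\<Sum>q\<in>{1..m} - {a}. coupling a q / (?x a - ?x q))"
      using a by (subst sum.remove[of _ a]) auto
    also have "\<dots> = - (\<Sum>j\<in>{1..m} - {a}. weight_form r (simple_root (c a)) (simple_root (c j)) / (t a - t j))"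
      unfolding sum_negf[symmetric]
    proof (rule sum.cong[OF refl])
      fix j assume "j \<in> {1..m} - {a}"
      then have j: "j \<in> {1..m}" by blast
      show "coupling a j / (?x a - ?x j) = - (weight_form r (simple_root (c a)) (simple_root (c j)) / (t a - t j))"
        unfolding xL[OF a] xL[OF j] cL[OF j] by simp
    qed
    finally have 1: "(\<Sum>q\<in>{1..m}. coupling a q / (?x a - ?x q)) =
       - (\<Sum>j\<in>{1..m} - {a}. weight_form r (simple_root (c a)) (simple_root (c j)) / (t a - t j))" .
    have 2: "(\<Sum>s\<in>{1..n}. coupling a (m + s) / (?x a - ?x (m + s))) =
       (\<Sum>s = 1..n. weight_form r (simple_root (c a)) (\<Lambda> s) / (t a - z s))"
      by (intro sum.cong refl) (simp only: xL[OF a] xR cR)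
    show ?thesis unfolding gradient_def sum_node_split 1 2 by simp
  qed
  have adm: "admissible ?x \<longleftrightarrow> (\<forall>a\<in>{1..m}.
      (\<forall>s\<in>{1..n}. weight_form r (simple_root (c a)) (\<Lambda> s) \<noteq> 0 \<longrightarrow> t a \<noteq> z s) \<and>
      (\<forall>j\<in>{1..m} - {a}. weight_form r (simple_root (c a)) (simple_root (c j)) \<noteq> 0 \<longrightarrow> t a \<noteq> t j))"
  proof (intro iffI ballI conjI impI)
    fix a s assume *: "admissible ?x" "a \<in> {1..m}" "s \<in> {1..n}" "weight_form r (simple_root (c a)) (\<Lambda> s) \<noteq> 0"
    have "(a, m + s) \<in> edge_pairs m n" using *(2,3) by (auto simp: edge_pairs_def)
    then show "t a \<noteq> z s" using *(1,4) cR[OF *(3), of a] xL[OF *(2)] xR[OF *(3)] unfolding admissible_def by auto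
  next
    fix a j assume *: "admissible ?x" "a \<in> {1..m}" "j \<in> {1..m} - {a}" "weight_form r (simple_root (c a)) (simple_root (c j)) \<noteq> 0"
    have j: "j \<in> {1..m}" using *(3) by blast
    have "(a, j) \<in> edge_pairs m n" using *(2,3) by (auto simp: edge_pairs_def)
    then show "t a \<noteq> t j" using *(1,4) cL[OF j, of a] xL[OF *(2)] xL[OF j] unfolding admissible_def by auto
  next
    assume *: "\<forall>a\<in>{1..m}.
      (\<forall>s\<in>{1..n}. weight_form r (simple_root (c a)) (\<Lambda> s) \<noteq> 0 \<longrightarrow> t a \<noteq> z s) \<and>
      (\<forall>j\<in>{1..m} - {a}. weight_form r (simple_root (c a)) (simple_root (c j)) \<noteq> 0 \<longrightarrow> t a \<noteq> t j)"
    show "admissible ?x"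
      unfolding admissible_def
    proof (intro ballI, unfold split_paired_all, clarify)
      fix a q assume e: "(a, q) \<in> edge_pairs m n" and k: "coupling a q \<noteq> 0" and eq: "?x a = ?x q"
      have a: "a \<in> {1..m}" and q: "q \<in> {1..m + n}" "a \<noteq> q" using e by (auto simp: edge_pairs_def)
      show False
      proof (cases "q \<le> m")
        case True
        then have q': "q \<in> {1..m}" using q by simp
        then show False using *[rule_format, OF a] k q(2) cL[OF q', of a] eq xL[OF a] xL[OF q'] by auto
      next
        case False
        then have s: "q - m \<in> {1..n}" "m + (q - m) = q" using q by auto
        then show False using *[rule_format, OF a] k cR[OF s(1), of a] eq xL[OF a] xR[OF s(1)] by auto
      qed
    qed
  qed
  show ?thesis unfolding critical_point_def adm using grad by auto
qed

lemma nodes_upd: "a \<in> {1..m} \<Longrightarrow> nodes m (t(a := y)) z = (nodes m t z)(a := y)"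
  by (auto simp: nodes_def fun_eq_iff)

text \<open>Logarithmic derivatives add over the factors, and only the factors containing
  \<open>t b\<close> contribute. The factor that depends on \<open>z\<close> alone is non-zero
  because the points are distinct.\<close>

lemma log_derivative_master_function:
  assumes dom: "\<And>s. s \<in> {1..n} \<Longrightarrow> integral_dominant r (\<Lambda> s)" and z: "inj_on z {1..n}"
    and adm: "admissible (nodes m t z)" and b: "b \<in> {1..m}"
  shows "log_derivative (\<lambda>y. master_function r n \<Lambda> l z (t(b := y))) (gradient b (nodes m t z)) (t b)"
proof -
  let ?x = "nodes m t z"
  define wR where "wR i s = weight_form r (simple_root (c i)) (\<Lambda> s)" for i s
  define wL where "wL i j = weight_form r (simple_root (c i)) (simple_root (c j))" for i j
  define dR where "dR i s = (if i = b then - wR i s / (t i - z s) else 0)" for i s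
  define dL where "dL i j = (if i = b then wL i j / (t i - t j) else if j = b then wL i j / (t j - t i) else 0)" for i j
  have edgeR: "(i, m + s) \<in> edge_pairs m n" if "i \<in> {1..m}" "s \<in> {1..n}" for i s
    using that by (auto simp: edge_pairs_def)
  have intR: "wR i s \<in> \<int>" if "i \<in> {1..m}" "s \<in> {1..n}" for i s
    using coupling_int[OF dom that(1), of "m + s"] that by (simp add: coupling_def wR_def)
  have intL: "wL i j \<in> \<int>" if "i \<in> {1..m}" "j \<in> {1..m}" for i j
    using coupling_int[OF dom that(1), of j] that by (simp add: coupling_def wL_def)
  have neR: "t i - z s \<noteq> 0" if "i \<in> {1..m}" "s \<in> {1..n}" "wR i s \<noteq> 0" for i s
  proof -
    have "coupling i (m + s) \<noteq> 0" using that by (simp add: coupling_def wR_def)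
    then have "?x i \<noteq> ?x (m + s)" using adm edgeR[OF that(1,2)] unfolding admissible_def by blast
    then show ?thesis using that by (simp add: nodes_def)
  qed
  have neL: "t i - t j \<noteq> 0" if "i \<in> {1..m}" "j \<in> {1..m}" "i \<noteq> j" "wL i j \<noteq> 0" for i j
  proof -
    have "coupling i j \<noteq> 0" "(i, j) \<in> edge_pairs m n" using that by (auto simp: coupling_def wL_def edge_pairs_def)
    then have "?x i \<noteq> ?x j" using adm unfolding admissible_def by blast
    then show ?thesis using that by (simp add: nodes_def)
  qed
  have dvar: "((\<lambda>y. (t(b := y)) i) has_field_derivative (if i = b then 1 else 0)) (at (t b))" for i
    by (cases "i = b") auto
  have R: "log_derivative (\<lambda>y. power_factor ((t(b := y)) i - z s) (- wR i s)) (dR i s) (t b)"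
    if "i \<in> {1..m}" "s \<in> {1..n}" for i s
  proof -
    have 1: "log_derivative (\<lambda>y. power_factor ((t(b := y)) i - z s) (- wR i s))
        (- wR i s * ((if i = b then 1 else 0) - 0) / ((t(b := t b)) i - z s)) (t b)"
      using neR[OF that] intR[OF that]
      by (intro log_derivative_power_factor DERIV_diff dvar DERIV_const) auto
    have 2: "- wR i s * ((if i = b then 1 else 0) - 0) / ((t(b := t b)) i - z s) = dR i s"
      by (simp add: dR_def)
    show ?thesis using 1 unfolding 2 .
  qed
  have L: "log_derivative (\<lambda>y. power_factor ((t(b := y)) i - (t(b := y)) j) (wL i j)) (dL i j) (t b)"
    if "i \<in> {1..m}" "j \<in> {i<..m}" for i j
  proof -
    have j: "j \<in> {1..m}" "i \<noteq> j" using that by auto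
    have 1: "log_derivative (\<lambda>y. power_factor ((t(b := y)) i - (t(b := y)) j) (wL i j))
        (wL i j * ((if i = b then 1 else 0) - (if j = b then 1 else 0)) / ((t(b := t b)) i - (t(b := t b)) j)) (t b)"
      using neL[OF that(1) j] intL[OF that(1) j(1)]
      by (intro log_derivative_power_factor DERIV_diff dvar) auto
    have 2: "wL i j * ((if i = b then 1 else 0) - (if j = b then 1 else 0)) / ((t(b := t b)) i - (t(b := t b)) j) = dL i j"
      using j(2) minus_divide_right[of "wL i b" "t i - t b"] by (auto simp: dL_def)
    show ?thesis using 1 unfolding 2 .
  qed
  have K: "(\<Prod>i\<in>{1..n}. \<Prod>j\<in>{i<..n}. power_factor (z i - z j) (weight_form r (\<Lambda> i) (\<Lambda> j))) \<noteq> 0"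
  proof (simp only: prod_zero_iff finite_atLeastAtMost finite_greaterThanAtMost, intro notI, elim bexE)
    fix i j assume "i \<in> {1..n}" "j \<in> {i<..n}" "power_factor (z i - z j) (weight_form r (\<Lambda> i) (\<Lambda> j)) = 0"
    moreover from this have "z i \<noteq> z j" using inj_on_eq_iff[OF z, of i j] by auto
    ultimately show False by (simp add: power_factor_def split: if_splits)
  qed
  have "log_derivative (\<lambda>y. master_function r n \<Lambda> l z (t(b := y)))
      (0 + (\<Sum>i\<in>{1..m}. \<Sum>s\<in>{1..n}. dR i s) + (\<Sum>i\<in>{1..m}. \<Sum>j\<in>{i<..m}. dL i j)) (t b)"
    unfolding master_function_def wR_def[symmetric] wL_def[symmetric]
    by (intro log_derivative_mult log_derivative_const[OF K] log_derivative_prod R L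
        finite_atLeastAtMost finite_greaterThanAtMost)
  moreover have "(\<Sum>i\<in>{1..m}. \<Sum>s\<in>{1..n}. dR i s) = - (\<Sum>s\<in>{1..n}. coupling b (m + s) / (?x b - ?x (m + s)))"
  proof -
    have "(\<Sum>i\<in>{1..m}. \<Sum>s\<in>{1..n}. dR i s) = (\<Sum>i\<in>{1..m}. if i = b then (\<Sum>s\<in>{1..n}. dR b s) else 0)"
      by (intro sum.cong refl) (auto simp: dR_def)
    also have "\<dots> = (\<Sum>s\<in>{1..n}. dR b s)" using b by simp
    also have "\<dots> = (\<Sum>s\<in>{1..n}. - (coupling b (m + s) / (?x b - ?x (m + s))))"
      using b by (intro sum.cong refl) (simp add: dR_def coupling_def nodes_def wR_def)
    finally show ?thesis by (simp add: sum_negf)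
  qed
  moreover have "(\<Sum>i\<in>{1..m}. \<Sum>j\<in>{i<..m}. dL i j) = - (\<Sum>q\<in>{1..m}. coupling b q / (?x b - ?x q))"
  proof -
    \<comment> \<open>A pair with \<open>b\<close> in second place contributes
      \<open>wL i b / (t b - t i)\<close>, which is \<open>e i\<close> by the symmetry of the form.
      So the pairs before and after \<open>b\<close> recombine into one sum over all other
      variables.\<close>
    define e where "e j = wL b j / (t b - t j)" for j
    have "(\<Sum>i\<in>{1..m}. \<Sum>j\<in>{i<..m}. dL i j) =
        (\<Sum>i\<in>{1..m}. (if i = b then \<Sum>j\<in>{b<..m}. e j else 0) + (if i < b then e i else 0))"
    proof (rule sum.cong[OF refl])
      fix i assume i: "i \<in> {1..m}"
      show "(\<Sum>j\<in>{i<..m}. dL i j) = (if i = b then \<Sum>j\<in>{b<..m}. e j else 0) + (if i < b then e i else 0)"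
      proof (cases "i = b")
        case True
        then show ?thesis by (auto simp: dL_def e_def intro!: sum.cong)
      next
        case False
        have "(\<Sum>j\<in>{i<..m}. dL i j) = (\<Sum>j\<in>{i<..m}. if j = b then e i else 0)"
          using False by (intro sum.cong refl) (auto simp: dL_def e_def wL_def weight_form_def mult.commute)
        also have "\<dots> = (if i < b then e i else 0)" using b by (simp add: sum.delta)
        finally show ?thesis using False by simp
      qed
    qed
    also have "\<dots> = (\<Sum>j\<in>{b<..m}. e j) + (\<Sum>i\<in>{1..m}. if i < b then e i else 0)"
      unfolding sum.distrib using b by simp
    also have "(\<Sum>i\<in>{1..m}. if i < b then e i else 0) = (\<Sum>i\<in>{1..<b}. e i)"
      using b by (intro sum.mono_neutral_cong_right) auto
    also have "(\<Sum>j\<in>{b<..m}. e j) + (\<Sum>i\<in>{1..<b}. e i) = (\<Sum>j\<in>{b<..m} \<union> {1..<b}. e j)"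
      by (rule sum.union_disjoint[symmetric]) auto
    also have "{b<..m} \<union> {1..<b} = {1..m} - {b}" using b by auto
    also have "(\<Sum>j\<in>{1..m} - {b}. e j) = (\<Sum>j\<in>{1..m}. e j)"
      by (rule sum.mono_neutral_left) (auto simp: e_def)
    also have "\<dots> = (\<Sum>q\<in>{1..m}. - (coupling b q / (?x b - ?x q)))"
      using b by (intro sum.cong refl) (simp add: e_def coupling_def nodes_def wL_def)
    finally show ?thesis by (simp add: sum_negf)
  qed
  ultimately show ?thesis unfolding gradient_def sum_node_split by (simp add: add.commute)
qed

text \<open>The derivative of \<open>gradient a\<close> in the coordinate \<open>b\<close>. The
  difference of the two truth values is the derivative of \<open>x a - x q\<close>.\<close>

definition hessian_entry :: "(nat \<Rightarrow> complex) \<Rightarrow> nat \<Rightarrow> nat \<Rightarrow> complex" where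
  "hessian_entry x a b = (\<Sum>q\<in>{1..m + n}. coupling a q / ((x a - x q) * (x a - x q)) * (of_bool (a = b) - of_bool (q = b)))"

lemma has_field_derivative_gradient:
  assumes adm: "admissible x" and a: "a \<in> {1..m}" and b: "b \<in> {1..m}"
  shows "((\<lambda>y. gradient a (x(b := y))) has_field_derivative hessian_entry x a b) (at (x b))"
proof -
  have "((\<lambda>y. coupling a q / ((x(b := y)) a - (x(b := y)) q)) has_field_derivative
      - (coupling a q / ((x a - x q) * (x a - x q)) * (of_bool (a = b) - of_bool (q = b)))) (at (x b))"
    if q: "q \<in> {1..m + n}" for q
  proof (cases "coupling a q = 0 \<or> q = a")
    case True
    then show ?thesis by auto
  next
    case False
    then have ne: "x a - x q \<noteq> 0" using adm a q by (auto simp: admissible_def edge_pairs_def)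
    have dvar: "((\<lambda>y. (x(b := y)) i) has_field_derivative of_bool (i = b)) (at (x b))" for i
      by (cases "i = b") auto
    have "((\<lambda>y. coupling a q / ((x(b := y)) a - (x(b := y)) q)) has_field_derivative
      (0 * ((x(b := x b)) a - (x(b := x b)) q) - coupling a q * (of_bool (a = b) - of_bool (q = b))) /
       (((x(b := x b)) a - (x(b := x b)) q) * ((x(b := x b)) a - (x(b := x b)) q))) (at (x b))"
      using ne by (intro DERIV_divide DERIV_const DERIV_diff dvar) simp
    moreover have "(0 * ((x(b := x b)) a - (x(b := x b)) q) - coupling a q * (of_bool (a = b) - of_bool (q = b))) /
       (((x(b := x b)) a - (x(b := x b)) q) * ((x(b := x b)) a - (x(b := x b)) q)) =
       - (coupling a q / ((x a - x q) * (x a - x q)) * (of_bool (a = b) - of_bool (q = b)))"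
      unfolding fun_upd_triv by simp
    ultimately show ?thesis by (rule back_subst[where P = "\<lambda>d. (_ has_field_derivative d) _"])
  qed
  then have "((\<lambda>y. - (\<Sum>q\<in>{1..m + n}. coupling a q / ((x(b := y)) a - (x(b := y)) q))) has_field_derivative
      - (\<Sum>q\<in>{1..m + n}. - (coupling a q / ((x a - x q) * (x a - x q)) * (of_bool (a = b) - of_bool (q = b))))) (at (x b))"
    by (intro DERIV_minus DERIV_sum)
  then show ?thesis by (simp add: gradient_def hessian_entry_def sum_negf)
qed

text \<open>The second derivative needs the formula for the first one on a whole neighbourhood, and
  that formula holds at admissible points.\<close>

lemma eventually_admissible:
  assumes adm: "admissible x"
  shows "eventually (\<lambda>y. admissible (x(b := y))) (nhds (x b))"
proof -
  have "eventually (\<lambda>y. coupling i q \<noteq> 0 \<longrightarrow> (x(b := y)) i \<noteq> (x(b := y)) q) (nhds (x b))"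
    if e: "(i, q) \<in> edge_pairs m n" for i q
  proof (cases "coupling i q = 0")
    case False
    then have ne: "x i - x q \<noteq> 0" using adm e by (auto simp: admissible_def)
    have lim: "((\<lambda>y. (x(b := y)) i) \<longlongrightarrow> x i) (nhds (x b))" for i
      by (cases "i = b") (auto simp: filterlim_ident)
    have "((\<lambda>y. (x(b := y)) i - (x(b := y)) q) \<longlongrightarrow> x i - x q) (nhds (x b))"
      by (intro tendsto_diff lim)
    from tendsto_imp_eventually_ne[OF this ne] show ?thesis by (rule eventually_mono) auto
  qed simp
  then show ?thesis
    unfolding admissible_def case_prod_beta
    by (intro eventually_ball_finite finite_edge_pairs ballI) (metis prod.collapse)
qed

lemma partial_deriv_log_master_function:
  assumes dom: "\<And>s. s \<in> {1..n} \<Longrightarrow> integral_dominant r (\<Lambda> s)" and z: "inj_on z {1..n}"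
    and adm: "admissible (nodes m t z)" and a: "a \<in> {1..m}" and b: "b \<in> {1..m}"
  shows "partial_deriv b (\<lambda>u. partial_deriv a (master_function r n \<Lambda> l z) u / master_function r n \<Lambda> l z u) t =
    hessian_entry (nodes m t z) a b"
proof -
  let ?f = "master_function r n \<Lambda> l z" and ?x = "nodes m t z"
  have quot: "partial_deriv a ?f u / ?f u = gradient a (nodes m u z)" if "admissible (nodes m u z)" for u
  proof -
    have "log_derivative (\<lambda>y. ?f (u(a := y))) (gradient a (nodes m u z)) (u a)"
      using dom z that a by (rule log_derivative_master_function)
    then have "?f u \<noteq> 0" "((\<lambda>y. ?f (u(a := y))) has_field_derivative gradient a (nodes m u z) * ?f u) (at (u a))"
      by (simp_all add: log_derivative_def)
    then show ?thesis unfolding partial_deriv_def by (simp add: DERIV_imp_deriv)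
  qed
  have xb: "?x b = t b" using b by (simp add: nodes_def)
  have "eventually (\<lambda>y. admissible (?x(b := y))) (nhds (t b))"
    using eventually_admissible[OF adm, of b] by (simp add: xb)
  then have "eventually (\<lambda>y. partial_deriv a ?f (t(b := y)) / ?f (t(b := y)) = gradient a (?x(b := y))) (nhds (t b))"
    by (rule eventually_mono) (use quot nodes_upd[OF b] in simp)
  then have "partial_deriv b (\<lambda>u. partial_deriv a ?f u / ?f u) t = deriv (\<lambda>y. gradient a (?x(b := y))) (t b)"
    unfolding partial_deriv_def[of b] by (intro deriv_cong_ev) auto
  also have "\<dots> = hessian_entry ?x a b"
    using has_field_derivative_gradient[OF adm a b] xb by (simp add: DERIV_imp_deriv)
  finally show ?thesis .
qed

lemma det_log_hessian:
  assumes dom: "\<And>s. s \<in> {1..n} \<Longrightarrow> integral_dominant r (\<Lambda> s)" and z: "inj_on z {1..n}"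
    and adm: "admissible (nodes m t z)"
  shows "Determinant.det (log_hessian m (master_function r n \<Lambda> l z) t) = set_det {1..m} (hessian_entry (nodes m t z))"
proof -
  have bij: "bij_betw Suc {0..<m} {1..m}"
    by (intro bij_betw_imageI) (auto simp: image_Suc_atLeastLessThan)
  let ?H = "mat m m (\<lambda>(i, j). hessian_entry (nodes m t z) (Suc i) (Suc j))"
  \<comment> \<open>The row index of \<open>log_hessian\<close> belongs to the outer derivative,
    whereas the row index of \<open>hessian_entry\<close> belongs to the inner one.\<close>
  have "log_hessian m (master_function r n \<Lambda> l z) t = transpose_mat ?H"
  proof (rule eq_matI)
    fix i j assume "i < dim_row (transpose_mat ?H)" "j < dim_col (transpose_mat ?H)"
    then have ij: "i < m" "j < m" by auto
    then have "partial_deriv (i + 1) (\<lambda>u. partial_deriv (j + 1) (master_function r n \<Lambda> l z) u / master_function r n \<Lambda> l z u) t =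
        hessian_entry (nodes m t z) (j + 1) (i + 1)"
      by (intro partial_deriv_log_master_function dom z adm) auto
    then show "log_hessian m (master_function r n \<Lambda> l z) t $$ (i, j) = transpose_mat ?H $$ (i, j)"
      using ij by (simp add: log_hessian_def)
  qed (simp_all add: log_hessian_def)
  then have "Determinant.det (log_hessian m (master_function r n \<Lambda> l z) t) = Determinant.det ?H"
    by (simp add: det_transpose[of _ m])
  also have "\<dots> = set_det {1..m} (hessian_entry (nodes m t z))"
    by (rule set_det_eq_det[OF bij, symmetric])
  finally show ?thesis .
qed

end

section \<open>Pairing with the dual weight function\<close>

lemma chain_fun_map: "chain_fun y q (map \<sigma> xs) = chain_fun (\<lambda>i. y (\<sigma> i)) q xs"
  by (induction xs rule: induct_list012) auto

context highest_weight_factors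
begin

definition dual_vector :: "nat \<Rightarrow> 'v \<Rightarrow> complex" where
  "dual_vector s = (SOME \<xi>. (\<forall>x y. \<xi> (x + y) = \<xi> x + \<xi> y) \<and> (\<forall>a x. \<xi> (sc a x) = a * \<xi> x) \<and> \<xi> (v s) = 1 \<and>
     (\<forall>J. set J \<subseteq> {1..r} \<and> J \<noteq> [] \<longrightarrow> \<xi> (F_monomial r (\<rho> s) J (v s)) = 0))"

lemma dual_vector:
  assumes s: "s \<in> {1..n}"
  shows "dual_vector s (x + y) = dual_vector s x + dual_vector s y" "dual_vector s (sc a x) = a * dual_vector s x"
    "dual_vector s (v s) = 1"
    "set J \<subseteq> {1..r} \<Longrightarrow> J \<noteq> [] \<Longrightarrow> dual_vector s (F_monomial r (\<rho> s) J (v s)) = 0"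
proof -
  interpret S: sl_rep sc r "V s" "\<rho> s" by (rule sl_rep_factor[OF s])
  let ?P = "\<lambda>\<xi>. (\<forall>x y. \<xi> (x + y) = \<xi> x + \<xi> y) \<and> (\<forall>a x. \<xi> (sc a x) = a * \<xi> x) \<and> \<xi> (v s) = (1::complex) \<and>
     (\<forall>J. set J \<subseteq> {1..r} \<and> J \<noteq> [] \<longrightarrow> \<xi> (F_monomial r (\<rho> s) J (v s)) = 0)"
  have "\<exists>\<xi>. ?P \<xi>"
    by (rule S.dual_vector_exists[OF singular_factor[OF s] factor_nonzero[OF s]]) blast
  then have "?P (dual_vector s)" unfolding dual_vector_def by (rule someI_ex)
  then show "dual_vector s (x + y) = dual_vector s x + dual_vector s y" "dual_vector s (sc a x) = a * dual_vector s x"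
    "dual_vector s (v s) = 1"
    "set J \<subseteq> {1..r} \<Longrightarrow> J \<noteq> [] \<Longrightarrow> dual_vector s (F_monomial r (\<rho> s) J (v s)) = 0" by blast+
qed

definition dual_E_factor :: "nat \<Rightarrow> nat list \<Rightarrow> 'v \<Rightarrow> complex" where
  "dual_E_factor s = sl_rep.dual_E r (\<rho> s) (dual_vector s)"

text \<open>The weight function of the dual module, with the variables \<open>y\<close>, as a multilinear form.\<close>

definition dual_weight_form :: "(nat \<Rightarrow> complex) \<Rightarrow> (nat \<Rightarrow> 'v) \<Rightarrow> complex" where
  "dual_weight_form y u = (\<Sum>B\<in>arrangements n {1..m}. chain_prod m n y B * (\<Prod>s\<in>{1..n}. dual_E_factor s (map c (B s)) (u s)))"

lemma multilinear_dual_weight_form: "multilinear_form n sc V (dual_weight_form y)"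
  unfolding multilinear_form_def
proof (intro ballI conjI allI)
  fix u s assume s: "s \<in> {1..n}"
  interpret S: sl_rep sc r "V s" "\<rho> s" by (rule sl_rep_factor[OF s])
  define R where "R B = (\<Prod>k\<in>{1..n} - {s}. dual_E_factor k (map c (B k)) (u k))" for B :: "nat \<Rightarrow> nat list"
  have split: "(\<Prod>k\<in>{1..n}. dual_E_factor k (map c (B k)) ((u(s := x)) k)) = dual_E_factor s (map c (B s)) x * R B" for B x
    unfolding R_def using s by (subst prod.remove[of _ s]) auto
  have lin: "dual_E_factor s (map c (B s)) (x + y) = dual_E_factor s (map c (B s)) x + dual_E_factor s (map c (B s)) y"
    "dual_E_factor s (map c (B s)) (sc a x) = a * dual_E_factor s (map c (B s)) x"
    if "B \<in> arrangements n {1..m}" "x \<in> V s" "y \<in> V s" for B x y a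
    unfolding dual_E_factor_def
    using S.dual_E_linear[OF dual_vector(1,2)[OF s] color_block[OF that(1) s]] that(2,3) by blast+
  fix x assume x: "x \<in> V s"
  show "dual_weight_form y (u(s := x + w)) = dual_weight_form y (u(s := x)) + dual_weight_form y (u(s := w))" if w: "w \<in> V s" for w
    unfolding dual_weight_form_def split sum.distrib[symmetric]
  proof (rule sum.cong[OF refl])
    fix B assume B: "B \<in> arrangements n {1..m}"
    show "chain_prod m n y B * (dual_E_factor s (map c (B s)) (x + w) * R B) =
      chain_prod m n y B * (dual_E_factor s (map c (B s)) x * R B) + chain_prod m n y B * (dual_E_factor s (map c (B s)) w * R B)"
      unfolding lin(1)[OF B x w] by (simp add: algebra_simps)
  qed
  show "dual_weight_form y (u(s := sc a x)) = a * dual_weight_form y (u(s := x))" for a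
    unfolding dual_weight_form_def split sum_distrib_left
  proof (rule sum.cong[OF refl])
    fix B assume B: "B \<in> arrangements n {1..m}"
    show "chain_prod m n y B * (dual_E_factor s (map c (B s)) (sc a x) * R B) =
      a * (chain_prod m n y B * (dual_E_factor s (map c (B s)) x * R B))"
      unfolding lin(2)[OF B x x] by (simp add: algebra_simps)
  qed
qed

text \<open>The contribution of a pair of orderings to the Shapovalov pairing: each label
  contributes its couplings to its root and to the labels behind it in both orderings. This is the
  product evaluated by the matrix-tree theorem.\<close>

definition arrangement_weight :: "(nat \<Rightarrow> nat list) \<Rightarrow> (nat \<Rightarrow> nat list) \<Rightarrow> complex" where
  "arrangement_weight B C = (\<Prod>a\<in>{1..m}. \<Sum>q | q \<in> {1..m + n} \<and> linked m n B a q \<and> linked m n C a q. coupling a q)"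

definition same_blocks :: "(nat \<Rightarrow> nat list) \<Rightarrow> (nat \<Rightarrow> nat list) set" where
  "same_blocks B = {C. C \<in> arrangements n {1..m} \<and> (\<forall>k\<in>{1..n}. set (C k) = set (B k))}"

text \<open>In the coefficient of a removed label, the highest weight is the coupling to the root
  \<open>m + s\<close> and each subtracted simple root is a coupling to another label.\<close>

lemma dual_E_factor_F_monomial:
  assumes \<Lambda>: "\<And>s. s \<in> {1..n} \<Longrightarrow> is_weight r (\<Lambda> s)"
    and B: "B \<in> arrangements n {1..m}" and s: "s \<in> {1..n}" and J: "set J \<subseteq> {1..r}"
  shows "dual_E_factor s J (F_monomial r (\<rho> s) (map c (B s)) (v s)) =
    (\<Sum>C | distinct C \<and> set C = set (B s) \<and> map c C = J. \<Prod>a\<in>set (B s).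
      \<Sum>q | q \<in> {1..m + n} \<and> (q = m + s \<or> precedes (B s) a q \<and> precedes C a q). coupling a q)"
proof -
  interpret S: sl_rep sc r "V s" "\<rho> s" by (rule sl_rep_factor[OF s])
  have im: "c ` set (B s) \<subseteq> {1..r}" using color_block[OF B s] by simp
  have "dual_E_factor s J (F_monomial r (\<rho> s) (map c (B s)) (v s)) =
    (\<Sum>C | distinct C \<and> set C = set (B s) \<and> map c C = J. \<Prod>a\<in>set (B s). \<Lambda> s (chev_H r (c a)) -
      (\<Sum>b | precedes (B s) a b \<and> precedes C a b. simple_root (c b) (chev_H r (c a))))"
    unfolding dual_E_factor_def
    by (rule S.dual_E_F_monomial[OF singular_factor[OF s] dual_vector[OF s] J arrangementsD(1)[OF B s] im])
  also have "\<dots> = (\<Sum>C | distinct C \<and> set C = set (B s) \<and> map c C = J. \<Prod>a\<in>set (B s).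
      \<Sum>q | q \<in> {1..m + n} \<and> (q = m + s \<or> precedes (B s) a q \<and> precedes C a q). coupling a q)"
  proof (intro sum.cong prod.cong refl)
    fix C a assume a: "a \<in> set (B s)"
    then have aL: "a \<in> {1..m}" using arrangementsD(2)[OF B s] by blast
    let ?Q = "{b. precedes (B s) a b \<and> precedes C a b}"
    have Q: "?Q \<subseteq> {1..m}" using arrangementsD(2)[OF B s] by (auto dest: precedes_set)
    have "{q. q \<in> {1..m + n} \<and> (q = m + s \<or> precedes (B s) a q \<and> precedes C a q)} = insert (m + s) ?Q"
      using Q s by auto
    moreover have "m + s \<notin> ?Q" using Q s by auto
    moreover have "finite ?Q" using Q finite_subset by blast
    ultimately have "(\<Sum>q | q \<in> {1..m + n} \<and> (q = m + s \<or> precedes (B s) a q \<and> precedes C a q). coupling a q) =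
        coupling a (m + s) + (\<Sum>b\<in>?Q. coupling a b)" by simp
    also have "coupling a (m + s) = \<Lambda> s (chev_H r (c a))"
      using s weight_form_coroot[OF \<Lambda>[OF s] color_range[OF aL]] by (simp add: coupling_def)
    also have "(\<Sum>b\<in>?Q. coupling a b) = - (\<Sum>b\<in>?Q. simple_root (c b) (chev_H r (c a)))"
      unfolding sum_negf[symmetric]
    proof (rule sum.cong[OF refl])
      fix b assume "b \<in> ?Q"
      then have b: "b \<in> {1..m}" using Q by blast
      then show "coupling a b = - simple_root (c b) (chev_H r (c a))"
        using weight_form_coroot[OF is_weight_simple_root[OF color_range[OF b]] color_range[OF aL]]
        by (simp add: coupling_def)
    qed
    finally show "\<Lambda> s (chev_H r (c a)) - (\<Sum>b\<in>?Q. simple_root (c b) (chev_H r (c a))) =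
      (\<Sum>q | q \<in> {1..m + n} \<and> (q = m + s \<or> precedes (B s) a q \<and> precedes C a q). coupling a q)" by simp
  qed
  finally show ?thesis .
qed

lemma finite_same_blocks: "finite (same_blocks B)"
  by (rule finite_subset[of _ "arrangements n {1..m}"]) (auto simp: same_blocks_def finite_arrangements)

text \<open>For an ordering \<open>B'\<close> from the dual form, choosing an order of removal in
  every factor gives an arrangement \<open>C\<close> with the blocks of \<open>B\<close> and the
  colours of \<open>B'\<close>. The weight does not involve \<open>B'\<close> otherwise, so for
  fixed \<open>C\<close> only the chains of all \<open>B'\<close> with the colours of
  \<open>C\<close> are summed.\<close>

lemma F_tensor_dual_weight_form:
  assumes \<Lambda>: "\<And>s. s \<in> {1..n} \<Longrightarrow> is_weight r (\<Lambda> s)" and B: "B \<in> arrangements n {1..m}"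
  shows "F_tensor B (dual_weight_form y) = (\<Sum>C\<in>same_blocks B. arrangement_weight B C *
    (\<Sum>B' | B' \<in> arrangements n {1..m} \<and> (\<forall>s\<in>{1..n}. map c (B' s) = map c (C s)). chain_prod m n y B'))"
proof -
  let ?A = "arrangements n {1..m}"
  define W where "W B' s C = (\<Prod>a\<in>set (B s).
      \<Sum>q | q \<in> {1..m + n} \<and> (q = m + s \<or> precedes (B s) a q \<and> precedes C a q). coupling a q)" for B' :: "nat \<Rightarrow> nat list" and s C
  define T where "T B' s = {C. distinct C \<and> set C = set (B s) \<and> map c C = map c (B' s)}" for B' s
  have finT: "finite (T B' s)" for B' s
  proof (rule finite_subset)
    show "T B' s \<subseteq> {C. set C \<subseteq> set (B s) \<and> length C \<le> length (B' s)}"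
      by (auto simp: T_def dest: arg_cong[where f = length])
  qed (rule finite_lists_length_le, simp)
  have PiT: "Pi\<^sub>E {1..n} (T B') = {C \<in> same_blocks B. \<forall>s\<in>{1..n}. map c (C s) = map c (B' s)}" for B'
  proof (intro equalityI subsetI)
    fix C assume C: "C \<in> Pi\<^sub>E {1..n} (T B')"
    then have Cs: "distinct (C s) \<and> set (C s) = set (B s) \<and> map c (C s) = map c (B' s)" if "s \<in> {1..n}" for s
      using that by (auto simp: T_def PiE_iff)
    have "C \<in> ?A"
    proof (rule arrangementsI)
      show "C \<in> extensional {1..n}" using C by (simp add: PiE_def)
      show "set (C k) \<subseteq> {1..m}" if "k \<in> {1..n}" for k using Cs[OF that] arrangementsD(2)[OF B that] by simp
      show "j = k" if "a \<in> set (C j)" "a \<in> set (C k)" "j \<in> {1..n}" "k \<in> {1..n}" for a j k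
        using that Cs[OF that(3)] Cs[OF that(4)] arrangementsD(3)[OF B, of a j k] by simp
      show "\<exists>k\<in>{1..n}. a \<in> set (C k)" if "a \<in> {1..m}" for a
        using arrangementsD(4)[OF B that] Cs by blast
    qed (use Cs in blast)
    with Cs show "C \<in> {C \<in> same_blocks B. \<forall>s\<in>{1..n}. map c (C s) = map c (B' s)}"
      by (simp add: same_blocks_def)
  next
    fix C assume "C \<in> {C \<in> same_blocks B. \<forall>s\<in>{1..n}. map c (C s) = map c (B' s)}"
    then have C: "C \<in> ?A" "\<And>s. s \<in> {1..n} \<Longrightarrow> set (C s) = set (B s) \<and> map c (C s) = map c (B' s)"
      by (auto simp: same_blocks_def)
    show "C \<in> Pi\<^sub>E {1..n} (T B')"
      unfolding PiE_iff using C(2) arrangementsD(1,5)[OF C(1)] by (simp add: T_def)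
  qed
  have weight: "(\<Prod>s\<in>{1..n}. W B' s (C s)) = arrangement_weight B C" if C: "C \<in> same_blocks B" for B' C
  proof -
    have CA: "C \<in> ?A" and sets: "\<And>s. s \<in> {1..n} \<Longrightarrow> set (C s) = set (B s)" using C by (auto simp: same_blocks_def)
    have linked_iff: "linked m n D a q \<longleftrightarrow> q = m + s \<or> precedes (D s) a q"
      if "D \<in> ?A" "s \<in> {1..n}" "a \<in> set (D s)" for D s a q
    proof
      assume "linked m n D a q"
      then obtain k where k: "k \<in> {1..n}" "a \<in> set (D k)" "q = m + k \<or> precedes (D k) a q"
        unfolding linked_def by blast
      then have "k = s" using arrangementsD(3)[OF that(1), of a k s] that by blast
      with k(3) show "q = m + s \<or> precedes (D s) a q" by simp
    qed (use that in \<open>auto simp: linked_def\<close>)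
    have L: "{1..m} = (\<Union>s\<in>{1..n}. set (B s))" by (rule arrangements_Union[OF B])
    have "arrangement_weight B C = (\<Prod>s\<in>{1..n}. \<Prod>a\<in>set (B s).
        \<Sum>q | q \<in> {1..m + n} \<and> linked m n B a q \<and> linked m n C a q. coupling a q)"
      unfolding arrangement_weight_def
      by (subst L, rule prod.UNION_disjoint) (use arrangementsD(3)[OF B] in \<open>blast+\<close>)
    also have "\<dots> = (\<Prod>s\<in>{1..n}. W B' s (C s))"
      unfolding W_def
    proof (intro prod.cong sum.cong refl Collect_cong conj_cong)
      fix s a q assume s: "s \<in> {1..n}" and a: "a \<in> set (B s)"
      show "linked m n B a q \<and> linked m n C a q \<longleftrightarrow> q = m + s \<or> precedes (B s) a q \<and> precedes (C s) a q"
        using linked_iff[OF B s a] linked_iff[OF CA s, of a q] sets[OF s] a by auto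
    qed
    finally show ?thesis by simp
  qed
  have "F_tensor B (dual_weight_form y) = dual_weight_form y (\<lambda>s\<in>{1..n}. F_monomial r (\<rho> s) (map c (B s)) (v s))"
    by (simp add: F_tensor_def pure_tensor_def multilinear_dual_weight_form)
  also have "\<dots> = (\<Sum>B'\<in>?A. chain_prod m n y B' * (\<Prod>s\<in>{1..n}. \<Sum>C\<in>T B' s. W B' s C))"
    unfolding dual_weight_form_def
  proof (intro sum.cong prod.cong refl arg_cong2[where f = "(*)"])
    fix B' s assume B': "B' \<in> ?A" and s: "s \<in> {1..n}"
    show "dual_E_factor s (map c (B' s)) ((\<lambda>s\<in>{1..n}. F_monomial r (\<rho> s) (map c (B s)) (v s)) s) = (\<Sum>C\<in>T B' s. W B' s C)"
      using dual_E_factor_F_monomial[OF \<Lambda> B s color_block[OF B' s]] s by (simp add: T_def W_def)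
  qed
  also have "\<dots> = (\<Sum>B'\<in>?A. chain_prod m n y B' * (\<Sum>C\<in>Pi\<^sub>E {1..n} (T B'). \<Prod>s\<in>{1..n}. W B' s (C s)))"
    by (subst prod_sum_PiE) (auto simp: finT)
  also have "\<dots> = (\<Sum>B'\<in>?A. \<Sum>C\<in>{C \<in> same_blocks B. \<forall>s\<in>{1..n}. map c (C s) = map c (B' s)}. chain_prod m n y B' * arrangement_weight B C)"
    unfolding PiT sum_distrib_left by (intro sum.cong refl arg_cong2[where f = "(*)"] weight) blast
  also have "\<dots> = (\<Sum>C\<in>same_blocks B. \<Sum>B'\<in>{B' \<in> ?A. \<forall>s\<in>{1..n}. map c (C s) = map c (B' s)}. chain_prod m n y B' * arrangement_weight B C)"
    by (rule sum.swap_restrict) (auto simp: finite_arrangements finite_same_blocks)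
  also have "\<dots> = (\<Sum>C\<in>same_blocks B. arrangement_weight B C *
    (\<Sum>B' | B' \<in> ?A \<and> (\<forall>s\<in>{1..n}. map c (B' s) = map c (C s)). chain_prod m n y B'))"
    unfolding sum_distrib_left by (intro sum.cong refl) (auto simp: mult.commute)
  finally show ?thesis .
qed

definition color_symmetries :: "(nat \<Rightarrow> nat) set" where
  "color_symmetries = {\<sigma>. \<sigma> permutes {1..m} \<and> (\<forall>a\<in>{1..m}. c (\<sigma> a) = c a)}"

lemma finite_color_symmetries: "finite color_symmetries"
  by (rule finite_subset[of _ "{\<sigma>. \<sigma> permutes {1..m}}"]) (auto simp: color_symmetries_def finite_permutations)

text \<open>An arrangement with the colours of \<open>C\<close> is a relabelling of \<open>C\<close>
  by a unique colour-preserving permutation, and relabelling the chains is the same as permuting the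
  variables.\<close>

lemma sum_same_colors:
  assumes C: "C \<in> arrangements n {1..m}"
  shows "(\<Sum>B' | B' \<in> arrangements n {1..m} \<and> (\<forall>s\<in>{1..n}. map c (B' s) = map c (C s)). chain_prod m n y B') =
    (\<Sum>\<sigma>\<in>color_symmetries. chain_prod m n (\<lambda>i. y (\<sigma> i)) C)"
proof -
  let ?A = "arrangements n {1..m}"
  have dom: "{\<sigma>. \<sigma> permutes {1..m} \<and> (\<forall>s\<in>{1..n}. map c (map \<sigma> (C s)) = map c (C s))} = color_symmetries"
  proof -
    have "(\<forall>s\<in>{1..n}. map c (map \<sigma> (C s)) = map c (C s)) \<longleftrightarrow> (\<forall>a\<in>(\<Union>s\<in>{1..n}. set (C s)). c (\<sigma> a) = c a)" for \<sigma>
      by auto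
    moreover have "(\<Union>s\<in>{1..n}. set (C s)) = {1..m}" by (rule arrangements_Union[OF C, symmetric])
    ultimately show ?thesis unfolding color_symmetries_def by (simp only:)
  qed
  have ran: "{B' \<in> ?A. \<forall>s\<in>{1..n}. length (B' s) = length (C s) \<and> map c (B' s) = map c (C s)} =
      {B' \<in> ?A. \<forall>s\<in>{1..n}. map c (B' s) = map c (C s)}"
    by (auto dest: map_eq_imp_length_eq)
  note bij = bij_betw_coloured_permutations[OF finite_atLeastAtMost C, of c "\<lambda>s. map c (C s)", unfolded dom ran]
  have "(\<Sum>B'\<in>{B' \<in> ?A. \<forall>s\<in>{1..n}. map c (B' s) = map c (C s)}. chain_prod m n y B') =
      (\<Sum>\<sigma>\<in>color_symmetries. chain_prod m n y (\<lambda>s\<in>{1..n}. map \<sigma> (C s)))"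
    by (rule sum.reindex_bij_betw[OF bij, symmetric])
  also have "\<dots> = (\<Sum>\<sigma>\<in>color_symmetries. chain_prod m n (\<lambda>i. y (\<sigma> i)) C)"
  proof (rule sum.cong[OF refl])
    fix \<sigma> assume "\<sigma> \<in> color_symmetries"
    then have "\<sigma> (m + s) = m + s" if "s \<in> {1..n}" for s
      using that by (intro permutes_not_in[of \<sigma> "{1..m}"]) (auto simp: color_symmetries_def)
    then show "chain_prod m n y (\<lambda>s\<in>{1..n}. map \<sigma> (C s)) = chain_prod m n (\<lambda>i. y (\<sigma> i)) C"
      unfolding chain_prod_def by (intro prod.cong refl) (simp add: chain_fun_map)
  qed
  finally show ?thesis by simp
qed

definition cross_entry :: "(nat \<Rightarrow> complex) \<Rightarrow> (nat \<Rightarrow> complex) \<Rightarrow> nat \<Rightarrow> nat \<Rightarrow> complex" where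
  "cross_entry x y a b =
    (\<Sum>q\<in>{1..m + n}. coupling a q / ((x a - x q) * (y a - y q)) * (of_bool (a = b) - of_bool (q = b)))"

text \<open>For every \<open>\<sigma>\<close> the sum over pairs of orderings is that of the
  matrix-tree theorem with \<open>y\<close> replaced by \<open>y \<circ> \<sigma>\<close>. The
  latter is again generic, because \<open>\<sigma>\<close> permutes the labels and fixes the
  roots.\<close>

lemma weight_function_dual_weight_form:
  assumes \<Lambda>: "\<And>s. s \<in> {1..n} \<Longrightarrow> is_weight r (\<Lambda> s)"
    and gx: "generic m n (nodes m t z)" and gy: "generic m n y"
  shows "weight_function r n sc V \<rho> v l t z (dual_weight_form y) =
    (\<Sum>\<sigma>\<in>color_symmetries. set_det {1..m} (cross_entry (nodes m t z) (\<lambda>i. y (\<sigma> i))))"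
proof -
  let ?A = "arrangements n {1..m}" and ?x = "nodes m t z"
  have "weight_function r n sc V \<rho> v l t z (dual_weight_form y) =
      (\<Sum>B\<in>?A. chain_prod m n ?x B * F_tensor B (dual_weight_form y))"
    unfolding weight_function_nodes by (simp add: tensor_sum_apply tensor_scale_def)
  also have "\<dots> = (\<Sum>B\<in>?A. \<Sum>C\<in>same_blocks B. \<Sum>\<sigma>\<in>color_symmetries.
      chain_prod m n ?x B * chain_prod m n (\<lambda>i. y (\<sigma> i)) C * arrangement_weight B C)"
  proof (rule sum.cong[OF refl])
    fix B assume B: "B \<in> ?A"
    have "F_tensor B (dual_weight_form y) = (\<Sum>C\<in>same_blocks B. arrangement_weight B C *
        (\<Sum>\<sigma>\<in>color_symmetries. chain_prod m n (\<lambda>i. y (\<sigma> i)) C))"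
      by (subst F_tensor_dual_weight_form[OF \<Lambda> B], assumption, intro sum.cong refl arg_cong2[where f = "(*)"] sum_same_colors)
        (simp add: same_blocks_def)
    then show "chain_prod m n ?x B * F_tensor B (dual_weight_form y) = (\<Sum>C\<in>same_blocks B. \<Sum>\<sigma>\<in>color_symmetries.
      chain_prod m n ?x B * chain_prod m n (\<lambda>i. y (\<sigma> i)) C * arrangement_weight B C)"
      by (simp add: sum_distrib_left mult_ac)
  qed
  also have "\<dots> = (\<Sum>\<sigma>\<in>color_symmetries. \<Sum>B\<in>?A. \<Sum>C\<in>same_blocks B.
      chain_prod m n ?x B * chain_prod m n (\<lambda>i. y (\<sigma> i)) C * arrangement_weight B C)"
    by (subst sum.swap[of _ color_symmetries]) (intro sum.cong refl sum.swap)
  also have "\<dots> = (\<Sum>\<sigma>\<in>color_symmetries. set_det {1..m} (cross_entry ?x (\<lambda>i. y (\<sigma> i))))"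
  proof (rule sum.cong[OF refl])
    fix \<sigma> assume "\<sigma> \<in> color_symmetries"
    then have \<sigma>: "\<sigma> permutes {1..m}" by (simp add: color_symmetries_def)
    have gx': "?x b \<noteq> ?x q" if "b \<in> {1..m}" "q \<in> {1..m + n}" "b \<noteq> q" for b q
      using genericD[OF gx that] .
    have gy': "y (\<sigma> b) \<noteq> y (\<sigma> q)" if "b \<in> {1..m}" "q \<in> {1..m + n}" "b \<noteq> q" for b q
    proof (rule genericD[OF gy])
      show "\<sigma> b \<in> {1..m}" using that permutes_in_image[OF \<sigma>] by blast
      have "\<sigma> permutes {1..m + n}" by (rule permutes_subset[OF \<sigma>]) auto
      from permutes_in_image[OF this, of q] show "\<sigma> q \<in> {1..m + n}" using that(2) by (rule iffD2)
      show "\<sigma> b \<noteq> \<sigma> q" using permutes_inj[OF \<sigma>] that by (auto dest: injD)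
    qed
    show "(\<Sum>B\<in>?A. \<Sum>C\<in>same_blocks B. chain_prod m n ?x B * chain_prod m n (\<lambda>i. y (\<sigma> i)) C * arrangement_weight B C) =
        set_det {1..m} (cross_entry ?x (\<lambda>i. y (\<sigma> i)))"
      unfolding same_blocks_def arrangement_weight_def cross_entry_def
      by (rule chain_pair_sum) (erule gx' gy', assumption+)+
  qed
  finally show ?thesis .
qed

end

section \<open>Bethe vectors\<close>

context highest_weight_factors
begin

text \<open>By this symmetry, continuity in one family of variables gives continuity in the
  other.\<close>

lemma cross_entry_commute: "cross_entry x y = cross_entry y x"
  by (simp add: cross_entry_def fun_eq_iff mult.commute)

text \<open>A denominator that tends to 0 at an admissible point comes with zero coupling or with
  \<open>q = a\<close>, and then the term is constantly 0. No condition on \<open>y\<close> enters: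
  if \<open>y a = y q\<close>, the term is 0 on both sides.\<close>

lemma tendsto_set_det_cross_entry:
  assumes X: "\<And>i. ((\<lambda>e. X e i) \<longlongrightarrow> x i) F" and adm: "admissible x"
  shows "((\<lambda>e. set_det {1..m} (cross_entry (X e) y)) \<longlongrightarrow> set_det {1..m} (cross_entry x y)) F"
proof -
  have entry: "((\<lambda>e. cross_entry (X e) y a b) \<longlongrightarrow> cross_entry x y a b) F" if a: "a \<in> {1..m}" for a b
    unfolding cross_entry_def
  proof (intro tendsto_sum tendsto_mult tendsto_const)
    fix q assume q: "q \<in> {1..m + n}"
    show "((\<lambda>e. coupling a q / ((X e a - X e q) * (y a - y q))) \<longlongrightarrow> coupling a q / ((x a - x q) * (y a - y q))) F"
    proof (cases "coupling a q = 0 \<or> q = a \<or> y a - y q = 0")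
      case True
      then show ?thesis by auto
    next
      case False
      then have "x a - x q \<noteq> 0" using adm a q by (auto simp: admissible_def edge_pairs_def)
      with False show ?thesis by (intro tendsto_intros X) auto
    qed
  qed
  show ?thesis
    unfolding set_det_def
  proof (intro tendsto_sum tendsto_mult tendsto_const tendsto_prod)
    fix \<pi> a assume "a \<in> {1..m}"
    then show "((\<lambda>e. cross_entry (X e) y a (\<pi> a)) \<longlongrightarrow> cross_entry x y a (\<pi> a)) F" by (rule entry)
  qed
qed

lemma color_symmetry_coupling:
  assumes \<sigma>: "\<sigma> \<in> color_symmetries" and a: "a \<in> {1..m}" and q: "q \<in> {1..m + n}"
  shows "coupling (\<sigma> a) (\<sigma> q) = coupling a q"
proof (cases "q \<le> m")
  case True
  then have "q \<in> {1..m}" using q by simp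
  then have "\<sigma> q \<in> {1..m}" "c (\<sigma> q) = c q" "c (\<sigma> a) = c a"
    using \<sigma> a permutes_in_image[of \<sigma> "{1..m}" q] by (auto simp: color_symmetries_def)
  then show ?thesis using True by (simp add: coupling_def)
next
  case False
  then have "\<sigma> q = q" using \<sigma> by (intro permutes_not_in[of \<sigma> "{1..m}"]) (auto simp: color_symmetries_def)
  moreover have "c (\<sigma> a) = c a" using \<sigma> a by (auto simp: color_symmetries_def)
  ultimately show ?thesis using False by (simp add: coupling_def)
qed

lemma color_symmetry_edge:
  assumes \<sigma>: "\<sigma> \<in> color_symmetries" and e: "(a, q) \<in> edge_pairs m n"
  shows "(\<sigma> a, \<sigma> q) \<in> edge_pairs m n"
proof -
  have p: "\<sigma> permutes {1..m}" using \<sigma> by (simp add: color_symmetries_def)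
  then have p': "\<sigma> permutes {1..m + n}" by (rule permutes_subset) auto
  have aq: "a \<in> {1..m}" "q \<in> {1..m + n}" "a \<noteq> q" using e by (auto simp: edge_pairs_def)
  have "\<sigma> a \<in> {1..m}" using permutes_in_image[OF p] aq by blast
  moreover have "\<sigma> q \<in> {1..m + n}" using permutes_in_image[OF p'] aq by blast
  moreover have "\<sigma> a \<noteq> \<sigma> q" using permutes_inj[OF p] aq by (auto dest: injD)
  ultimately show ?thesis by (simp add: edge_pairs_def)
qed

lemma admissible_permute:
  assumes \<sigma>: "\<sigma> \<in> color_symmetries" and adm: "admissible x"
  shows "admissible (\<lambda>i. x (\<sigma> i))"
  unfolding admissible_def
proof (intro ballI, unfold split_paired_all, clarify)
  fix a q assume e: "(a, q) \<in> edge_pairs m n" and k: "coupling a q \<noteq> 0" and eq: "x (\<sigma> a) = x (\<sigma> q)"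
  have "a \<in> {1..m}" "q \<in> {1..m + n}" using e by (auto simp: edge_pairs_def)
  then have "coupling (\<sigma> a) (\<sigma> q) \<noteq> 0" using color_symmetry_coupling[OF \<sigma>] k by simp
  then have "x (\<sigma> a) \<noteq> x (\<sigma> q)" using adm color_symmetry_edge[OF \<sigma> e] unfolding admissible_def by blast
  with eq show False by simp
qed

lemma gradient_permute:
  assumes \<sigma>: "\<sigma> \<in> color_symmetries" and a: "a \<in> {1..m}"
  shows "gradient a (\<lambda>i. x (\<sigma> i)) = gradient (\<sigma> a) x"
proof -
  have "\<sigma> permutes {1..m}" using \<sigma> by (simp add: color_symmetries_def)
  then have p: "\<sigma> permutes {1..m + n}" by (rule permutes_subset) auto
  have "(\<Sum>q\<in>{1..m + n}. coupling (\<sigma> a) q / (x (\<sigma> a) - x q)) = (\<Sum>q\<in>{1..m + n}. coupling (\<sigma> a) (\<sigma> q) / (x (\<sigma> a) - x (\<sigma> q)))"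
    using sum.permute[OF p, of "\<lambda>q. coupling (\<sigma> a) q / (x (\<sigma> a) - x q)"] by (simp add: o_def)
  also have "\<dots> = (\<Sum>q\<in>{1..m + n}. coupling a q / (x (\<sigma> a) - x (\<sigma> q)))"
    by (intro sum.cong refl) (simp only: color_symmetry_coupling[OF \<sigma> a])
  finally show ?thesis by (simp add: gradient_def)
qed

text \<open>The difference of two distinct critical points in the same orbit lies in the kernel of the
  matrix of difference quotients of the gradient.\<close>

lemma set_det_cross_entry_orbit:
  assumes \<sigma>: "\<sigma> \<in> color_symmetries" "\<sigma> \<noteq> id" and adm: "admissible x"
    and crit: "\<And>a. a \<in> {1..m} \<Longrightarrow> gradient a x = 0"
  shows "set_det {1..m} (cross_entry x (\<lambda>i. x (\<sigma> i))) = 0"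
proof -
  have p: "\<sigma> permutes {1..m}" using \<sigma> by (simp add: color_symmetries_def)
  obtain a0 where a0: "\<sigma> a0 \<noteq> a0" using \<sigma>(2) by (auto simp: fun_eq_iff)
  then have a0L: "a0 \<in> {1..m}" using permutes_not_in[OF p] by blast
  then have s0: "\<sigma> a0 \<in> {1..m}" using permutes_in_image[OF p] by blast
  have col: "c (\<sigma> a0) = c a0" using \<sigma>(1) a0L by (auto simp: color_symmetries_def)
  define u where "u i = x i - x (\<sigma> i)" for i
  \<comment> \<open>The roots are fixed by \<open>\<sigma>\<close>, so they can join the sum over
    labels without changing the kernel relation.\<close>
  have root: "u q = 0" if "q \<notin> {1..m}" for q using permutes_not_in[OF p that] by (simp add: u_def)
  \<comment> \<open>A label and its image have the same colour, so their coupling is -2 and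
    admissibility separates their coordinates.\<close>
  have "coupling a0 (\<sigma> a0) \<noteq> 0"
    using s0 weight_form_simple_root[OF color_range[OF a0L] color_range[OF s0]] col by (simp add: coupling_def)
  moreover have "(a0, \<sigma> a0) \<in> edge_pairs m n" using a0 a0L s0 by (auto simp: edge_pairs_def)
  ultimately have "x a0 \<noteq> x (\<sigma> a0)" using adm unfolding admissible_def by blast
  then have u0: "u a0 \<noteq> 0" by (simp add: u_def)
  show ?thesis
  proof (rule set_det_zero_kernel[OF finite_atLeastAtMost a0L, of u])
    show "u a0 \<noteq> 0" by (rule u0)
    fix a assume a: "a \<in> {1..m}"
    define w where "w q = coupling a q / ((x a - x q) * (x (\<sigma> a) - x (\<sigma> q)))" for q
    have "(\<Sum>b\<in>{1..m}. cross_entry x (\<lambda>i. x (\<sigma> i)) a b * u b) =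
        (\<Sum>q\<in>{1..m + n}. \<Sum>b\<in>{1..m}. w q * (of_bool (a = b) - of_bool (q = b)) * u b)"
      unfolding cross_entry_def w_def sum_distrib_right by (rule sum.swap)
    also have "\<dots> = (\<Sum>q\<in>{1..m + n}. w q * (u a - u q))"
    proof (rule sum.cong[OF refl])
      fix q
      have "(\<Sum>b\<in>{1..m}. w q * (of_bool (a = b) - of_bool (q = b)) * u b) =
          w q * ((\<Sum>b\<in>{1..m}. if b = a then u b else 0) - (\<Sum>b\<in>{1..m}. if b = q then u b else 0))"
        unfolding sum_subtractf[symmetric] sum_distrib_left by (intro sum.cong refl) auto
      also have "\<dots> = w q * (u a - u q)" using a root[of q] by (simp add: sum.delta)
      finally show "(\<Sum>b\<in>{1..m}. w q * (of_bool (a = b) - of_bool (q = b)) * u b) = w q * (u a - u q)" .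
    qed
    also have "\<dots> = (\<Sum>q\<in>{1..m + n}. coupling a q / (x (\<sigma> a) - x (\<sigma> q)) - coupling a q / (x a - x q))"
    proof (rule sum.cong[OF refl])
      fix q assume q: "q \<in> {1..m + n}"
      show "w q * (u a - u q) = coupling a q / (x (\<sigma> a) - x (\<sigma> q)) - coupling a q / (x a - x q)"
      proof (cases "coupling a q = 0 \<or> q = a")
        case True
        then show ?thesis by (auto simp: w_def)
      next
        case False
        then have e: "(a, q) \<in> edge_pairs m n" using a q by (auto simp: edge_pairs_def)
        \<comment> \<open>Multiplying a cross entry by the difference of its two denominators splits
          it into one term of each gradient.\<close>
        have "k / (p * s) * (p - s) = k / s - k / p" if "p \<noteq> 0" "s \<noteq> 0" for k p s :: complex
          using that by (simp add: field_simps)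
        moreover have "x a - x q \<noteq> 0" using adm e False by (auto simp: admissible_def)
        moreover have "x (\<sigma> a) - x (\<sigma> q) \<noteq> 0"
          using admissible_permute[OF \<sigma>(1) adm] e False by (auto simp: admissible_def)
        moreover have "u a - u q = (x a - x q) - (x (\<sigma> a) - x (\<sigma> q))" by (simp add: u_def)
        ultimately show ?thesis unfolding w_def by simp
      qed
    qed
    also have "\<dots> = gradient a x - gradient a (\<lambda>i. x (\<sigma> i))" by (simp add: gradient_def sum_subtractf)
    also have "\<dots> = 0" using crit[OF a] gradient_permute[OF \<sigma>(1) a] crit[of "\<sigma> a"] a permutes_in_image[OF p] by simp
    finally show "(\<Sum>b\<in>{1..m}. cross_entry x (\<lambda>i. x (\<sigma> i)) a b * u b) = 0" .
  qed
qed

lemma tendsto_nodes_move: "((\<lambda>e. nodes m (move t e) z i) \<longlongrightarrow> nodes m t z i) (at 0)"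
  unfolding nodes_def using tendsto_move[of t i] by (cases "i \<le> m") auto

lemma regular_value_nonzero:
  assumes dom: "\<And>s. s \<in> {1..n} \<Longrightarrow> integral_dominant r (\<Lambda> s)" and z: "inj_on z {1..n}"
    and nd: "nondegenerate_critical_point r n \<Lambda> l z t"
    and w: "regular_value m n T (weight_function r n sc V \<rho> v l) t z w"
  shows "w \<noteq> 0"
proof
  assume w0: "w = 0"
  let ?x = "nodes m t z" and ?X = "\<lambda>e. nodes m (move t e) z"
  have \<Lambda>: "is_weight r (\<Lambda> s)" if "s \<in> {1..n}" for s using dom[OF that] by (simp add: integral_dominant_def)
  have crit: "admissible ?x" "\<And>a. a \<in> {1..m} \<Longrightarrow> gradient a ?x = 0"
    using nd unfolding nondegenerate_critical_point_def critical_point_iff by blast+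
  have gen: "eventually (\<lambda>e. generic m n (?X e)) (at 0)"
    unfolding generic_nodes by (rule eventually_off_diagonals_move)
  \<comment> \<open>Here \<open>y\<close> is fixed and generic while \<open>t\<close> is approached
    along a line. The value at \<open>t\<close> of the right side needs only admissibility, so the
    identity survives at a critical point on a diagonal.\<close>
  have zero: "(\<Sum>\<sigma>\<in>color_symmetries. set_det {1..m} (cross_entry ?x (\<lambda>i. y (\<sigma> i)))) = 0" if gy: "generic m n y" for y
  proof -
    have "((\<lambda>e. weight_function r n sc V \<rho> v l (move t e) z (dual_weight_form y)) \<longlongrightarrow> 0) (at 0)"
      using regular_value_limit[OF w, of "dual_weight_form y"] w0 by simp
    moreover have "eventually (\<lambda>e. weight_function r n sc V \<rho> v l (move t e) z (dual_weight_form y) =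
        (\<Sum>\<sigma>\<in>color_symmetries. set_det {1..m} (cross_entry (?X e) (\<lambda>i. y (\<sigma> i))))) (at 0)"
      using gen by (rule eventually_mono) (rule weight_function_dual_weight_form[OF \<Lambda> _ gy])
    ultimately have "((\<lambda>e. \<Sum>\<sigma>\<in>color_symmetries. set_det {1..m} (cross_entry (?X e) (\<lambda>i. y (\<sigma> i)))) \<longlongrightarrow> 0) (at 0)"
      by (rule Lim_transform_eventually)
    moreover have "((\<lambda>e. \<Sum>\<sigma>\<in>color_symmetries. set_det {1..m} (cross_entry (?X e) (\<lambda>i. y (\<sigma> i)))) \<longlongrightarrow>
        (\<Sum>\<sigma>\<in>color_symmetries. set_det {1..m} (cross_entry ?x (\<lambda>i. y (\<sigma> i))))) (at 0)"
      by (intro tendsto_sum tendsto_set_det_cross_entry tendsto_nodes_move crit(1))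
    ultimately show ?thesis using tendsto_unique[of "at (0::complex)"] by force
  qed
  \<comment> \<open>Now \<open>y\<close> runs to the critical point along the same kind of line.
    Every reordering of the limit is admissible, which is all that continuity in the second family
    asks for.\<close>
  have "((\<lambda>e. \<Sum>\<sigma>\<in>color_symmetries. set_det {1..m} (cross_entry ?x (\<lambda>i. ?X e (\<sigma> i)))) \<longlongrightarrow>
      (\<Sum>\<sigma>\<in>color_symmetries. set_det {1..m} (cross_entry ?x (\<lambda>i. ?x (\<sigma> i))))) (at 0)"
  proof (rule tendsto_sum)
    fix \<sigma> assume \<sigma>: "\<sigma> \<in> color_symmetries"
    show "((\<lambda>e. set_det {1..m} (cross_entry ?x (\<lambda>i. ?X e (\<sigma> i)))) \<longlongrightarrow>
      set_det {1..m} (cross_entry ?x (\<lambda>i. ?x (\<sigma> i)))) (at 0)"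
      unfolding cross_entry_commute[of ?x]
      by (rule tendsto_set_det_cross_entry[OF tendsto_nodes_move admissible_permute[OF \<sigma> crit(1)]])
  qed
  moreover have "eventually (\<lambda>e. (\<Sum>\<sigma>\<in>color_symmetries. set_det {1..m} (cross_entry ?x (\<lambda>i. ?X e (\<sigma> i)))) = 0) (at 0)"
    using gen by (rule eventually_mono) (rule zero)
  then have "((\<lambda>e. \<Sum>\<sigma>\<in>color_symmetries. set_det {1..m} (cross_entry ?x (\<lambda>i. ?X e (\<sigma> i)))) \<longlongrightarrow> 0) (at 0)"
    by (rule tendsto_eventually)
  ultimately have "(\<Sum>\<sigma>\<in>color_symmetries. set_det {1..m} (cross_entry ?x (\<lambda>i. ?x (\<sigma> i)))) = 0"
    using tendsto_unique[of "at (0::complex)"] by force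
  moreover have "(\<Sum>\<sigma>\<in>color_symmetries. set_det {1..m} (cross_entry ?x (\<lambda>i. ?x (\<sigma> i)))) =
      (\<Sum>\<sigma>\<in>{id}. set_det {1..m} (cross_entry ?x (\<lambda>i. ?x (\<sigma> i))))"
  proof (rule sum.mono_neutral_right[OF finite_color_symmetries])
    show "{id} \<subseteq> color_symmetries" by (simp add: color_symmetries_def permutes_id)
    show "\<forall>\<sigma>\<in>color_symmetries - {id}. set_det {1..m} (cross_entry ?x (\<lambda>i. ?x (\<sigma> i))) = 0"
      using set_det_cross_entry_orbit[OF _ _ crit(1)] crit(2) by blast
  qed
  moreover have "cross_entry ?x ?x = hessian_entry ?x"
    by (simp add: cross_entry_def hessian_entry_def fun_eq_iff)
  ultimately have "set_det {1..m} (hessian_entry ?x) = 0" by simp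
  moreover have "set_det {1..m} (hessian_entry ?x) \<noteq> 0"
    using nd det_log_hessian[OF dom z crit(1)] unfolding nondegenerate_critical_point_def by simp
  ultimately show False by simp
qed

section \<open>The weight of the Bethe vector and the final assembly\<close>

lemma sum_color_roots: "(\<Sum>a\<in>{1..m}. simple_root (c a) h) = (\<Sum>i=1..r. of_nat (l i) * simple_root i h)"
proof -
  have "(\<Sum>a\<in>{1..m}. simple_root (c a) h) = (\<Sum>i\<in>{1..r}. \<Sum>a\<in>{a \<in> {1..m}. c a = i}. simple_root (c a) h)"
    by (rule sum.group[symmetric]) (use color_range in auto)
  also have "\<dots> = (\<Sum>i\<in>{1..r}. of_nat (l i) * simple_root i h)"
  proof (rule sum.cong[OF refl])
    fix i assume i: "i \<in> {1..r}"
    have "(\<Sum>a\<in>{a \<in> {1..m}. c a = i}. simple_root (c a) h) = (\<Sum>a\<in>{a \<in> {1..m}. c a = i}. simple_root i h)"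
      by (intro sum.cong) auto
    also have "\<dots> = of_nat (l i) * simple_root i h" using color_spec[of r l] i by simp
    finally show "(\<Sum>a\<in>{a \<in> {1..m}. c a = i}. simple_root (c a) h) = of_nat (l i) * simple_root i h" .
  qed
  finally show ?thesis .
qed

text \<open>By the Leibniz rule the eigenvalues of the factors add up, and the simple roots
  collected over all lists are those of all the variables.\<close>

lemma F_tensor_weight:
  assumes B: "B \<in> arrangements n {1..m}" and h: "h \<in> cartan r"
  shows "tensor_action n sc V \<rho> h (F_tensor B) = tensor_scale (lowered_weight r n \<Lambda> l h) (F_tensor B)"
proof
  fix \<phi> :: "(nat \<Rightarrow> 'v) \<Rightarrow> complex"
  define u where "u = (\<lambda>s\<in>{1..n}. F_monomial r (\<rho> s) (map c (B s)) (v s))"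
  define \<mu> where "\<mu> s = \<Lambda> s h - (\<Sum>a\<in>set (B s). simple_root (c a) h)" for s
  have u: "u \<in> (\<Pi>\<^sub>E s\<in>{1..n}. V s)" using F_tensor_factor_mem[OF B] by (simp add: u_def restrict_PiE_iff)
  have Fu: "F_tensor B = pure_tensor n sc V u"
    unfolding F_tensor_def by (rule pure_tensor_cong) (simp add: u_def)
  have mod: "sl_module r sc (V s) (\<rho> s)" if "s \<in> {1..n}" for s
    using irreducible[OF that] by (simp add: irreducible_module_def)
  have eig: "\<rho> s h (u s) = sc (\<mu> s) (u s)" if s: "s \<in> {1..n}" for s
  proof -
    interpret S: sl_rep sc r "V s" "\<rho> s" by (rule sl_rep_factor[OF s])
    have "(\<Sum>j\<leftarrow>map c (B s). simple_root j h) = (\<Sum>a\<in>set (B s). simple_root (c a) h)"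
      using arrangementsD(1)[OF B s] by (simp add: o_def sum.distinct_set_conv_list)
    then show ?thesis
      using S.F_monomial_weight[OF singular_factor[OF s] h color_block[OF B s]] s by (simp add: u_def \<mu>_def)
  qed
  show "tensor_action n sc V \<rho> h (F_tensor B) \<phi> = tensor_scale (lowered_weight r n \<Lambda> l h) (F_tensor B) \<phi>"
  proof (cases "multilinear_form n sc V \<phi>")
    case True
    have pt: "pure_tensor n sc V w \<phi> = \<phi> w" if "w \<in> (\<Pi>\<^sub>E s\<in>{1..n}. V s)" for w
      using True that by (simp add: pure_tensor_def PiE_def extensional_restrict)
    have upd: "pure_tensor n sc V (u(s := \<rho> s h (u s))) \<phi> = \<mu> s * \<phi> u" if s: "s \<in> {1..n}" for s
    proof -
      interpret S: sl_rep sc r "V s" "\<rho> s" by (rule sl_rep_factor[OF s])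
      have us: "u s \<in> V s" using u s by blast
      have "sc (\<mu> s) (u s) \<in> V s" by (rule S.subspace_scale[OF S.subspace_V us])
      then have "u(s := sc (\<mu> s) (u s)) \<in> (\<Pi>\<^sub>E s\<in>{1..n}. V s)"
        using u s by (auto simp: PiE_iff extensional_def)
      then have "pure_tensor n sc V (u(s := \<rho> s h (u s))) \<phi> = \<phi> (u(s := sc (\<mu> s) (u s)))"
        unfolding eig[OF s] by (rule pt)
      also have "\<dots> = \<mu> s * \<phi> (u(s := u s))"
        using True u s us unfolding multilinear_form_def by blast
      finally show ?thesis by simp
    qed
    have "tensor_action n sc V \<rho> h (F_tensor B) = (\<Sum>s = 1..n. pure_tensor n sc V (u(s := \<rho> s h (u s))))"
      unfolding Fu by (rule tensor_action_pure_tensor[OF _ cartan_sl[OF h] u]) (rule mod)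
    then have "tensor_action n sc V \<rho> h (F_tensor B) \<phi> = (\<Sum>s = 1..n. \<mu> s) * \<phi> u"
      by (simp add: tensor_sum_apply upd sum_distrib_right)
    also have "(\<Sum>s = 1..n. \<mu> s) = lowered_weight r n \<Lambda> l h"
    proof -
      have L: "{1..m} = (\<Union>s\<in>{1..n}. set (B s))" by (rule arrangements_Union[OF B])
      have "(\<Sum>a\<in>{1..m}. simple_root (c a) h) = (\<Sum>s\<in>{1..n}. \<Sum>a\<in>set (B s). simple_root (c a) h)"
        by (subst L, rule sum.UNION_disjoint) (use arrangementsD(3)[OF B] in \<open>blast+\<close>)
      then have "(\<Sum>s\<in>{1..n}. \<Sum>a\<in>set (B s). simple_root (c a) h) = (\<Sum>i=1..r. of_nat (l i) * simple_root i h)"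
        by (simp only: sum_color_roots)
      then show ?thesis by (simp add: \<mu>_def lowered_weight_def sum_subtractf)
    qed
    finally show ?thesis using pt[OF u] by (simp add: Fu tensor_scale_def)
  next
    case False
    then show ?thesis by (simp add: tensor_action_def tensor_scale_def Fu pure_tensor_def)
  qed
qed

text \<open>The action is a transpose, so acting with \<open>h\<close> and evaluating at
  \<open>\<phi>\<close> is evaluation at another form \<open>\<psi>\<close>. The eigenvalue equation
  off the diagonals thus compares two evaluations, and both pass to the limit.\<close>

lemma regular_value_weight_space:
  assumes w: "regular_value m n (tensor_space n sc V) (weight_function r n sc V \<rho> v l) t z w"
  shows "w \<in> weight_space r tensor_scale (tensor_space n sc V) (tensor_action n sc V \<rho>) (lowered_weight r n \<Lambda> l)"
  unfolding weight_space_def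
proof (intro CollectI conjI ballI regular_value_mem[OF w])
  fix h assume h: "h \<in> cartan r"
  let ?f = "weight_function r n sc V \<rho> v l" and ?\<mu> = "lowered_weight r n \<Lambda> l h"
  show "tensor_action n sc V \<rho> h w = tensor_scale ?\<mu> w"
  proof
    fix \<phi> :: "(nat \<Rightarrow> 'v) \<Rightarrow> complex"
    define \<psi> where "\<psi> = (\<lambda>u. \<Sum>s = 1..n. \<phi> (u(s := \<rho> s h (u s))))"
    show "tensor_action n sc V \<rho> h w \<phi> = tensor_scale ?\<mu> w \<phi>"
    proof (cases "multilinear_form n sc V \<phi>")
      case True
      have "F_tensor B \<psi> = ?\<mu> * F_tensor B \<phi>" if "B \<in> arrangements n {1..m}" for B
        using fun_cong[OF F_tensor_weight[OF that h], of \<phi>] True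
        by (simp add: tensor_action_def tensor_scale_def \<psi>_def)
      then have "?f t' z \<psi> = ?\<mu> * ?f t' z \<phi>" for t'
        unfolding weight_function_nodes by (simp add: tensor_sum_apply tensor_scale_def sum_distrib_left mult_ac)
      then have "((\<lambda>e. ?\<mu> * ?f (move t e) z \<phi>) \<longlongrightarrow> w \<psi>) (at 0)"
        using regular_value_limit[OF w, of \<psi>] by simp
      moreover have "((\<lambda>e. ?\<mu> * ?f (move t e) z \<phi>) \<longlongrightarrow> ?\<mu> * w \<phi>) (at 0)"
        by (intro tendsto_intros regular_value_limit[OF w])
      ultimately have "w \<psi> = ?\<mu> * w \<phi>" by (intro tendsto_unique[of "at (0::complex)"]) auto
      then show ?thesis using True by (simp add: tensor_action_def tensor_scale_def \<psi>_def)
    next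
      case False
      then have "?f t' z \<phi> = 0" for t'
        unfolding weight_function_nodes by (simp add: tensor_sum_apply tensor_scale_def F_tensor_def pure_tensor_def)
      then have "((\<lambda>e. 0) \<longlongrightarrow> w \<phi>) (at (0::complex))"
        using regular_value_limit[OF w, of \<phi>] by simp
      then have "w \<phi> = 0" by (simp add: tendsto_const_iff)
      then show ?thesis using False by (simp add: tensor_action_def tensor_scale_def)
    qed
  qed
qed

text \<open>Coordinates of a critical point coincide only where the coupling is 0. For two variables
  this makes the roots orthogonal, so the nodes are not joined; for a variable and a point
  \<open>z\<close> it makes the highest weight vanish on the coroot. These are the two conditions
  under which the poles cancel.\<close>

lemma regular_value_at_critical_point:
  assumes dom: "\<And>s. s \<in> {1..n} \<Longrightarrow> integral_dominant r (\<Lambda> s)"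
    and crit: "critical_point r n \<Lambda> l z t"
  shows "regular_value m n (tensor_space n sc V) (weight_function r n sc V \<rho> v l) t z (bethe_vector r n sc V \<rho> v l t z)"
proof -
  have adm: "admissible (nodes m t z)" using crit by (simp add: critical_point_iff)
  have "\<exists>w. regular_value m n (tensor_space n sc V) (weight_function r n sc V \<rho> v l) t z w"
  proof (rule regular_value_exists)
    fix a b assume ab: "a \<in> {1..m}" "b \<in> {1..m}" "a \<noteq> b" "t a = t b"
    have "(a, b) \<in> edge_pairs m n" using ab by (auto simp: edge_pairs_def)
    then have "coupling a b = 0" using adm ab unfolding admissible_def by (auto simp: nodes_def)
    then show "c a \<noteq> c b + 1 \<and> c b \<noteq> c a + 1"
      using weight_form_simple_root[OF color_range[OF ab(1)] color_range[OF ab(2)]] ab(2)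
      by (auto simp: coupling_def split: if_splits)
  next
    fix a k assume ak: "a \<in> {1..m}" "k \<in> {1..n}" "t a = z k"
    have "(a, m + k) \<in> edge_pairs m n" using ak by (auto simp: edge_pairs_def)
    then have "coupling a (m + k) = 0" using adm ak unfolding admissible_def by (auto simp: nodes_def)
    then show "\<Lambda> k (chev_H r (c a)) = 0"
      using weight_form_coroot[OF _ color_range[OF ak(1)], of "\<Lambda> k"] dom[OF ak(2)] ak(2)
      by (simp add: coupling_def integral_dominant_def)
  qed
  then obtain w where w: "regular_value m n (tensor_space n sc V) (weight_function r n sc V \<rho> v l) t z w" by blast
  have "bethe_vector r n sc V \<rho> v l t z = w"
    unfolding bethe_vector_def
    by (rule the_equality[where P = "regular_value m n (tensor_space n sc V) (weight_function r n sc V \<rho> v l) t z" and a = w])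
      (rule w, rule regular_value_unique[OF _ w])
  with w show ?thesis by simp
qed

end

theorem corollary7p1:
  fixes r n :: nat
    and \<Lambda> :: "nat \<Rightarrow> weight"
    and l :: "nat \<Rightarrow> nat"
    and sc :: "complex \<Rightarrow> 'v::ab_group_add \<Rightarrow> 'v"
    and V :: "nat \<Rightarrow> 'v set"
    and \<rho> :: "nat \<Rightarrow> complex mat \<Rightarrow> 'v \<Rightarrow> 'v"
    and v :: "nat \<Rightarrow> 'v"
    and z t0 :: "nat \<Rightarrow> complex"
  assumes "\<And>s. s \<in> {1..n} \<Longrightarrow> integral_dominant r (\<Lambda> s)"
    and "integral_dominant r (lowered_weight r n \<Lambda> l)"
    and "\<And>s. s \<in> {1..n} \<Longrightarrow> irreducible_module r sc (V s) (\<rho> s)"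
    and "\<And>s. s \<in> {1..n} \<Longrightarrow> highest_weight_vector r sc (V s) (\<rho> s) (\<Lambda> s) (v s)"
    and "inj_on z {1..n}"
    and "nondegenerate_critical_point r n \<Lambda> l z t0"
  shows "bethe_vector r n sc V \<rho> v l t0 z
           \<in> weight_space r tensor_scale (tensor_space n sc V) (tensor_action n sc V \<rho>)
               (lowered_weight r n \<Lambda> l)
         \<and> bethe_vector r n sc V \<rho> v l t0 z \<noteq> 0"
proof -
  interpret highest_weight_factors r n \<Lambda> sc V \<rho> v l
    by (intro highest_weight_factors.intro assms(3,4))
  have crit: "critical_point r n \<Lambda> l z t0"
    using assms(6) by (simp add: nondegenerate_critical_point_def)
  have regular: "regular_value (var_count r l) n (tensor_space n sc V) (weight_function r n sc V \<rho> v l) t0 z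
      (bethe_vector r n sc V \<rho> v l t0 z)"
    by (rule regular_value_at_critical_point[OF _ crit]) (rule assms(1))
  moreover have "bethe_vector r n sc V \<rho> v l t0 z \<noteq> 0"
    by (rule regular_value_nonzero[OF _ assms(5,6) regular]) (rule assms(1))
  ultimately show ?thesis using regular_value_weight_space by blast
qed

end
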